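(* Let $R$ be a commutative ring. The biset category $\mathbb B=\mathbb B_R$ is a tensor category over $R$, in the sense that it is an $R$-linear additive category with a symmetric monoidal structure $\otimes$ that is $R$-bilinear.
   Context: All categories are finite (finitely many objects and morphisms) and $\mathrm{Set}$ is the category of finite sets. A $(\mathcal C,\mathcal D)$-biset is a functor $\Omega:\mathcal C\times\mathcal D^{\mathrm{op}}\to\mathrm{Set}$. The composite of a $(\mathcal C,\mathcal D)$-biset $\Omega$ and a $(\mathcal D,\mathcal E)$-biset $\Psi$ is the $(\mathcal C,\mathcal E)$-biset $(\Omega\circ\Psi)(x,z)=\left(\bigsqcup_{y}\Omega(x,y)\times\Psi(y,z)\right)/\sim$, with $\sim$ generated by $(u\beta,v)\sim(u,\beta v)$ for morphisms $\beta$ of $\mathcal D$. $A_R(\mathcal D,\mathcal C)$ is $R\otimes_{\mathbb Z}$ of the Grothendieck group of finite $(\mathcal D,\mathcal C)$-bisets with respect to disjoint union. The biset category $\mathbb B_R$ has finite categories as objects, $\mathrm{Hom}_{\mathbb B_R}(\mathcal C,\mathcal D)=A_R(\mathcal D,\mathcal C)$, and composition the $R$-bilinear extension of $\circ$; the identity of $\mathcal C$ is the biset $(x,y)\mapsto\mathrm{Hom}_{\mathcal C}(y,x)$. The tensor product $\otimes$ on objects is the product of categories $\mathcal C\times\mathcal D$, on morphisms it is the $R$-bilinear extension of the product of bisets $(\Omega\times\Psi)((x,x'),(y,y'))=\Omega(x,y)\times\Psi(x',y')$, and the unit is the category $\mathbf 1$ with one object and one morphism. *)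

theory Defs
  imports "HOL-Algebra.Module" "HOL-Algebra.Free_Abelian_Groups" "HOL-Library.FSet"
begin

section \<open>Categories and functors\<close>

text \<open>Hom-sets of distinct pairs of objects need not be disjoint, so composition and the
  morphism part of a functor take the objects as arguments.  For \<open>f : x \<rightarrow> y\<close> and
  \<open>g : y \<rightarrow> z\<close> the composite \<open>g \<circ> f\<close> is \<open>Comp C x y z g f\<close>.\<close>

record ('o, 'm) category =
  Obj :: "'o set"
  Mor :: "'o \<Rightarrow> 'o \<Rightarrow> 'm set"
  Ident :: "'o \<Rightarrow> 'm"
  Comp :: "'o \<Rightarrow> 'o \<Rightarrow> 'o \<Rightarrow> 'm \<Rightarrow> 'm \<Rightarrow> 'm"

locale category =
  fixes C :: "('o, 'm, 'z) category_scheme"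
  assumes Ident_in: "x \<in> Obj C \<Longrightarrow> Ident C x \<in> Mor C x x"
    and Comp_in: "\<lbrakk>x \<in> Obj C; y \<in> Obj C; z \<in> Obj C; f \<in> Mor C x y; g \<in> Mor C y z\<rbrakk>
      \<Longrightarrow> Comp C x y z g f \<in> Mor C x z"
    and Comp_Ident_left: "\<lbrakk>x \<in> Obj C; y \<in> Obj C; f \<in> Mor C x y\<rbrakk>
      \<Longrightarrow> Comp C x y y (Ident C y) f = f"
    and Comp_Ident_right: "\<lbrakk>x \<in> Obj C; y \<in> Obj C; f \<in> Mor C x y\<rbrakk>
      \<Longrightarrow> Comp C x x y f (Ident C x) = f"
    and Comp_assoc: "\<lbrakk>w \<in> Obj C; x \<in> Obj C; y \<in> Obj C; z \<in> Obj C;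
        f \<in> Mor C w x; g \<in> Mor C x y; h \<in> Mor C y z\<rbrakk>
      \<Longrightarrow> Comp C w y z h (Comp C w x y g f) = Comp C w x z (Comp C x y z h g) f"

definition finite_category :: "('o, 'm) category \<Rightarrow> bool" where
  "finite_category C \<longleftrightarrow> category C \<and> finite (Obj C) \<and>
     (\<forall>x\<in>Obj C. \<forall>y\<in>Obj C. finite (Mor C x y))"

definition iso_arrow :: "('o, 'm, 'z) category_scheme \<Rightarrow> 'o \<Rightarrow> 'o \<Rightarrow> 'm \<Rightarrow> bool" where
  "iso_arrow C x y f \<longleftrightarrow> f \<in> Mor C x y \<and>
     (\<exists>g\<in>Mor C y x. Comp C x y x g f = Ident C x \<and> Comp C y x y f g = Ident C y)"

definition op_cat :: "('o, 'm) category \<Rightarrow> ('o, 'm) category" where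
  "op_cat C = \<lparr>Obj = Obj C, Mor = (\<lambda>x y. Mor C y x), Ident = Ident C,
     Comp = (\<lambda>x y z g f. Comp C z y x f g)\<rparr>"

definition fin_set_cat :: "('e set, 'e \<Rightarrow> 'e) category" where
  "fin_set_cat = \<lparr>Obj = {A. finite A}, Mor = (\<lambda>A B. A \<rightarrow>\<^sub>E B), Ident = (\<lambda>A. \<lambda>a\<in>A. a),
     Comp = (\<lambda>A B D g f. compose A g f)\<rparr>"

record ('o1, 'm1, 'o2, 'm2) functr =
  FObj :: "'o1 \<Rightarrow> 'o2"
  FMor :: "'o1 \<Rightarrow> 'o1 \<Rightarrow> 'm1 \<Rightarrow> 'm2"

locale functr =
  fixes C :: "('o1, 'm1) category" and D :: "('o2, 'm2) category"
    and F :: "('o1, 'm1, 'o2, 'm2) functr"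
  assumes FObj_in: "x \<in> Obj C \<Longrightarrow> FObj F x \<in> Obj D"
    and FMor_in: "\<lbrakk>x \<in> Obj C; y \<in> Obj C; f \<in> Mor C x y\<rbrakk>
      \<Longrightarrow> FMor F x y f \<in> Mor D (FObj F x) (FObj F y)"
    and FMor_Ident: "x \<in> Obj C \<Longrightarrow> FMor F x x (Ident C x) = Ident D (FObj F x)"
    and FMor_Comp: "\<lbrakk>x \<in> Obj C; y \<in> Obj C; z \<in> Obj C; f \<in> Mor C x y; g \<in> Mor C y z\<rbrakk>
      \<Longrightarrow> FMor F x z (Comp C x y z g f) =
          Comp D (FObj F x) (FObj F y) (FObj F z) (FMor F y z g) (FMor F x y f)"

definition nat_isomorphic :: "('o1, 'm1) category \<Rightarrow> ('o2, 'm2) category \<Rightarrow>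
    ('o1, 'm1, 'o2, 'm2) functr \<Rightarrow> ('o1, 'm1, 'o2, 'm2) functr \<Rightarrow> bool" where
  "nat_isomorphic C D F G \<longleftrightarrow> (\<exists>\<eta>.
     (\<forall>x\<in>Obj C. iso_arrow D (FObj F x) (FObj G x) (\<eta> x)) \<and>
     (\<forall>x\<in>Obj C. \<forall>y\<in>Obj C. \<forall>f\<in>Mor C x y.
        Comp D (FObj F x) (FObj F y) (FObj G y) (\<eta> y) (FMor F x y f) =
        Comp D (FObj F x) (FObj G x) (FObj G y) (FMor G x y f) (\<eta> x)))"


section \<open>A universe for finite categories and finite sets\<close>

text \<open>The objects and morphisms of the finite categories, and the elements of the finite sets,
  are taken from a type that contains \<open>'a\<close> and is closed under pairs, tagged unions and the
  formation of finite sets.  It is infinite, so every finite category and every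
  finite set is represented up to isomorphism.\<close>

datatype 'a univ =
    Atom 'a
  | UPair (ufst: "'a univ") (usnd: "'a univ")
  | UInl "'a univ"
  | UInr "'a univ"
  | USet (uelems: "'a univ fset")

type_synonym 'a ucat = "('a univ, 'a univ) category"
type_synonym 'a ubiset = "('a univ, 'a univ, 'a univ set, 'a univ \<Rightarrow> 'a univ) functr"

definition prod_cat :: "'a ucat \<Rightarrow> 'a ucat \<Rightarrow> 'a ucat" where
  "prod_cat C D = \<lparr>
     Obj = {UPair x y | x y. x \<in> Obj C \<and> y \<in> Obj D},
     Mor = (\<lambda>p q. {UPair f g | f g. f \<in> Mor C (ufst p) (ufst q) \<and> g \<in> Mor D (usnd p) (usnd q)}),
     Ident = (\<lambda>p. UPair (Ident C (ufst p)) (Ident D (usnd p))),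
     Comp = (\<lambda>p q r n m. UPair (Comp C (ufst p) (ufst q) (ufst r) (ufst n) (ufst m))
                               (Comp D (usnd p) (usnd q) (usnd r) (usnd n) (usnd m)))\<rparr>"

definition unit_cat :: "'a ucat" where
  "unit_cat = \<lparr>Obj = {USet {||}}, Mor = (\<lambda>_ _. {USet {||}}), Ident = (\<lambda>_. USet {||}),
     Comp = (\<lambda>_ _ _ _ _. USet {||})\<rparr>"


section \<open>Bisets\<close>

definition biset :: "'a ucat \<Rightarrow> 'a ucat \<Rightarrow> 'a ubiset \<Rightarrow> bool" where
  "biset C D \<Omega> \<longleftrightarrow> functr (prod_cat C (op_cat D)) fin_set_cat \<Omega>"

definition biset_iso :: "'a ucat \<Rightarrow> 'a ucat \<Rightarrow> 'a ubiset \<Rightarrow> 'a ubiset \<Rightarrow> bool" where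
  "biset_iso C D = nat_isomorphic (prod_cat C (op_cat D)) fin_set_cat"

text \<open>For \<open>\<alpha> : x \<rightarrow> x'\<close> in \<open>C\<close> and \<open>\<beta> : y' \<rightarrow> y\<close> in \<open>D\<close>, \<open>bact \<Omega> x y x' y' \<alpha> \<beta> u\<close> is the
  element \<open>\<alpha> u \<beta>\<close> of \<open>\<Omega>(x', y')\<close>, where \<open>u \<in> \<Omega>(x, y)\<close>.\<close>

abbreviation bact :: "'a ubiset \<Rightarrow> 'a univ \<Rightarrow> 'a univ \<Rightarrow> 'a univ \<Rightarrow> 'a univ \<Rightarrow>
    'a univ \<Rightarrow> 'a univ \<Rightarrow> 'a univ \<Rightarrow> 'a univ" where
  "bact \<Omega> x y x' y' \<alpha> \<beta> u \<equiv> FMor \<Omega> (UPair x y) (UPair x' y') (UPair \<alpha> \<beta>) u"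

definition id_biset :: "'a ucat \<Rightarrow> 'a ubiset" where
  "id_biset C = \<lparr>
     FObj = (\<lambda>p. Mor C (usnd p) (ufst p)),
     FMor = (\<lambda>p q m. \<lambda>f\<in>Mor C (usnd p) (ufst p).
        Comp C (usnd q) (ufst p) (ufst q) (ufst m)
          (Comp C (usnd q) (usnd p) (ufst p) f (usnd m)))\<rparr>"

definition sum_biset :: "'a ubiset \<Rightarrow> 'a ubiset \<Rightarrow> 'a ubiset" where
  "sum_biset \<Omega> \<Psi> = \<lparr>
     FObj = (\<lambda>p. UInl ` FObj \<Omega> p \<union> UInr ` FObj \<Psi> p),
     FMor = (\<lambda>p q m. \<lambda>t\<in>UInl ` FObj \<Omega> p \<union> UInr ` FObj \<Psi> p.
        (case t of UInl u \<Rightarrow> UInl (FMor \<Omega> p q m u)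
                 | UInr v \<Rightarrow> UInr (FMor \<Psi> p q m v)))\<rparr>"

text \<open>An element \<open>(u, v)\<close> of the \<open>y\<close>-th summand of the disjoint union over \<open>y\<close> of
  \<open>\<Omega>(x, y) \<times> \<Psi>(y, z)\<close> is encoded as \<open>UPair y (UPair u v)\<close>.\<close>

definition bal_pairs :: "'a ucat \<Rightarrow> 'a ubiset \<Rightarrow> 'a ubiset \<Rightarrow> 'a univ \<Rightarrow> 'a univ \<Rightarrow> 'a univ set" where
  "bal_pairs D \<Omega> \<Psi> x z =
     {UPair y (UPair u v) | y u v. y \<in> Obj D \<and> u \<in> FObj \<Omega> (UPair x y) \<and> v \<in> FObj \<Psi> (UPair y z)}"

definition bal_gen :: "'a ucat \<Rightarrow> 'a ucat \<Rightarrow> 'a ucat \<Rightarrow> 'a ubiset \<Rightarrow> 'a ubiset \<Rightarrow>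
    'a univ \<Rightarrow> 'a univ \<Rightarrow> ('a univ \<times> 'a univ) set" where
  "bal_gen C D E \<Omega> \<Psi> x z =
     {(UPair y' (UPair (bact \<Omega> x y x y' (Ident C x) \<beta> u) v),
       UPair y (UPair u (bact \<Psi> y' z y z \<beta> (Ident E z) v))) | y y' \<beta> u v.
      y \<in> Obj D \<and> y' \<in> Obj D \<and> \<beta> \<in> Mor D y' y \<and>
      u \<in> FObj \<Omega> (UPair x y) \<and> v \<in> FObj \<Psi> (UPair y' z)}"

definition bal_class :: "'a ucat \<Rightarrow> 'a ucat \<Rightarrow> 'a ucat \<Rightarrow> 'a ubiset \<Rightarrow> 'a ubiset \<Rightarrow>
    'a univ \<Rightarrow> 'a univ \<Rightarrow> 'a univ \<Rightarrow> 'a univ" where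
  "bal_class C D E \<Omega> \<Psi> x z t =
     USet (Abs_fset ((bal_gen C D E \<Omega> \<Psi> x z \<union> (bal_gen C D E \<Omega> \<Psi> x z)\<inverse>)\<^sup>* `` {t}))"

definition comp_biset :: "'a ucat \<Rightarrow> 'a ucat \<Rightarrow> 'a ucat \<Rightarrow> 'a ubiset \<Rightarrow> 'a ubiset \<Rightarrow> 'a ubiset" where
  "comp_biset C D E \<Omega> \<Psi> = \<lparr>
     FObj = (\<lambda>p. bal_class C D E \<Omega> \<Psi> (ufst p) (usnd p) ` bal_pairs D \<Omega> \<Psi> (ufst p) (usnd p)),
     FMor = (\<lambda>p q m.
       \<lambda>K\<in>bal_class C D E \<Omega> \<Psi> (ufst p) (usnd p) ` bal_pairs D \<Omega> \<Psi> (ufst p) (usnd p).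
         the_elem ((\<lambda>t. let y = ufst t; u = ufst (usnd t); v = usnd (usnd t) in
             bal_class C D E \<Omega> \<Psi> (ufst q) (usnd q)
               (UPair y (UPair
                 (bact \<Omega> (ufst p) y (ufst q) y (ufst m) (Ident D y) u)
                 (bact \<Psi> y (usnd p) y (usnd q) (Ident D y) (usnd m) v))))
           ` fset (uelems K)))\<rparr>"

text \<open>The product of a \<open>(C, D)\<close>-biset and a \<open>(C', D')\<close>-biset, a \<open>(C \<times> C', D \<times> D')\<close>-biset.\<close>

definition prod_biset :: "'a ubiset \<Rightarrow> 'a ubiset \<Rightarrow> 'a ubiset" where
  "prod_biset \<Omega> \<Psi> =
     (let left = (\<lambda>p. UPair (ufst (ufst p)) (ufst (usnd p)));
          right = (\<lambda>p. UPair (usnd (ufst p)) (usnd (usnd p)));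
          pairs = (\<lambda>p. {UPair u v | u v. u \<in> FObj \<Omega> (left p) \<and> v \<in> FObj \<Psi> (right p)})
      in \<lparr>FObj = pairs,
          FMor = (\<lambda>p q m. \<lambda>t\<in>pairs p.
            UPair (FMor \<Omega> (left p) (left q) (left m) (ufst t))
                  (FMor \<Psi> (right p) (right q) (right m) (usnd t)))\<rparr>)"


section \<open>Grothendieck groups of bisets and extension of scalars\<close>

text \<open>The abelian group (written multiplicatively) with generators \<open>S\<close> and relators \<open>T\<close>.\<close>

definition presented_group :: "'g set \<Rightarrow> ('g \<Rightarrow>\<^sub>0 int) set \<Rightarrow> ('g \<Rightarrow>\<^sub>0 int) set monoid" where
  "presented_group S T = free_Abelian_group S Mod generate (free_Abelian_group S) T"

definition presented_gen :: "'g set \<Rightarrow> ('g \<Rightarrow>\<^sub>0 int) set \<Rightarrow> 'g \<Rightarrow> ('g \<Rightarrow>\<^sub>0 int) set" where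
  "presented_gen S T g =
     generate (free_Abelian_group S) T #>\<^bsub>free_Abelian_group S\<^esub> frag_of g"

definition iso_class :: "'a ucat \<Rightarrow> 'a ucat \<Rightarrow> 'a ubiset \<Rightarrow> 'a ubiset set" where
  "iso_class C D \<Omega> = {\<Psi>. biset C D \<Psi> \<and> biset_iso C D \<Omega> \<Psi>}"

definition iso_classes :: "'a ucat \<Rightarrow> 'a ucat \<Rightarrow> 'a ubiset set set" where
  "iso_classes C D = {iso_class C D \<Omega> | \<Omega>. biset C D \<Omega>}"

definition biset_relators :: "'a ucat \<Rightarrow> 'a ucat \<Rightarrow> ('a ubiset set \<Rightarrow>\<^sub>0 int) set" where
  "biset_relators C D =
     {frag_of (iso_class C D (sum_biset \<Omega> \<Psi>)) - frag_of (iso_class C D \<Omega>)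
        - frag_of (iso_class C D \<Psi>) | \<Omega> \<Psi>. biset C D \<Omega> \<and> biset C D \<Psi>}"

definition grothendieck :: "'a ucat \<Rightarrow> 'a ucat \<Rightarrow> ('a ubiset set \<Rightarrow>\<^sub>0 int) set monoid" where
  "grothendieck C D = presented_group (iso_classes C D) (biset_relators C D)"

text \<open>\<open>R \<otimes>\<^sub>\<int> G\<close>, for an abelian group \<open>G\<close> written multiplicatively: the quotient of the free
  abelian group on \<open>R \<times> G\<close> by the biadditivity relations, with \<open>r \<cdot> (s \<otimes> g) = (r s) \<otimes> g\<close>.
  The fields \<open>mult\<close> and \<open>one\<close> of a module record play no role.\<close>

definition tensor_relators :: "('r, 'k) ring_scheme \<Rightarrow> 'g monoid \<Rightarrow> ('r \<times> 'g \<Rightarrow>\<^sub>0 int) set" where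
  "tensor_relators R G =
     {frag_of (r \<oplus>\<^bsub>R\<^esub> s, g) - frag_of (r, g) - frag_of (s, g) | r s g.
        r \<in> carrier R \<and> s \<in> carrier R \<and> g \<in> carrier G} \<union>
     {frag_of (r, g \<otimes>\<^bsub>G\<^esub> h) - frag_of (r, g) - frag_of (r, h) | r g h.
        r \<in> carrier R \<and> g \<in> carrier G \<and> h \<in> carrier G}"

definition tensor_Z :: "('r, 'k) ring_scheme \<Rightarrow> 'g monoid \<Rightarrow> ('r, ('r \<times> 'g \<Rightarrow>\<^sub>0 int) set) module" where
  "tensor_Z R G =
     (let F = free_Abelian_group (carrier R \<times> carrier G);
          N = generate F (tensor_relators R G);
          Q = presented_group (carrier R \<times> carrier G) (tensor_relators R G)
      in \<lparr>carrier = carrier Q, monoid.mult = (\<lambda>_ _. undefined), one = undefined,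
          ring.zero = monoid.one Q, ring.add = monoid.mult Q,
          smult = (\<lambda>r A. N <#>\<^bsub>F\<^esub> (frag_extend (\<lambda>(s, g). frag_of (r \<otimes>\<^bsub>R\<^esub> s, g)) ` A))\<rparr>)"

definition pure_tensor :: "('r, 'k) ring_scheme \<Rightarrow> 'g monoid \<Rightarrow> 'r \<Rightarrow> 'g \<Rightarrow> ('r \<times> 'g \<Rightarrow>\<^sub>0 int) set" where
  "pure_tensor R G r g = presented_gen (carrier R \<times> carrier G) (tensor_relators R G) (r, g)"

type_synonym ('r, 'a) bmor = "('r \<times> ('a ubiset set \<Rightarrow>\<^sub>0 int) set \<Rightarrow>\<^sub>0 int) set"

definition A_mod :: "('r, 'k) ring_scheme \<Rightarrow> 'a ucat \<Rightarrow> 'a ucat \<Rightarrow> ('r, ('r, 'a) bmor) module" where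
  "A_mod R C D = tensor_Z R (grothendieck C D)"

definition biset_elt :: "('r, 'k) ring_scheme \<Rightarrow> 'a ucat \<Rightarrow> 'a ucat \<Rightarrow> 'a ubiset \<Rightarrow> ('r, 'a) bmor" where
  "biset_elt R C D \<Omega> = pure_tensor R (grothendieck C D) \<one>\<^bsub>R\<^esub>
     (presented_gen (iso_classes C D) (biset_relators C D) (iso_class C D \<Omega>))"

definition bilinear_map :: "('r, 'k) ring_scheme \<Rightarrow> ('r, 'm1) module \<Rightarrow> ('r, 'm2) module \<Rightarrow>
    ('r, 'm3) module \<Rightarrow> ('m1 \<Rightarrow> 'm2 \<Rightarrow> 'm3) \<Rightarrow> bool" where
  "bilinear_map R M N P f \<longleftrightarrow>
     (\<forall>a\<in>carrier M. \<forall>b\<in>carrier N. f a b \<in> carrier P) \<and>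
     (\<forall>a\<in>carrier M. \<forall>a'\<in>carrier M. \<forall>b\<in>carrier N. f (a \<oplus>\<^bsub>M\<^esub> a') b = f a b \<oplus>\<^bsub>P\<^esub> f a' b) \<and>
     (\<forall>a\<in>carrier M. \<forall>b\<in>carrier N. \<forall>b'\<in>carrier N. f a (b \<oplus>\<^bsub>N\<^esub> b') = f a b \<oplus>\<^bsub>P\<^esub> f a b') \<and>
     (\<forall>r\<in>carrier R. \<forall>a\<in>carrier M. \<forall>b\<in>carrier N. f (r \<odot>\<^bsub>M\<^esub> a) b = r \<odot>\<^bsub>P\<^esub> f a b) \<and>
     (\<forall>r\<in>carrier R. \<forall>a\<in>carrier M. \<forall>b\<in>carrier N. f a (r \<odot>\<^bsub>N\<^esub> b) = r \<odot>\<^bsub>P\<^esub> f a b)"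

text \<open>The \<open>R\<close>-bilinear extension of an operation \<open>h\<close> on bisets.  As the classes of bisets generate
  the modules, its values on the carriers do not depend on the choice made by \<open>SOME\<close>.\<close>

definition bilinear_extension :: "('r, 'k) ring_scheme \<Rightarrow> 'a ucat \<Rightarrow> 'a ucat \<Rightarrow> 'a ucat \<Rightarrow> 'a ucat \<Rightarrow>
    'a ucat \<Rightarrow> 'a ucat \<Rightarrow> ('a ubiset \<Rightarrow> 'a ubiset \<Rightarrow> 'a ubiset) \<Rightarrow>
    ('r, 'a) bmor \<Rightarrow> ('r, 'a) bmor \<Rightarrow> ('r, 'a) bmor" where
  "bilinear_extension R C1 D1 C2 D2 C3 D3 h =
     (SOME f. bilinear_map R (A_mod R C1 D1) (A_mod R C2 D2) (A_mod R C3 D3) f \<and>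
        (\<forall>\<Omega> \<Psi>. biset C1 D1 \<Omega> \<longrightarrow> biset C2 D2 \<Psi> \<longrightarrow>
           f (biset_elt R C1 D1 \<Omega>) (biset_elt R C2 D2 \<Psi>) = biset_elt R C3 D3 (h \<Omega> \<Psi>)))"


section \<open>Tensor categories\<close>

record ('o, 'm, 'r) lin_category = "('o, 'm) category" +
  HomMod :: "'o \<Rightarrow> 'o \<Rightarrow> ('r, 'm) module"

locale linear_category = cring R + category B
  for R :: "('r, 'k) ring_scheme" (structure) and B :: "('o, 'm, 'r) lin_category" +
  assumes HomMod_module: "\<lbrakk>X \<in> Obj B; Y \<in> Obj B\<rbrakk> \<Longrightarrow> module R (HomMod B X Y)"
    and carrier_HomMod: "\<lbrakk>X \<in> Obj B; Y \<in> Obj B\<rbrakk> \<Longrightarrow> carrier (HomMod B X Y) = Mor B X Y"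
    and Comp_bilinear: "\<lbrakk>X \<in> Obj B; Y \<in> Obj B; Z \<in> Obj B\<rbrakk>
      \<Longrightarrow> bilinear_map R (HomMod B Y Z) (HomMod B X Y) (HomMod B X Z) (Comp B X Y Z)"

definition zero_object :: "('o, 'm, 'z) category_scheme \<Rightarrow> 'o \<Rightarrow> bool" where
  "zero_object B Z \<longleftrightarrow> Z \<in> Obj B \<and>
     (\<forall>X\<in>Obj B. (\<exists>!f. f \<in> Mor B X Z) \<and> (\<exists>!f. f \<in> Mor B Z X))"

definition is_biproduct :: "('o, 'm, 'r) lin_category \<Rightarrow> 'o \<Rightarrow> 'o \<Rightarrow> 'o \<Rightarrow> 'm \<Rightarrow> 'm \<Rightarrow> 'm \<Rightarrow> 'm \<Rightarrow> bool" where
  "is_biproduct B X Y S i j p q \<longleftrightarrow> S \<in> Obj B \<and>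
     i \<in> Mor B X S \<and> j \<in> Mor B Y S \<and> p \<in> Mor B S X \<and> q \<in> Mor B S Y \<and>
     Comp B X S X p i = Ident B X \<and> Comp B Y S Y q j = Ident B Y \<and>
     Comp B Y S X p j = \<zero>\<^bsub>HomMod B Y X\<^esub> \<and> Comp B X S Y q i = \<zero>\<^bsub>HomMod B X Y\<^esub> \<and>
     Comp B S X S i p \<oplus>\<^bsub>HomMod B S S\<^esub> Comp B S Y S j q = Ident B S"

locale additive_linear_category = linear_category R B
  for R :: "('r, 'k) ring_scheme" (structure) and B :: "('o, 'm, 'r) lin_category" +
  assumes ex_zero_object: "\<exists>Z. zero_object B Z"
    and ex_biproduct: "\<lbrakk>X \<in> Obj B; Y \<in> Obj B\<rbrakk> \<Longrightarrow> \<exists>S i j p q. is_biproduct B X Y S i j p q"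

text \<open>For \<open>f : X \<rightarrow> X'\<close> and \<open>g : Y \<rightarrow> Y'\<close>, \<open>tm X X' Y Y' f g\<close> is \<open>f \<otimes> g\<close>.  The associator
  \<open>a X Y Z\<close> goes from \<open>(X \<otimes> Y) \<otimes> Z\<close> to \<open>X \<otimes> (Y \<otimes> Z)\<close>, the unitors \<open>l X\<close> and \<open>r X\<close> from
  \<open>U \<otimes> X\<close> and \<open>X \<otimes> U\<close> to \<open>X\<close>, and the symmetry \<open>s X Y\<close> from \<open>X \<otimes> Y\<close> to \<open>Y \<otimes> X\<close>.\<close>

locale symmetric_monoidal_category = category B
  for B :: "('o, 'm, 'z) category_scheme" +
  fixes to :: "'o \<Rightarrow> 'o \<Rightarrow> 'o"
    and tm :: "'o \<Rightarrow> 'o \<Rightarrow> 'o \<Rightarrow> 'o \<Rightarrow> 'm \<Rightarrow> 'm \<Rightarrow> 'm"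
    and U :: 'o
    and a :: "'o \<Rightarrow> 'o \<Rightarrow> 'o \<Rightarrow> 'm"
    and l :: "'o \<Rightarrow> 'm"
    and r :: "'o \<Rightarrow> 'm"
    and s :: "'o \<Rightarrow> 'o \<Rightarrow> 'm"
  assumes to_in: "\<lbrakk>X \<in> Obj B; Y \<in> Obj B\<rbrakk> \<Longrightarrow> to X Y \<in> Obj B"
    and tm_in: "\<lbrakk>X \<in> Obj B; X' \<in> Obj B; Y \<in> Obj B; Y' \<in> Obj B; f \<in> Mor B X X'; g \<in> Mor B Y Y'\<rbrakk>
      \<Longrightarrow> tm X X' Y Y' f g \<in> Mor B (to X Y) (to X' Y')"
    and tm_Ident: "\<lbrakk>X \<in> Obj B; Y \<in> Obj B\<rbrakk>
      \<Longrightarrow> tm X X Y Y (Ident B X) (Ident B Y) = Ident B (to X Y)"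
    and tm_Comp: "\<lbrakk>X \<in> Obj B; X' \<in> Obj B; X'' \<in> Obj B; Y \<in> Obj B; Y' \<in> Obj B; Y'' \<in> Obj B;
        f \<in> Mor B X X'; f' \<in> Mor B X' X''; g \<in> Mor B Y Y'; g' \<in> Mor B Y' Y''\<rbrakk>
      \<Longrightarrow> tm X X'' Y Y'' (Comp B X X' X'' f' f) (Comp B Y Y' Y'' g' g) =
          Comp B (to X Y) (to X' Y') (to X'' Y'') (tm X' X'' Y' Y'' f' g') (tm X X' Y Y' f g)"
    and U_in: "U \<in> Obj B"
    and a_iso: "\<lbrakk>X \<in> Obj B; Y \<in> Obj B; Z \<in> Obj B\<rbrakk>
      \<Longrightarrow> iso_arrow B (to (to X Y) Z) (to X (to Y Z)) (a X Y Z)"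
    and a_natural: "\<lbrakk>X \<in> Obj B; X' \<in> Obj B; Y \<in> Obj B; Y' \<in> Obj B; Z \<in> Obj B; Z' \<in> Obj B;
        f \<in> Mor B X X'; g \<in> Mor B Y Y'; h \<in> Mor B Z Z'\<rbrakk>
      \<Longrightarrow> Comp B (to (to X Y) Z) (to (to X' Y') Z') (to X' (to Y' Z'))
            (a X' Y' Z') (tm (to X Y) (to X' Y') Z Z' (tm X X' Y Y' f g) h) =
          Comp B (to (to X Y) Z) (to X (to Y Z)) (to X' (to Y' Z'))
            (tm X X' (to Y Z) (to Y' Z') f (tm Y Y' Z Z' g h)) (a X Y Z)"
    and l_iso: "X \<in> Obj B \<Longrightarrow> iso_arrow B (to U X) X (l X)"
    and l_natural: "\<lbrakk>X \<in> Obj B; X' \<in> Obj B; f \<in> Mor B X X'\<rbrakk>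
      \<Longrightarrow> Comp B (to U X) (to U X') X' (l X') (tm U U X X' (Ident B U) f) =
          Comp B (to U X) X X' f (l X)"
    and r_iso: "X \<in> Obj B \<Longrightarrow> iso_arrow B (to X U) X (r X)"
    and r_natural: "\<lbrakk>X \<in> Obj B; X' \<in> Obj B; f \<in> Mor B X X'\<rbrakk>
      \<Longrightarrow> Comp B (to X U) (to X' U) X' (r X') (tm X X' U U f (Ident B U)) =
          Comp B (to X U) X X' f (r X)"
    and s_in: "\<lbrakk>X \<in> Obj B; Y \<in> Obj B\<rbrakk> \<Longrightarrow> s X Y \<in> Mor B (to X Y) (to Y X)"
    and s_natural: "\<lbrakk>X \<in> Obj B; X' \<in> Obj B; Y \<in> Obj B; Y' \<in> Obj B; f \<in> Mor B X X'; g \<in> Mor B Y Y'\<rbrakk>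
      \<Longrightarrow> Comp B (to X Y) (to X' Y') (to Y' X') (s X' Y') (tm X X' Y Y' f g) =
          Comp B (to X Y) (to Y X) (to Y' X') (tm Y Y' X X' g f) (s X Y)"
    and pentagon: "\<lbrakk>W \<in> Obj B; X \<in> Obj B; Y \<in> Obj B; Z \<in> Obj B\<rbrakk>
      \<Longrightarrow> Comp B (to (to (to W X) Y) Z) (to (to W X) (to Y Z)) (to W (to X (to Y Z)))
            (a W X (to Y Z)) (a (to W X) Y Z) =
          Comp B (to (to (to W X) Y) Z) (to W (to (to X Y) Z)) (to W (to X (to Y Z)))
            (tm W W (to (to X Y) Z) (to X (to Y Z)) (Ident B W) (a X Y Z))
            (Comp B (to (to (to W X) Y) Z) (to (to W (to X Y)) Z) (to W (to (to X Y) Z))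
              (a W (to X Y) Z) (tm (to (to W X) Y) (to W (to X Y)) Z Z (a W X Y) (Ident B Z)))"
    and triangle: "\<lbrakk>X \<in> Obj B; Y \<in> Obj B\<rbrakk>
      \<Longrightarrow> Comp B (to (to X U) Y) (to X (to U Y)) (to X Y)
            (tm X X (to U Y) Y (Ident B X) (l Y)) (a X U Y) =
          tm (to X U) X Y Y (r X) (Ident B Y)"
    and hexagon: "\<lbrakk>X \<in> Obj B; Y \<in> Obj B; Z \<in> Obj B\<rbrakk>
      \<Longrightarrow> Comp B (to (to X Y) Z) (to (to Y Z) X) (to Y (to Z X)) (a Y Z X)
            (Comp B (to (to X Y) Z) (to X (to Y Z)) (to (to Y Z) X) (s X (to Y Z)) (a X Y Z)) =
          Comp B (to (to X Y) Z) (to Y (to X Z)) (to Y (to Z X))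
            (tm Y Y (to X Z) (to Z X) (Ident B Y) (s X Z))
            (Comp B (to (to X Y) Z) (to (to Y X) Z) (to Y (to X Z)) (a Y X Z)
              (tm (to X Y) (to Y X) Z Z (s X Y) (Ident B Z)))"
    and symmetry: "\<lbrakk>X \<in> Obj B; Y \<in> Obj B\<rbrakk>
      \<Longrightarrow> Comp B (to X Y) (to Y X) (to X Y) (s Y X) (s X Y) = Ident B (to X Y)"

locale tensor_category = additive_linear_category R B + symmetric_monoidal_category B to tm U a l r s
  for R :: "('r, 'k) ring_scheme" (structure) and B :: "('o, 'm, 'r) lin_category"
    and to tm U a l r s +
  assumes tm_bilinear: "\<lbrakk>X \<in> Obj B; X' \<in> Obj B; Y \<in> Obj B; Y' \<in> Obj B\<rbrakk>
    \<Longrightarrow> bilinear_map R (HomMod B X X') (HomMod B Y Y') (HomMod B (to X Y) (to X' Y')) (tm X X' Y Y')"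


section \<open>The biset category\<close>

text \<open>A morphism from \<open>X\<close> to \<open>Y\<close> is an element of \<open>A_R(Y, X)\<close>, so that \<open>g \<circ> f\<close> extends the
  composite of a \<open>(Z, Y)\<close>-biset and a \<open>(Y, X)\<close>-biset.\<close>

definition biset_category :: "('r, 'k) ring_scheme \<Rightarrow> ('a ucat, ('r, 'a) bmor, 'r) lin_category" where
  "biset_category R = \<lparr>
     Obj = {C. finite_category C},
     Mor = (\<lambda>X Y. carrier (A_mod R Y X)),
     Ident = (\<lambda>X. biset_elt R X X (id_biset X)),
     Comp = (\<lambda>X Y Z. bilinear_extension R Z Y Y X Z X (comp_biset Z Y X)),
     HomMod = (\<lambda>X Y. A_mod R Y X)\<rparr>"

definition tensor_mor :: "('r, 'k) ring_scheme \<Rightarrow> 'a ucat \<Rightarrow> 'a ucat \<Rightarrow> 'a ucat \<Rightarrow> 'a ucat \<Rightarrow>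
    ('r, 'a) bmor \<Rightarrow> ('r, 'a) bmor \<Rightarrow> ('r, 'a) bmor" where
  "tensor_mor R X X' Y Y' =
     bilinear_extension R X' X Y' Y (prod_cat X' Y') (prod_cat X Y) prod_biset"

end

theory Submission
  imports Defs
begin

text \<open>A linear map out of \<open>A_R(C, D)\<close> is the same as an isomorphism-invariant additive function on
  bisets, so composition and tensor product extend bilinearly, and every multilinear identity need only
  be checked on bisets, up to isomorphism.  There the universal property of \<open>\<Omega> \<circ> \<Psi>\<close> (balanced maps)
  gives the isomorphisms.  The structure morphisms come from functors: \<open>\<phi> : X \<rightarrow> Y\<close> induces the biset
  \<open>(y, x) \<mapsto> Y(\<phi> x, y)\<close>, compatibly with composition and products, so each coherence condition reduces
  to an equality of functors.  Biproducts are disjoint unions of categories, and the zero object is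
  the empty category.\<close>

section \<open>Presented abelian groups\<close>

text \<open>Functor bisets behave differently on the two sides. Composing \<Omega> on the right with
  the biset of \<phi> is restriction along \<phi>, a co-Yoneda computation; composing on the left is
  induction, in general a genuine quotient, which becomes computable when \<phi> is invertible. All
  structure functors are invertible, and this lets both sides of a naturality square be compared.
  The projections of a biproduct are in general not functor bisets: they use the same hom-sets with
  the roles of the variables exchanged, and the two composites of injection after projection add up
  to the identity because a morphism of a disjoint union stays in one half. Scalars and bisets enter
  through two successive presentations, of the Grothendieck group and of its tensor product with
  \<open>R\<close>; all relators of both have the form a - b - c, so one locale serves both.
  Bilinear extensions are selected by \<open>SOME\<close>, so existence comes before any
  computation; it is obtained by currying. Classes of the balanced relation are coded as finite sets
  in the universe, and the finiteness of the middle category makes this coding faithful.\<close>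

definition additive_relators :: "('g \<times> 'g \<times> 'g) set \<Rightarrow> ('g \<Rightarrow>\<^sub>0 int) set" where
  "additive_relators Q = (\<lambda>(a, b, c). frag_of a - frag_of b - frag_of c) ` Q"

text \<open>A triple \<open>(a, b, c)\<close> stands for the relation a = b c. Disjoint union in the
  Grothendieck group and biadditivity in the tensor product both have this form, and the locale is
  instantiated once for each.\<close>

locale additive_presentation =
  fixes S :: "'g set" and Q :: "('g \<times> 'g \<times> 'g) set"
  assumes Q_subset: "Q \<subseteq> S \<times> S \<times> S"
begin

abbreviation "F \<equiv> free_Abelian_group S"
abbreviation "N \<equiv> generate F (additive_relators Q)"
abbreviation "P \<equiv> presented_group S (additive_relators Q)"
abbreviation "gen \<equiv> presented_gen S (additive_relators Q)"

sublocale F: comm_group F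
  by (rule abelian_free_Abelian_group)

lemma relators_subset: "additive_relators Q \<subseteq> carrier F"
proof
  fix t assume "t \<in> additive_relators Q"
  then obtain a b c where "(a, b, c) \<in> Q" and t: "t = frag_of a - frag_of b - frag_of c"
    by (auto simp: additive_relators_def)
  then have abc: "a \<in> S" "b \<in> S" "c \<in> S"
    using Q_subset by auto
  have "Poly_Mapping.keys (frag_of a - frag_of b - frag_of c) \<subseteq> S"
    using abc by (intro keys_diff[THEN order_trans] Un_least) auto
  then show "t \<in> carrier F"
    by (simp add: t)
qed

lemma subgroup_N: "subgroup N F"
  by (rule F.generate_is_subgroup[OF relators_subset])

sublocale normal N F
  by (simp add: F.normal_iff_subgroup subgroup_N)

sublocale P: comm_group P
  unfolding presented_group_def by (rule F.abelian_FactGroup[OF subgroup_N])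

lemma coset_hom: "(\<lambda>x. N #>\<^bsub>F\<^esub> x) \<in> hom F P"
  unfolding presented_group_def by (rule r_coset_hom_Mod)

sublocale coset: group_hom F P "\<lambda>x. N #>\<^bsub>F\<^esub> x"
  by unfold_locales (rule coset_hom)

lemma gen_coset: "gen g = N #>\<^bsub>F\<^esub> frag_of g"
  by (simp add: presented_gen_def)

lemma carrier_P: "carrier P = (\<lambda>x. N #>\<^bsub>F\<^esub> x) ` carrier F"
  by (simp add: presented_group_def carrier_FactGroup)

lemma gen_in: "g \<in> S \<Longrightarrow> gen g \<in> carrier P"
  using coset.hom_closed[of "frag_of g"] by (simp add: gen_coset)

lemma coset_diff:
  assumes "x \<in> carrier F" "y \<in> carrier F"
  shows "N #>\<^bsub>F\<^esub> (x - y) = (N #>\<^bsub>F\<^esub> x) \<otimes>\<^bsub>P\<^esub> inv\<^bsub>P\<^esub> (N #>\<^bsub>F\<^esub> y)"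
proof -
  have "N #>\<^bsub>F\<^esub> (x - y) = N #>\<^bsub>F\<^esub> (x \<otimes>\<^bsub>F\<^esub> inv\<^bsub>F\<^esub> y)"
    using assms by simp
  also have "\<dots> = (N #>\<^bsub>F\<^esub> x) \<otimes>\<^bsub>P\<^esub> inv\<^bsub>P\<^esub> (N #>\<^bsub>F\<^esub> y)"
    using assms by (simp only: coset.hom_mult coset.hom_inv F.inv_closed)
  finally show ?thesis .
qed

lemma gen_relation:
  assumes "(a, b, c) \<in> Q"
  shows "gen a = gen b \<otimes>\<^bsub>P\<^esub> gen c"
proof -
  have abc: "a \<in> S" "b \<in> S" "c \<in> S"
    using assms Q_subset by auto
  have ab: "frag_of a - frag_of b \<in> carrier F"
    using keys_diff[of "frag_of a" "frag_of b"] abc by auto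
  have "frag_of a - frag_of b - frag_of c \<in> N"
    by (rule generate.incl) (use assms in \<open>force simp: additive_relators_def\<close>)
  then have "N #>\<^bsub>F\<^esub> (frag_of a - frag_of b - frag_of c) = \<one>\<^bsub>P\<^esub>"
    by (simp add: presented_group_def F.coset_join2 rcos_const subgroup_N)
  then have "gen a \<otimes>\<^bsub>P\<^esub> inv\<^bsub>P\<^esub> gen b \<otimes>\<^bsub>P\<^esub> inv\<^bsub>P\<^esub> gen c = \<one>\<^bsub>P\<^esub>"
    using ab abc by (simp add: coset_diff gen_coset del: carrier_free_Abelian_group_iff)
  then have "gen a \<otimes>\<^bsub>P\<^esub> inv\<^bsub>P\<^esub> gen b = gen c"
    using abc by (simp add: P.inv_unique' P.inv_equality gen_in P.inv_solve_right')
  then show ?thesis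
    using abc by (metis P.inv_solve_right P.m_comm gen_in)
qed

text \<open>The last case mirrors induction by differences in the free abelian group. It covers
  products and inverses together, and an equation between homomorphisms passes through it
  directly.\<close>

lemma P_induct [consumes 1, case_names gen one mult]:
  assumes "x \<in> carrier P"
    and gen: "\<And>g. g \<in> S \<Longrightarrow> Pr (gen g)"
    and one: "Pr \<one>\<^bsub>P\<^esub>"
    and mult: "\<And>a b. \<lbrakk>a \<in> carrier P; b \<in> carrier P; Pr a; Pr b\<rbrakk> \<Longrightarrow> Pr (a \<otimes>\<^bsub>P\<^esub> inv\<^bsub>P\<^esub> b)"
  shows "Pr x"
proof -
  obtain c where x: "x = N #>\<^bsub>F\<^esub> c" and c: "c \<in> carrier F"
    using assms(1) by (auto simp: carrier_P)
  from c have "Poly_Mapping.keys c \<subseteq> S" by simp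
  then have "Pr (N #>\<^bsub>F\<^esub> c)"
  proof (induction c rule: free_Abelian_group_induct[consumes 1])
    case 1
    show ?case using one coset.hom_one by simp
  next
    case (2 x y)
    then show ?case
      using mult[of "N #>\<^bsub>F\<^esub> x" "N #>\<^bsub>F\<^esub> y"] coset_diff[of x y] coset.hom_closed[of x] coset.hom_closed[of y]
      by simp
  next
    case (3 a)
    then show ?case using gen by (simp add: gen_coset)
  qed
  then show ?thesis by (simp add: x)
qed

text \<open>The extension of \<open>f\<close> to the free group kills every relator, so its kernel
  contains the subgroup generated by them and it factors through the quotient.\<close>

lemma P_universal:
  assumes H: "comm_group H" and f: "\<And>x. x \<in> S \<Longrightarrow> f x \<in> carrier H"
    and rel: "\<And>a b c. (a, b, c) \<in> Q \<Longrightarrow> f a = f b \<otimes>\<^bsub>H\<^esub> f c"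
  obtains g where "g \<in> hom P H" "\<And>x. x \<in> S \<Longrightarrow> g (gen x) = f x"
proof -
  interpret H: comm_group H by fact
  obtain h where h: "h \<in> hom F H" and hf: "\<And>x. x \<in> S \<Longrightarrow> h (frag_of x) = f x"
    using H.free_Abelian_group_universal[of f S] f by blast
  interpret h: group_hom F H h
    by unfold_locales (rule h)
  have "additive_relators Q \<subseteq> kernel F H h"
  proof
    fix t assume "t \<in> additive_relators Q"
    then obtain a b c where Q: "(a, b, c) \<in> Q" and t: "t = frag_of a - frag_of b - frag_of c"
      by (auto simp: additive_relators_def)
    then have abc: "a \<in> S" "b \<in> S" "c \<in> S"
      using Q_subset by auto
    \<comment> \<open>Written with the group operations, so that the homomorphism laws of
      \<open>h\<close> apply.\<close>
    have t': "t = frag_of a \<otimes>\<^bsub>F\<^esub> inv\<^bsub>F\<^esub> (frag_of b \<otimes>\<^bsub>F\<^esub> frag_of c)"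
      using abc by (simp add: t keys_add[THEN order_trans] keys_frag_of)
    have "h t = f a \<otimes>\<^bsub>H\<^esub> inv\<^bsub>H\<^esub> (f b \<otimes>\<^bsub>H\<^esub> f c)"
      unfolding t' using abc
      by (simp only: h.hom_mult h.hom_inv F.inv_closed F.m_closed frag_of_in_free_Abelian_group hf)
    also have "\<dots> = \<one>\<^bsub>H\<^esub>"
      using rel[OF Q] f abc by simp
    finally show "t \<in> kernel F H h"
      using \<open>t \<in> additive_relators Q\<close> relators_subset
      by (auto simp: kernel_def simp del: carrier_free_Abelian_group_iff)
  qed
  then have "N \<subseteq> kernel F H h"
    by (rule F.generate_subgroup_incl[OF _ h.subgroup_kernel])
  then obtain g where "g \<in> hom (F Mod N) H" "\<And>x. x \<in> carrier F \<Longrightarrow> g (N #>\<^bsub>F\<^esub> x) = h x"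
    using h.FactGroup_universal_kernel[OF normal_axioms] by blast
  then show thesis
    by (intro that[of g]) (auto simp: presented_group_def gen_coset hf)
qed

end

section \<open>Linear maps and extension of scalars\<close>

definition linear_map :: "('r, 'k) ring_scheme \<Rightarrow> ('r, 'm1) module \<Rightarrow> ('r, 'm2) module \<Rightarrow>
    ('m1 \<Rightarrow> 'm2) \<Rightarrow> bool" where
  "linear_map R M N f \<longleftrightarrow>
     (\<forall>a\<in>carrier M. f a \<in> carrier N) \<and>
     (\<forall>a\<in>carrier M. \<forall>b\<in>carrier M. f (a \<oplus>\<^bsub>M\<^esub> b) = f a \<oplus>\<^bsub>N\<^esub> f b) \<and>
     (\<forall>r\<in>carrier R. \<forall>a\<in>carrier M. f (r \<odot>\<^bsub>M\<^esub> a) = r \<odot>\<^bsub>N\<^esub> f a)"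

lemma linear_map_closed: "linear_map R M N f \<Longrightarrow> a \<in> carrier M \<Longrightarrow> f a \<in> carrier N"
  by (simp add: linear_map_def)

lemma linear_map_hom: "linear_map R M N f \<Longrightarrow> f \<in> hom (add_monoid M) (add_monoid N)"
  by (auto simp: linear_map_def intro!: homI)

lemma linear_map_ident: "linear_map R M M (\<lambda>a. a)"
  by (simp add: linear_map_def)

lemma bilinear_map_left:
  assumes "bilinear_map R M N P f" "linear_map R L M h" "b \<in> carrier N"
  shows "linear_map R L P (\<lambda>a. f (h a) b)"
  using assms by (simp add: bilinear_map_def linear_map_def)

lemma bilinear_map_right:
  assumes "bilinear_map R M N P f" "linear_map R L N h" "a \<in> carrier M"
  shows "linear_map R L P (\<lambda>b. f a (h b))"
  using assms by (simp add: bilinear_map_def linear_map_def)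

lemma bilinear_map_closed:
  "bilinear_map R M N P f \<Longrightarrow> a \<in> carrier M \<Longrightarrow> b \<in> carrier N \<Longrightarrow> f a b \<in> carrier P"
  by (simp add: bilinear_map_def)

lemma (in additive_presentation) P_hom_ext:
  assumes H: "group H" and f: "f \<in> hom P H" and g: "g \<in> hom P H"
    and gens: "\<And>x. x \<in> S \<Longrightarrow> f (gen x) = g (gen x)" and a: "a \<in> carrier P"
  shows "f a = g a"
proof -
  interpret H: group H by fact
  interpret f: group_hom P H f using f by unfold_locales
  interpret g: group_hom P H g using g by unfold_locales
  show ?thesis
    using a by (induction a rule: P_induct) (simp_all add: gens)
qed

section \<open>Extension of scalars from the integers to \<open>R\<close>\<close>

locale scalar_extension = R?: cring R + G: comm_group G
  for R :: "('r, 'k) ring_scheme" (structure) and G :: "'g monoid"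
begin

definition rels :: "(('r \<times> 'g) \<times> ('r \<times> 'g) \<times> ('r \<times> 'g)) set" where
  "rels = {((r \<oplus> s, g), (r, g), (s, g)) | r s g. r \<in> carrier R \<and> s \<in> carrier R \<and> g \<in> carrier G} \<union>
     {((r, g \<otimes>\<^bsub>G\<^esub> h), (r, g), (r, h)) | r g h. r \<in> carrier R \<and> g \<in> carrier G \<and> h \<in> carrier G}"

lemma tensor_relators_eq: "tensor_relators R G = additive_relators rels"
  unfolding tensor_relators_def additive_relators_def rels_def image_Un
  by (intro arg_cong2[where f = "(\<union>)"]) (force simp: image_iff)+

sublocale T: additive_presentation "carrier R \<times> carrier G" rels
  by unfold_locales (auto simp: rels_def)

abbreviation "T \<equiv> tensor_Z R G"
abbreviation "pure \<equiv> pure_tensor R G"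

lemma pure_gen: "pure r g = T.gen (r, g)"
  by (simp add: pure_tensor_def tensor_relators_eq)

lemma T_simps:
  "carrier T = carrier T.P" "\<zero>\<^bsub>T\<^esub> = \<one>\<^bsub>T.P\<^esub>" "x \<oplus>\<^bsub>T\<^esub> y = x \<otimes>\<^bsub>T.P\<^esub> y"
  "r \<odot>\<^bsub>T\<^esub> A = T.N <#>\<^bsub>T.F\<^esub> (frag_extend (\<lambda>(s, g). frag_of (r \<otimes> s, g)) ` A)"
  by (simp_all add: tensor_Z_def Let_def tensor_relators_eq)

lemma add_monoid_T:
  "hom H (add_monoid T) = hom H T.P" "hom (add_monoid T) H = hom T.P H"
  by (simp_all add: hom_def T_simps)

definition scale :: "'r \<Rightarrow> ('r \<times> 'g \<Rightarrow>\<^sub>0 int) \<Rightarrow> ('r \<times> 'g \<Rightarrow>\<^sub>0 int)" where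
  "scale r = frag_extend (\<lambda>(s, g). frag_of (r \<otimes> s, g))"

lemma scale_hom: "r \<in> carrier R \<Longrightarrow> scale r \<in> hom T.F T.F"
proof (rule homI)
  fix x assume "r \<in> carrier R" "x \<in> carrier T.F"
  then show "scale r x \<in> carrier T.F"
    using keys_frag_extend[of "\<lambda>(s, g). frag_of (r \<otimes> s, g)" x] by (fastforce simp: scale_def)
qed (simp add: scale_def frag_extend_add)

text \<open>Multiplying the ring entries of a biadditivity relation by \<open>r\<close> gives such a
  relation again, by distributivity in \<open>R\<close>. So relators go to relators, and the
  subgroup that they generate goes into itself.\<close>

lemma scale_N:
  assumes r: "r \<in> carrier R" and x: "x \<in> T.N"
  shows "scale r x \<in> T.N"
proof -
  interpret s: group_hom T.F T.F "scale r"
    using scale_hom[OF r] by unfold_locales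
  have rel: "\<And>a b. (a, b) \<in> rels \<Longrightarrow>
      (map_prod ((\<otimes>) r) id a, map_prod (map_prod ((\<otimes>) r) id) (map_prod ((\<otimes>) r) id) b) \<in> rels"
    using r by (force simp: rels_def r_distr)
  have "scale r ` additive_relators rels \<subseteq> additive_relators rels"
  proof
    fix t assume "t \<in> scale r ` additive_relators rels"
    then obtain a b c where "(a, b, c) \<in> rels" "t = scale r (frag_of a - frag_of b - frag_of c)"
      by (auto simp: additive_relators_def)
    then show "t \<in> additive_relators rels"
      using rel[of a "(b, c)"]
      by (auto simp: additive_relators_def scale_def frag_extend_diff image_iff split: prod.splits
               intro!: bexI)
  qed
  then have "generate T.F (scale r ` additive_relators rels) \<subseteq> T.N"
    by (rule T.F.mono_generate)
  then show ?thesis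
    using x s.generate_img[OF T.relators_subset] by auto
qed

text \<open>The image of a coset under \<open>scale r\<close> may be only part of a coset. The
  factor \<open>T.N\<close> in the definition of the scalar action fills it up, and invariance of
  \<open>T.N\<close> under \<open>scale r\<close> keeps the result inside one coset.\<close>

lemma smult_coset:
  assumes r: "r \<in> carrier R" and x: "x \<in> carrier T.F"
  shows "r \<odot>\<^bsub>T\<^esub> (T.N #>\<^bsub>T.F\<^esub> x) = T.N #>\<^bsub>T.F\<^esub> scale r x"
proof -
  have "T.N <#>\<^bsub>T.F\<^esub> (scale r ` (T.N #>\<^bsub>T.F\<^esub> x)) = T.N #>\<^bsub>T.F\<^esub> scale r x" (is "?L = ?R")
  proof
    show "?L \<subseteq> ?R"
    proof
      fix y assume "y \<in> ?L"
      then obtain n m where nm: "n \<in> T.N" "m \<in> T.N" "y = n + scale r (m + x)"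
        by (auto simp: set_mult_def r_coset_def)
      then have "n + scale r m \<in> T.N"
        using scale_N[OF r] generate.eng[of n T.F "additive_relators rels" "scale r m"] by simp
      moreover have "y = (n + scale r m) + scale r x"
        by (simp add: nm scale_def frag_extend_add)
      ultimately show "y \<in> ?R"
        by (auto simp: r_coset_def)
    qed
    show "?R \<subseteq> ?L"
      using generate.one[of T.F "additive_relators rels"]
      by (force simp: set_mult_def r_coset_def)
  qed
  then show ?thesis
    by (simp add: T_simps scale_def)
qed

lemma smult_hom:
  assumes r: "r \<in> carrier R"
  shows "(\<lambda>A. r \<odot>\<^bsub>T\<^esub> A) \<in> hom T.P T.P"
proof -
  interpret s: group_hom T.F T.F "scale r"
    using scale_hom[OF r] by unfold_locales
  show ?thesis
  proof (rule homI)
    fix x assume "x \<in> carrier T.P"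
    then show "r \<odot>\<^bsub>T\<^esub> x \<in> carrier T.P"
      using smult_coset[OF r] s.hom_closed T.coset.hom_closed unfolding T.carrier_P by auto
  next
    fix x y assume "x \<in> carrier T.P" "y \<in> carrier T.P"
    then obtain u v where u: "u \<in> carrier T.F" "x = T.N #>\<^bsub>T.F\<^esub> u"
      and v: "v \<in> carrier T.F" "y = T.N #>\<^bsub>T.F\<^esub> v"
      unfolding T.carrier_P by auto
    have "r \<odot>\<^bsub>T\<^esub> (T.N #>\<^bsub>T.F\<^esub> (u \<otimes>\<^bsub>T.F\<^esub> v)) = T.N #>\<^bsub>T.F\<^esub> (scale r u \<otimes>\<^bsub>T.F\<^esub> scale r v)"
      using u v smult_coset[OF r] s.hom_mult T.F.m_closed by metis
    then show "r \<odot>\<^bsub>T\<^esub> (x \<otimes>\<^bsub>T.P\<^esub> y) = (r \<odot>\<^bsub>T\<^esub> x) \<otimes>\<^bsub>T.P\<^esub> (r \<odot>\<^bsub>T\<^esub> y)"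
      using u v smult_coset[OF r] T.coset.hom_mult s.hom_closed by metis
  qed
qed

lemma smult_pure:
  "\<lbrakk>r \<in> carrier R; s \<in> carrier R; g \<in> carrier G\<rbrakk> \<Longrightarrow> r \<odot>\<^bsub>T\<^esub> pure s g = pure (r \<otimes> s) g"
  by (simp add: pure_gen T.gen_coset smult_coset scale_def)

lemma pure_in: "\<lbrakk>s \<in> carrier R; g \<in> carrier G\<rbrakk> \<Longrightarrow> pure s g \<in> carrier T"
  by (simp add: pure_gen T_simps T.gen_in)

lemma pure_add_left:
  "\<lbrakk>r \<in> carrier R; s \<in> carrier R; g \<in> carrier G\<rbrakk> \<Longrightarrow> pure (r \<oplus> s) g = pure r g \<oplus>\<^bsub>T\<^esub> pure s g"
  unfolding pure_gen T_simps by (rule T.gen_relation) (auto simp: rels_def)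

lemma pure_hom: "r \<in> carrier R \<Longrightarrow> pure r \<in> hom G (add_monoid T)"
  unfolding add_monoid_T pure_gen
  by (intro homI T.gen_in T.gen_relation) (auto simp: rels_def)

text \<open>For fixed scalars, each law not already contained in \<open>smult_hom\<close> compares
  two additive maps of \<open>x\<close>. It is therefore checked on pure tensors, where it becomes a
  ring law of \<open>R\<close>.\<close>

lemma module_T: "module R T"
proof (rule moduleI)
  show "cring R" ..
  show "abelian_group T"
    by (rule abelian_groupI) (auto simp: T_simps T.P.m_ac intro: T.P.l_inv_ex)
  note h = hom_in_carrier[OF smult_hom] hom_mult[OF smult_hom]
  fix x assume x: "x \<in> carrier T"
  show "\<one> \<odot>\<^bsub>T\<^esub> x = x"
    by (rule T.P_hom_ext[OF T.P.group_axioms smult_hom[OF one_closed], where g = "\<lambda>x. x"])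
      (use x in \<open>auto simp: T_simps(1) smult_pure simp flip: pure_gen intro: homI\<close>)
  fix a assume a: "a \<in> carrier R"
  show "a \<odot>\<^bsub>T\<^esub> x \<in> carrier T"
    using a x h by (simp add: T_simps(1))
  fix y assume "y \<in> carrier T"
  then show "a \<odot>\<^bsub>T\<^esub> (x \<oplus>\<^bsub>T\<^esub> y) = a \<odot>\<^bsub>T\<^esub> x \<oplus>\<^bsub>T\<^esub> a \<odot>\<^bsub>T\<^esub> y"
    using a x h by (simp add: T_simps(1,3))
next
  note h = hom_in_carrier[OF smult_hom] hom_mult[OF smult_hom]
  fix a b x assume a: "a \<in> carrier R" and b: "b \<in> carrier R" and x: "x \<in> carrier T"
  have hom: "(\<lambda>x. (a \<odot>\<^bsub>T\<^esub> x) \<otimes>\<^bsub>T.P\<^esub> (b \<odot>\<^bsub>T\<^esub> x)) \<in> hom T.P T.P"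
    using a b by (intro homI) (simp_all add: h T.P.m_ac)
  show "(a \<oplus> b) \<odot>\<^bsub>T\<^esub> x = a \<odot>\<^bsub>T\<^esub> x \<oplus>\<^bsub>T\<^esub> b \<odot>\<^bsub>T\<^esub> x"
    unfolding T_simps(3)
    by (rule T.P_hom_ext[OF T.P.group_axioms smult_hom hom])
      (use a b x in \<open>auto simp: T_simps(1) smult_pure pure_add_left l_distr simp flip: pure_gen T_simps(3)\<close>)
  have hom: "(\<lambda>x. a \<odot>\<^bsub>T\<^esub> (b \<odot>\<^bsub>T\<^esub> x)) \<in> hom T.P T.P"
    using a b by (intro homI) (simp_all add: h)
  show "(a \<otimes> b) \<odot>\<^bsub>T\<^esub> x = a \<odot>\<^bsub>T\<^esub> (b \<odot>\<^bsub>T\<^esub> x)"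
    by (rule T.P_hom_ext[OF T.P.group_axioms smult_hom hom])
      (use a b x in \<open>auto simp: T_simps(1) smult_pure m_assoc simp flip: pure_gen\<close>)
qed

text \<open>\<open>pure r x\<close> is \<open>r\<close> times \<open>pure \<one> x\<close>, so
  linearity reduces agreement to the elements \<open>pure \<one> x\<close>.\<close>

lemma T_linear_ext:
  assumes "module R M" and f: "linear_map R T M f" and g: "linear_map R T M g"
    and eq: "\<And>x. x \<in> carrier G \<Longrightarrow> f (pure \<one> x) = g (pure \<one> x)" and a: "a \<in> carrier T"
  shows "f a = g a"
proof -
  interpret M: module R M by fact
  have "f (pure r x) = g (pure r x)" if "r \<in> carrier R" "x \<in> carrier G" for r x
  proof -
    have "pure r x = r \<odot>\<^bsub>T\<^esub> pure \<one> x"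
      using that by (simp add: smult_pure)
    then show ?thesis
      using f g that by (simp add: linear_map_def pure_in eq)
  qed
  then show ?thesis
    using T.P_hom_ext[OF M.add.group_axioms linear_map_hom[OF f, unfolded add_monoid_T]
        linear_map_hom[OF g, unfolded add_monoid_T], of a] a
    by (auto simp: T_simps(1) pure_gen)
qed

text \<open>The only candidate sends \<open>pure r x\<close> to \<open>r\<close> times
  \<open>f x\<close>. It respects biadditivity by the two distributive laws of a module, and its
  linearity is again a comparison of homomorphisms on pure tensors.\<close>

lemma T_universal:
  assumes M: "module R M" and f: "f \<in> hom G (add_monoid M)"
  obtains h where "linear_map R T M h" "\<And>x. x \<in> carrier G \<Longrightarrow> h (pure \<one> x) = f x"
proof -
  interpret M: module R M by fact
  have fc: "\<And>x. x \<in> carrier G \<Longrightarrow> f x \<in> carrier M"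
    using f by (auto simp: hom_def)
  have fm: "\<And>x y. x \<in> carrier G \<Longrightarrow> y \<in> carrier G \<Longrightarrow> f (x \<otimes>\<^bsub>G\<^esub> y) = f x \<oplus>\<^bsub>M\<^esub> f y"
    using f by (auto simp: hom_def)
  obtain h where h: "h \<in> hom T.P (add_monoid M)"
    and hp: "\<And>p. p \<in> carrier R \<times> carrier G \<Longrightarrow> h (T.gen p) = (case p of (r, x) \<Rightarrow> r \<odot>\<^bsub>M\<^esub> f x)"
  proof (rule T.P_universal[of "add_monoid M" "\<lambda>(r, x). r \<odot>\<^bsub>M\<^esub> f x"])
    show "comm_group (add_monoid M)"
      by (rule M.a_comm_group)
  qed (auto simp: rels_def fc fm M.smult_l_distr M.smult_r_distr)
  have hpure: "h (pure r x) = r \<odot>\<^bsub>M\<^esub> f x" if "r \<in> carrier R" "x \<in> carrier G" for r x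
    using that hp[of "(r, x)"] by (simp add: pure_gen)
  have "h (r \<odot>\<^bsub>T\<^esub> a) = r \<odot>\<^bsub>M\<^esub> h a" if r: "r \<in> carrier R" and a: "a \<in> carrier T" for r a
  proof (rule T.P_hom_ext[of "add_monoid M"])
    show "(\<lambda>a. h (r \<odot>\<^bsub>T\<^esub> a)) \<in> hom T.P (add_monoid M)"
      using hom_compose[OF smult_hom[OF r] h] by (simp add: comp_def)
    show "(\<lambda>a. r \<odot>\<^bsub>M\<^esub> h a) \<in> hom T.P (add_monoid M)"
      using r hom_in_carrier[OF h] hom_mult[OF h] by (intro homI) (simp_all add: M.smult_r_distr)
  qed (use r a in \<open>auto simp: T_simps(1) M.add.group_axioms smult_pure hpure M.smult_assoc1 fc
         simp flip: pure_gen\<close>)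
  then have "linear_map R T M h"
    using hom_in_carrier[OF h] hom_mult[OF h] by (simp add: linear_map_def T_simps(1,3))
  then show thesis
    by (rule that) (simp add: hpure fc)
qed

end

section \<open>Bisets as sets with commuting actions\<close>

declare (in category) Ident_in [simp] Comp_in [simp] Comp_Ident_left [simp] Comp_Ident_right [simp]

abbreviation el :: "'a ubiset \<Rightarrow> 'a univ \<Rightarrow> 'a univ \<Rightarrow> 'a univ set" where
  "el \<Omega> x y \<equiv> FObj \<Omega> (UPair x y)"

lemma prod_op_cat_simps [simp]:
  "UPair x y \<in> Obj (prod_cat C D) \<longleftrightarrow> x \<in> Obj C \<and> y \<in> Obj D"
  "UPair f g \<in> Mor (prod_cat C D) (UPair x y) (UPair x' y') \<longleftrightarrow> f \<in> Mor C x x' \<and> g \<in> Mor D y y'"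
  "Ident (prod_cat C D) (UPair x y) = UPair (Ident C x) (Ident D y)"
  "Comp (prod_cat C D) (UPair x y) (UPair x' y') (UPair x'' y'') (UPair f' g') (UPair f g) =
     UPair (Comp C x x' x'' f' f) (Comp D y y' y'' g' g)"
  "Obj (op_cat D) = Obj D" "Mor (op_cat D) y y' = Mor D y' y" "Ident (op_cat D) = Ident D"
  "Comp (op_cat D) y y' y'' g f = Comp D y'' y' y f g"
  by (simp_all add: prod_cat_def op_cat_def)

lemma Obj_prod_catE:
  assumes "p \<in> Obj (prod_cat C D)"
  obtains x y where "p = UPair x y" "x \<in> Obj C" "y \<in> Obj D"
  using assms by (auto simp: prod_cat_def)

lemma Mor_prod_catE:
  assumes "m \<in> Mor (prod_cat C D) (UPair x y) (UPair x' y')"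
  obtains f g where "m = UPair f g" "f \<in> Mor C x x'" "g \<in> Mor D y y'"
  using assms by (auto simp: prod_cat_def)

lemma fin_set_cat_simps [simp]:
  "A \<in> Obj fin_set_cat \<longleftrightarrow> finite A" "Mor fin_set_cat A B = (A \<rightarrow>\<^sub>E B)"
  "Ident fin_set_cat A = (\<lambda>a\<in>A. a)" "Comp fin_set_cat A B D g f = compose A g f"
  by (simp_all add: fin_set_cat_def)

lemma iso_arrow_fin_set_cat:
  "iso_arrow fin_set_cat A B f \<longleftrightarrow> f \<in> A \<rightarrow>\<^sub>E B \<and> bij_betw f A B"
proof
  assume "iso_arrow fin_set_cat A B f"
  then obtain g where f: "f \<in> A \<rightarrow>\<^sub>E B" and g: "g \<in> B \<rightarrow>\<^sub>E A"
    and gf: "compose A g f = (\<lambda>a\<in>A. a)" and fg: "compose B f g = (\<lambda>b\<in>B. b)"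
    by (auto simp: iso_arrow_def)
  have "g (f a) = a" if "a \<in> A" for a
    using that fun_cong[OF gf, of a] by (simp add: compose_def)
  moreover have "f (g b) = b" if "b \<in> B" for b
    using that fun_cong[OF fg, of b] by (simp add: compose_def)
  ultimately have "bij_betw f A B"
    using f g by (intro bij_betw_byWitness[where f' = g]) auto
  with f show "f \<in> A \<rightarrow>\<^sub>E B \<and> bij_betw f A B" ..
next
  assume f: "f \<in> A \<rightarrow>\<^sub>E B \<and> bij_betw f A B"
  \<comment> \<open>Morphisms of \<open>fin_set_cat\<close> are extensional, so the inverse has to
    be cut off outside \<open>B\<close>.\<close>
  let ?g = "\<lambda>b\<in>B. inv_into A f b"
  have "?g \<in> B \<rightarrow>\<^sub>E A" "compose A ?g f = (\<lambda>a\<in>A. a)" "compose B f ?g = (\<lambda>b\<in>B. b)"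
    using f by (auto simp: compose_def bij_betw_def inv_into_into f_inv_into_f fun_eq_iff)
  with f show "iso_arrow fin_set_cat A B f"
    by (auto simp: iso_arrow_def intro!: bexI[of _ ?g])
qed

text \<open>The condition on \<open>u\<close> outside \<open>el \<Omega> x y\<close> reflects that a
  morphism of \<open>fin_set_cat\<close> is an extensional function: functoriality is an equation of
  functions on the whole universe.\<close>

lemma bisetI:
  assumes "\<And>x y. \<lbrakk>x \<in> Obj C; y \<in> Obj D\<rbrakk> \<Longrightarrow> finite (el \<Omega> x y)"
    and "\<And>x y x' y' \<alpha> \<beta> u. \<lbrakk>x \<in> Obj C; y \<in> Obj D; x' \<in> Obj C; y' \<in> Obj D; \<alpha> \<in> Mor C x x';
      \<beta> \<in> Mor D y' y; u \<in> el \<Omega> x y\<rbrakk> \<Longrightarrow> bact \<Omega> x y x' y' \<alpha> \<beta> u \<in> el \<Omega> x' y'"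
    and "\<And>x y x' y' \<alpha> \<beta> u. \<lbrakk>x \<in> Obj C; y \<in> Obj D; x' \<in> Obj C; y' \<in> Obj D; \<alpha> \<in> Mor C x x';
      \<beta> \<in> Mor D y' y; u \<notin> el \<Omega> x y\<rbrakk> \<Longrightarrow> bact \<Omega> x y x' y' \<alpha> \<beta> u = undefined"
    and "\<And>x y u. \<lbrakk>x \<in> Obj C; y \<in> Obj D; u \<in> el \<Omega> x y\<rbrakk>
      \<Longrightarrow> bact \<Omega> x y x y (Ident C x) (Ident D y) u = u"
    and "\<And>x y x' y' x'' y'' \<alpha> \<beta> \<alpha>' \<beta>' u. \<lbrakk>x \<in> Obj C; y \<in> Obj D; x' \<in> Obj C; y' \<in> Obj D;
      x'' \<in> Obj C; y'' \<in> Obj D; \<alpha> \<in> Mor C x x'; \<beta> \<in> Mor D y' y; \<alpha>' \<in> Mor C x' x'';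
      \<beta>' \<in> Mor D y'' y'; u \<in> el \<Omega> x y\<rbrakk> \<Longrightarrow> bact \<Omega> x' y' x'' y'' \<alpha>' \<beta>' (bact \<Omega> x y x' y' \<alpha> \<beta> u) =
        bact \<Omega> x y x'' y'' (Comp C x x' x'' \<alpha>' \<alpha>) (Comp D y'' y' y \<beta> \<beta>') u"
    and C: "category C" and D: "category D"
  shows "biset C D \<Omega>"
  unfolding biset_def
proof
  interpret C: category C by fact
  interpret D: category D by fact
  fix p assume "p \<in> Obj (prod_cat C (op_cat D))"
  then obtain x y where p: "p = UPair x y" "x \<in> Obj C" "y \<in> Obj D"
    by (auto elim: Obj_prod_catE)
  show "FObj \<Omega> p \<in> Obj fin_set_cat"
    using p assms(1) by simp
  show "FMor \<Omega> p p (Ident (prod_cat C (op_cat D)) p) = Ident fin_set_cat (FObj \<Omega> p)"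
    using p(2,3) by (auto simp: p(1) fun_eq_iff restrict_def assms(3,4))
  fix q assume "q \<in> Obj (prod_cat C (op_cat D))"
  then obtain x' y' where q: "q = UPair x' y'" "x' \<in> Obj C" "y' \<in> Obj D"
    by (auto elim: Obj_prod_catE)
  fix m assume "m \<in> Mor (prod_cat C (op_cat D)) p q"
  then obtain \<alpha> \<beta> where m: "m = UPair \<alpha> \<beta>" "\<alpha> \<in> Mor C x x'" "\<beta> \<in> Mor D y' y"
    using p q by (auto elim: Mor_prod_catE)
  show "FMor \<Omega> p q m \<in> Mor fin_set_cat (FObj \<Omega> p) (FObj \<Omega> q)"
    using p(2,3) q(2,3) m(2,3) by (auto simp: p(1) q(1) m(1) assms(2,3))
  fix r assume "r \<in> Obj (prod_cat C (op_cat D))"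
  then obtain x'' y'' where r: "r = UPair x'' y''" "x'' \<in> Obj C" "y'' \<in> Obj D"
    by (auto elim: Obj_prod_catE)
  fix n assume "n \<in> Mor (prod_cat C (op_cat D)) q r"
  then obtain \<alpha>' \<beta>' where n: "n = UPair \<alpha>' \<beta>'" "\<alpha>' \<in> Mor C x' x''" "\<beta>' \<in> Mor D y'' y'"
    using q r by (auto elim: Mor_prod_catE)
  show "FMor \<Omega> p r (Comp (prod_cat C (op_cat D)) p q r n m) =
     Comp fin_set_cat (FObj \<Omega> p) (FObj \<Omega> q) (FObj \<Omega> r) (FMor \<Omega> q r n) (FMor \<Omega> p q m)"
  proof (rule ext)
    fix u
    show "FMor \<Omega> p r (Comp (prod_cat C (op_cat D)) p q r n m) u =
     Comp fin_set_cat (FObj \<Omega> p) (FObj \<Omega> q) (FObj \<Omega> r) (FMor \<Omega> q r n) (FMor \<Omega> p q m) u"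
      using p(2,3) q(2,3) r(2,3) m(2,3) n(2,3)
      by (cases "u \<in> FObj \<Omega> p") (simp_all add: p(1) q(1) r(1) m(1) n(1) compose_def assms(3,5))
  qed
qed

locale bset = C: category C + D: category D
  for C D :: "'a ucat" +
  fixes \<Omega> :: "'a ubiset"
  assumes biset: "biset C D \<Omega>"
begin

lemma functr: "functr (prod_cat C (op_cat D)) fin_set_cat \<Omega>"
  using biset by (simp add: biset_def)

lemma finite_el: "\<lbrakk>x \<in> Obj C; y \<in> Obj D\<rbrakk> \<Longrightarrow> finite (el \<Omega> x y)"
  using functr.FObj_in[OF functr, of "UPair x y"] by simp

lemma FMor_in: "\<lbrakk>x \<in> Obj C; y \<in> Obj D; x' \<in> Obj C; y' \<in> Obj D; \<alpha> \<in> Mor C x x'; \<beta> \<in> Mor D y' y\<rbrakk>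
    \<Longrightarrow> FMor \<Omega> (UPair x y) (UPair x' y') (UPair \<alpha> \<beta>) \<in> el \<Omega> x y \<rightarrow>\<^sub>E el \<Omega> x' y'"
  using functr.FMor_in[OF functr, of "UPair x y" "UPair x' y'" "UPair \<alpha> \<beta>"] by simp

lemma act_undefined: "\<lbrakk>x \<in> Obj C; y \<in> Obj D; x' \<in> Obj C; y' \<in> Obj D; \<alpha> \<in> Mor C x x';
      \<beta> \<in> Mor D y' y; u \<notin> el \<Omega> x y\<rbrakk> \<Longrightarrow> bact \<Omega> x y x' y' \<alpha> \<beta> u = undefined"
  by (rule PiE_arb[OF FMor_in])

lemma act_in [simp, intro]: "\<lbrakk>x \<in> Obj C; y \<in> Obj D; x' \<in> Obj C; y' \<in> Obj D; \<alpha> \<in> Mor C x x';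
      \<beta> \<in> Mor D y' y; u \<in> el \<Omega> x y\<rbrakk> \<Longrightarrow> bact \<Omega> x y x' y' \<alpha> \<beta> u \<in> el \<Omega> x' y'"
  using FMor_in by blast

lemma act_id [simp]: "\<lbrakk>x \<in> Obj C; y \<in> Obj D; u \<in> el \<Omega> x y\<rbrakk>
      \<Longrightarrow> bact \<Omega> x y x y (Ident C x) (Ident D y) u = u"
  using functr.FMor_Ident[OF functr, of "UPair x y"] by simp

lemma act_act [simp]: "\<lbrakk>x \<in> Obj C; y \<in> Obj D; x' \<in> Obj C; y' \<in> Obj D;
      x'' \<in> Obj C; y'' \<in> Obj D; \<alpha> \<in> Mor C x x'; \<beta> \<in> Mor D y' y; \<alpha>' \<in> Mor C x' x'';
      \<beta>' \<in> Mor D y'' y'; u \<in> el \<Omega> x y\<rbrakk> \<Longrightarrow> bact \<Omega> x' y' x'' y'' \<alpha>' \<beta>' (bact \<Omega> x y x' y' \<alpha> \<beta> u) =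
        bact \<Omega> x y x'' y'' (Comp C x x' x'' \<alpha>' \<alpha>) (Comp D y'' y' y \<beta> \<beta>') u"
  using functr.FMor_Comp[OF functr, of "UPair x y" "UPair x' y'" "UPair x'' y''" "UPair \<alpha> \<beta>" "UPair \<alpha>' \<beta>'"]
  by (simp add: compose_def)

end

section \<open>Isomorphisms of bisets in terms of elements\<close>

lemma biset_isoI:
  assumes \<Omega>: "bset C D \<Omega>"
    and bij: "\<And>x y. \<lbrakk>x \<in> Obj C; y \<in> Obj D\<rbrakk> \<Longrightarrow> bij_betw (\<eta> x y) (el \<Omega> x y) (el \<Psi> x y)"
    and nat: "\<And>x y x' y' \<alpha> \<beta> u. \<lbrakk>x \<in> Obj C; y \<in> Obj D; x' \<in> Obj C; y' \<in> Obj D; \<alpha> \<in> Mor C x x';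
      \<beta> \<in> Mor D y' y; u \<in> el \<Omega> x y\<rbrakk> \<Longrightarrow>
      \<eta> x' y' (bact \<Omega> x y x' y' \<alpha> \<beta> u) = bact \<Psi> x y x' y' \<alpha> \<beta> (\<eta> x y u)"
  shows "biset_iso C D \<Omega> \<Psi>"
proof -
  interpret bset C D \<Omega> by fact
  \<comment> \<open>The given bijections are arbitrary off the value sets; restricting them turns
    them into morphisms of \<open>fin_set_cat\<close>.\<close>
  let ?\<eta> = "\<lambda>p. \<lambda>u\<in>FObj \<Omega> p. \<eta> (ufst p) (usnd p) u"
  have "iso_arrow fin_set_cat (FObj \<Omega> p) (FObj \<Psi> p) (?\<eta> p)" if "p \<in> Obj (prod_cat C (op_cat D))" for p
    using that bij bij_betw_apply[OF bij]
    by (auto simp: iso_arrow_fin_set_cat bij_betw_restrict_eq elim!: Obj_prod_catE)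
  moreover have "compose (FObj \<Omega> p) (?\<eta> q) (FMor \<Omega> p q m) = compose (FObj \<Omega> p) (FMor \<Psi> p q m) (?\<eta> p)"
    if "p \<in> Obj (prod_cat C (op_cat D))" "q \<in> Obj (prod_cat C (op_cat D))"
      "m \<in> Mor (prod_cat C (op_cat D)) p q" for p q m
    using that by (auto simp: compose_def nat intro!: restrict_ext elim!: Obj_prod_catE Mor_prod_catE)
  ultimately show ?thesis
    unfolding biset_iso_def nat_isomorphic_def by (intro exI[of _ ?\<eta>]) simp
qed

lemma biset_isoE:
  assumes iso: "biset_iso C D \<Omega> \<Psi>"
  obtains \<eta> where
    "\<And>x y. \<lbrakk>x \<in> Obj C; y \<in> Obj D\<rbrakk> \<Longrightarrow> bij_betw (\<eta> x y) (el \<Omega> x y) (el \<Psi> x y)"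
    "\<And>x y x' y' \<alpha> \<beta> u. \<lbrakk>x \<in> Obj C; y \<in> Obj D; x' \<in> Obj C; y' \<in> Obj D; \<alpha> \<in> Mor C x x';
      \<beta> \<in> Mor D y' y; u \<in> el \<Omega> x y\<rbrakk> \<Longrightarrow>
      \<eta> x' y' (bact \<Omega> x y x' y' \<alpha> \<beta> u) = bact \<Psi> x y x' y' \<alpha> \<beta> (\<eta> x y u)"
proof -
  obtain \<eta> where \<eta>:
     "\<forall>p\<in>Obj (prod_cat C (op_cat D)). iso_arrow fin_set_cat (FObj \<Omega> p) (FObj \<Psi> p) (\<eta> p)"
     "\<forall>p\<in>Obj (prod_cat C (op_cat D)). \<forall>q\<in>Obj (prod_cat C (op_cat D)).
       \<forall>f\<in>Mor (prod_cat C (op_cat D)) p q.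
        compose (FObj \<Omega> p) (\<eta> q) (FMor \<Omega> p q f) = compose (FObj \<Omega> p) (FMor \<Psi> p q f) (\<eta> p)"
    using iso by (auto simp: biset_iso_def nat_isomorphic_def)
  show thesis
  proof (rule that[of "\<lambda>x y. \<eta> (UPair x y)"])
    show "bij_betw (\<eta> (UPair x y)) (el \<Omega> x y) (el \<Psi> x y)" if "x \<in> Obj C" "y \<in> Obj D" for x y
      using that \<eta>(1) by (simp add: iso_arrow_fin_set_cat)
  next
    fix x y x' y' \<alpha> \<beta> u
    assume *: "x \<in> Obj C" "y \<in> Obj D" "x' \<in> Obj C" "y' \<in> Obj D" "\<alpha> \<in> Mor C x x'"
      "\<beta> \<in> Mor D y' y" "u \<in> el \<Omega> x y"
    then have "compose (el \<Omega> x y) (\<eta> (UPair x' y')) (FMor \<Omega> (UPair x y) (UPair x' y') (UPair \<alpha> \<beta>)) =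
        compose (el \<Omega> x y) (FMor \<Psi> (UPair x y) (UPair x' y') (UPair \<alpha> \<beta>)) (\<eta> (UPair x y))"
      using \<eta>(2) by simp
    from fun_cong[OF this, of u] * show "\<eta> (UPair x' y') (bact \<Omega> x y x' y' \<alpha> \<beta> u) =
        bact \<Psi> x y x' y' \<alpha> \<beta> (\<eta> (UPair x y) u)"
      by (simp add: compose_def)
  qed
qed

lemma biset_iso_refl: "bset C D \<Omega> \<Longrightarrow> biset_iso C D \<Omega> \<Omega>"
  by (rule biset_isoI[where \<eta> = "\<lambda>x y u. u"]) (simp_all add: bij_betw_def)

lemma biset_iso_trans:
  assumes \<Omega>: "bset C D \<Omega>" and "biset_iso C D \<Omega> \<Psi>" "biset_iso C D \<Psi> \<Theta>"
  shows "biset_iso C D \<Omega> \<Theta>"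
proof -
  interpret bset C D \<Omega> by fact
  obtain \<eta> where \<eta>:
    "\<And>x y. \<lbrakk>x \<in> Obj C; y \<in> Obj D\<rbrakk> \<Longrightarrow> bij_betw (\<eta> x y) (el \<Omega> x y) (el \<Psi> x y)"
    "\<And>x y x' y' \<alpha> \<beta> u. \<lbrakk>x \<in> Obj C; y \<in> Obj D; x' \<in> Obj C; y' \<in> Obj D; \<alpha> \<in> Mor C x x';
      \<beta> \<in> Mor D y' y; u \<in> el \<Omega> x y\<rbrakk> \<Longrightarrow>
      \<eta> x' y' (bact \<Omega> x y x' y' \<alpha> \<beta> u) = bact \<Psi> x y x' y' \<alpha> \<beta> (\<eta> x y u)"
    by (rule biset_isoE[OF assms(2)]) blast
  obtain \<theta> where \<theta>:
    "\<And>x y. \<lbrakk>x \<in> Obj C; y \<in> Obj D\<rbrakk> \<Longrightarrow> bij_betw (\<theta> x y) (el \<Psi> x y) (el \<Theta> x y)"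
    "\<And>x y x' y' \<alpha> \<beta> u. \<lbrakk>x \<in> Obj C; y \<in> Obj D; x' \<in> Obj C; y' \<in> Obj D; \<alpha> \<in> Mor C x x';
      \<beta> \<in> Mor D y' y; u \<in> el \<Psi> x y\<rbrakk> \<Longrightarrow>
      \<theta> x' y' (bact \<Psi> x y x' y' \<alpha> \<beta> u) = bact \<Theta> x y x' y' \<alpha> \<beta> (\<theta> x y u)"
    by (rule biset_isoE[OF assms(3)]) blast
  show ?thesis
  proof (rule biset_isoI[OF \<Omega>, where \<eta> = "\<lambda>x y. \<theta> x y \<circ> \<eta> x y"])
    show "bij_betw (\<theta> x y \<circ> \<eta> x y) (el \<Omega> x y) (el \<Theta> x y)" if "x \<in> Obj C" "y \<in> Obj D" for x y
      using that \<eta>(1) \<theta>(1) by (blast intro: bij_betw_trans)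
  qed (simp add: \<eta>(2) \<theta>(2) bij_betwE[OF \<eta>(1)])
qed

lemma biset_iso_sym:
  assumes \<Omega>: "bset C D \<Omega>" and \<Psi>: "bset C D \<Psi>" and "biset_iso C D \<Omega> \<Psi>"
  shows "biset_iso C D \<Psi> \<Omega>"
proof -
  interpret \<Omega>: bset C D \<Omega> by fact
  interpret \<Psi>: bset C D \<Psi> by fact
  obtain \<eta> where \<eta>:
    "\<And>x y. \<lbrakk>x \<in> Obj C; y \<in> Obj D\<rbrakk> \<Longrightarrow> bij_betw (\<eta> x y) (el \<Omega> x y) (el \<Psi> x y)"
    "\<And>x y x' y' \<alpha> \<beta> u. \<lbrakk>x \<in> Obj C; y \<in> Obj D; x' \<in> Obj C; y' \<in> Obj D; \<alpha> \<in> Mor C x x';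
      \<beta> \<in> Mor D y' y; u \<in> el \<Omega> x y\<rbrakk> \<Longrightarrow>
      \<eta> x' y' (bact \<Omega> x y x' y' \<alpha> \<beta> u) = bact \<Psi> x y x' y' \<alpha> \<beta> (\<eta> x y u)"
    by (rule biset_isoE[OF assms(3)]) blast
  show ?thesis
  proof (rule biset_isoI[OF \<Psi>, where \<eta> = "\<lambda>x y. inv_into (el \<Omega> x y) (\<eta> x y)"])
    show "bij_betw (inv_into (el \<Omega> x y) (\<eta> x y)) (el \<Psi> x y) (el \<Omega> x y)"
      if "x \<in> Obj C" "y \<in> Obj D" for x y
      using that \<eta>(1) by (blast intro: bij_betw_inv_into)
  next
    fix x y x' y' \<alpha> \<beta> u
    assume *: "x \<in> Obj C" "y \<in> Obj D" "x' \<in> Obj C" "y' \<in> Obj D" "\<alpha> \<in> Mor C x x'"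
      "\<beta> \<in> Mor D y' y" and "u \<in> el \<Psi> x y"
    then obtain w where w: "w \<in> el \<Omega> x y" "u = \<eta> x y w"
      using \<eta>(1)[of x y] by (auto simp: bij_betw_def)
    note inv = bij_betw_inv_into_left[OF \<eta>(1)]
    have "inv_into (el \<Omega> x' y') (\<eta> x' y') (bact \<Psi> x y x' y' \<alpha> \<beta> u) = bact \<Omega> x y x' y' \<alpha> \<beta> w"
      using * w inv[of x' y' "bact \<Omega> x y x' y' \<alpha> \<beta> w"] by (simp add: \<eta>(2))
    then show "inv_into (el \<Omega> x' y') (\<eta> x' y') (bact \<Psi> x y x' y' \<alpha> \<beta> u) =
       bact \<Omega> x y x' y' \<alpha> \<beta> (inv_into (el \<Omega> x y) (\<eta> x y) u)"
      using * w inv[of x y] by simp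
  qed
qed

lemma iso_class_eq:
  assumes "bset C D \<Omega>" "bset C D \<Psi>" "biset_iso C D \<Omega> \<Psi>"
  shows "iso_class C D \<Omega> = iso_class C D \<Psi>"
proof -
  have "biset_iso C D \<Omega> \<Theta> \<longleftrightarrow> biset_iso C D \<Psi> \<Theta>" for \<Theta>
    using biset_iso_trans[OF assms(1,3)] biset_iso_trans[OF assms(2) biset_iso_sym[OF assms]] by blast
  then show ?thesis
    by (simp add: iso_class_def)
qed

lemma sum_biset_simps [simp]:
  "el (sum_biset \<Omega> \<Psi>) x y = UInl ` el \<Omega> x y \<union> UInr ` el \<Psi> x y"
  "u \<in> el \<Omega> x y \<Longrightarrow> bact (sum_biset \<Omega> \<Psi>) x y x' y' \<alpha> \<beta> (UInl u) = UInl (bact \<Omega> x y x' y' \<alpha> \<beta> u)"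
  "v \<in> el \<Psi> x y \<Longrightarrow> bact (sum_biset \<Omega> \<Psi>) x y x' y' \<alpha> \<beta> (UInr v) = UInr (bact \<Psi> x y x' y' \<alpha> \<beta> v)"
  by (simp_all add: sum_biset_def)

lemma bset_sum:
  assumes "bset C D \<Omega>" "bset C D \<Psi>"
  shows "bset C D (sum_biset \<Omega> \<Psi>)"
proof -
  interpret \<Omega>: bset C D \<Omega> by fact
  interpret \<Psi>: bset C D \<Psi> by fact
  show ?thesis
  proof (unfold_locales, rule bisetI)
    fix x y x' y' \<alpha> \<beta> u
    assume "u \<notin> el (sum_biset \<Omega> \<Psi>) x y"
    then show "bact (sum_biset \<Omega> \<Psi>) x y x' y' \<alpha> \<beta> u = undefined"
      by (simp add: sum_biset_def)
  qed (auto simp: \<Omega>.finite_el \<Psi>.finite_el \<Omega>.C.category_axioms \<Omega>.D.category_axioms)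
qed

lemma bset_id:
  assumes "finite_category C"
  shows "bset C C (id_biset C)"
proof -
  interpret category C using assms by (simp add: finite_category_def)
  show ?thesis
  proof (unfold_locales, rule bisetI)
    show "finite (el (id_biset C) x y)" if "x \<in> Obj C" "y \<in> Obj C" for x y
      using that assms by (simp add: id_biset_def finite_category_def)
  qed (simp_all add: id_biset_def Comp_assoc category_axioms)
qed

lemma id_biset_simps [simp]:
  "el (id_biset C) x y = Mor C y x"
  "f \<in> Mor C y x \<Longrightarrow> bact (id_biset C) x y x' y' \<alpha> \<beta> f = Comp C y' x x' \<alpha> (Comp C y' y x f \<beta>)"
  by (simp_all add: id_biset_def)

text \<open>Restriction in both variables. One map \<open>\<chi>\<close> serves objects and
  morphisms, since \<open>UPair\<close> codes pairs of either kind. Composites with functor bisets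
  will be recognised as such restrictions.\<close>

definition res_biset :: "('a univ \<Rightarrow> 'a univ) \<Rightarrow> ('a univ \<Rightarrow> 'a univ) \<Rightarrow> 'a ubiset \<Rightarrow> 'a ubiset" where
  "res_biset \<phi> \<psi> \<Omega> = (let \<chi> = (\<lambda>p. UPair (\<phi> (ufst p)) (\<psi> (usnd p))) in
     \<lparr>FObj = (\<lambda>p. FObj \<Omega> (\<chi> p)), FMor = (\<lambda>p q m. FMor \<Omega> (\<chi> p) (\<chi> q) (\<chi> m))\<rparr>)"

lemma res_biset_simps [simp]:
  "el (res_biset \<phi> \<psi> \<Omega>) x y = el \<Omega> (\<phi> x) (\<psi> y)"
  "bact (res_biset \<phi> \<psi> \<Omega>) x y x' y' \<alpha> \<beta> u = bact \<Omega> (\<phi> x) (\<psi> y) (\<phi> x') (\<psi> y') (\<phi> \<alpha>) (\<psi> \<beta>) u"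
  by (simp_all add: res_biset_def)

text \<open>All functors needed below act on objects and on morphisms by one and the same map of the universe.\<close>

locale ufunctor = C: category C + D: category D
  for C D :: "'a ucat" +
  fixes \<phi> :: "'a univ \<Rightarrow> 'a univ"
  assumes map_Obj [simp, intro]: "x \<in> Obj C \<Longrightarrow> \<phi> x \<in> Obj D"
    and map_Mor [simp, intro]: "\<lbrakk>x \<in> Obj C; y \<in> Obj C; f \<in> Mor C x y\<rbrakk> \<Longrightarrow> \<phi> f \<in> Mor D (\<phi> x) (\<phi> y)"
    and map_Ident [simp]: "x \<in> Obj C \<Longrightarrow> \<phi> (Ident C x) = Ident D (\<phi> x)"
    and map_Comp [simp]: "\<lbrakk>x \<in> Obj C; y \<in> Obj C; z \<in> Obj C; f \<in> Mor C x y; g \<in> Mor C y z\<rbrakk>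
      \<Longrightarrow> \<phi> (Comp C x y z g f) = Comp D (\<phi> x) (\<phi> y) (\<phi> z) (\<phi> g) (\<phi> f)"

lemma bset_res:
  assumes "ufunctor C C' \<phi>" "ufunctor D D' \<psi>" "bset C' D' \<Omega>"
  shows "bset C D (res_biset \<phi> \<psi> \<Omega>)"
proof -
  interpret \<phi>: ufunctor C C' \<phi> by fact
  interpret \<psi>: ufunctor D D' \<psi> by fact
  interpret \<Omega>: bset C' D' \<Omega> by fact
  show ?thesis
  proof (unfold_locales, rule bisetI)
    fix x y x' y' \<alpha> \<beta> u
    assume "x \<in> Obj C" "y \<in> Obj D" "x' \<in> Obj C" "y' \<in> Obj D" "\<alpha> \<in> Mor C x x'"
      "\<beta> \<in> Mor D y' y" "u \<notin> el (res_biset \<phi> \<psi> \<Omega>) x y"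
    then show "bact (res_biset \<phi> \<psi> \<Omega>) x y x' y' \<alpha> \<beta> u = undefined"
      by (simp add: \<Omega>.act_undefined)
  qed (simp_all add: \<Omega>.finite_el \<phi>.C.category_axioms \<psi>.C.category_axioms)
qed

lemma ufunctor_id: "category C \<Longrightarrow> ufunctor C C (\<lambda>x. x)"
  by (simp add: ufunctor_def ufunctor_axioms_def)

lemma ufunctor_comp:
  assumes "ufunctor C D \<phi>" "ufunctor D E \<psi>"
  shows "ufunctor C E (\<lambda>x. \<psi> (\<phi> x))"
proof -
  interpret \<phi>: ufunctor C D \<phi> by fact
  interpret \<psi>: ufunctor D E \<psi> by fact
  show ?thesis by unfold_locales simp_all
qed

section \<open>Composition of bisets\<close>

locale bcomp = \<Omega>: bset C D \<Omega> + \<Psi>: bset D E \<Psi>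
  for C D E :: "'a ucat" and \<Omega> \<Psi> :: "'a ubiset" +
  assumes finite_Obj_D: "finite (Obj D)"
begin

abbreviation "compo \<equiv> comp_biset C D E \<Omega> \<Psi>"
abbreviation "bal x z \<equiv> (bal_gen C D E \<Omega> \<Psi> x z \<union> (bal_gen C D E \<Omega> \<Psi> x z)\<inverse>)\<^sup>*"

definition cls :: "'a univ \<Rightarrow> 'a univ \<Rightarrow> 'a univ \<Rightarrow> 'a univ \<Rightarrow> 'a univ \<Rightarrow> 'a univ" where
  "cls x z y u v = bal_class C D E \<Omega> \<Psi> x z (UPair y (UPair u v))"

text \<open>The map on classes induced by \<open>\<psi>\<close>, read off at an arbitrary
  representative stored in the code of the class. Independence of the choice, for balanced
  \<open>\<psi>\<close>, is \<open>lift_cls\<close>.\<close>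

definition lift :: "('a univ \<Rightarrow> 'a univ \<Rightarrow> 'a univ \<Rightarrow> 'b) \<Rightarrow> 'a univ \<Rightarrow> 'b" where
  "lift \<psi> K = (let t = (SOME t. t \<in> fset (uelems K)) in \<psi> (ufst t) (ufst (usnd t)) (usnd (usnd t)))"

lemma finite_bal_pairs:
  assumes "x \<in> Obj C" "z \<in> Obj E"
  shows "finite (bal_pairs D \<Omega> \<Psi> x z)"
proof -
  have "bal_pairs D \<Omega> \<Psi> x z =
      (\<lambda>(y, u, v). UPair y (UPair u v)) ` (SIGMA y:Obj D. el \<Omega> x y \<times> el \<Psi> y z)"
    by (force simp: bal_pairs_def)
  then show ?thesis
    using assms finite_Obj_D \<Omega>.finite_el \<Psi>.finite_el by simp
qed

lemma bal_gen_subset: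
  assumes "x \<in> Obj C" "z \<in> Obj E"
  shows "bal_gen C D E \<Omega> \<Psi> x z \<subseteq> bal_pairs D \<Omega> \<Psi> x z \<times> bal_pairs D \<Omega> \<Psi> x z"
  using assms by (auto simp: bal_gen_def bal_pairs_def)

lemma bal_closed:
  assumes "x \<in> Obj C" "z \<in> Obj E" "(t, t') \<in> bal x z" "t \<in> bal_pairs D \<Omega> \<Psi> x z"
  shows "t' \<in> bal_pairs D \<Omega> \<Psi> x z"
  using assms(3,4) bal_gen_subset[OF assms(1,2)] by (induction rule: rtrancl_induct) auto

text \<open>A class stays inside the set of pairs, which is finite because \<open>D\<close> has
  finitely many objects and the bisets have finite values. For a finite set \<open>Abs_fset\<close>
  loses nothing.\<close>

lemma fset_bal_class:
  assumes "x \<in> Obj C" "z \<in> Obj E" "t \<in> bal_pairs D \<Omega> \<Psi> x z"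
  shows "fset (uelems (bal_class C D E \<Omega> \<Psi> x z t)) = bal x z `` {t}"
proof -
  have "bal x z `` {t} \<subseteq> bal_pairs D \<Omega> \<Psi> x z"
    using bal_closed[OF assms(1,2)] assms(3) by auto
  then have "finite (bal x z `` {t})"
    using finite_bal_pairs[OF assms(1,2)] by (rule finite_subset)
  then show ?thesis
    by (simp add: bal_class_def Abs_fset_inverse)
qed

lemma bal_sym: "(t, t') \<in> bal x z \<Longrightarrow> (t', t) \<in> bal x z"
  by (meson sym_Un_converse sym_rtrancl symD)

lemma bal_class_eq:
  assumes "(t, t') \<in> bal x z"
  shows "bal_class C D E \<Omega> \<Psi> x z t = bal_class C D E \<Omega> \<Psi> x z t'"
proof -
  have "bal x z `` {t} = bal x z `` {t'}"
    using assms bal_sym[OF assms] by (auto intro: rtrancl_trans)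
  then show ?thesis
    by (simp add: bal_class_def)
qed

lemma cls_in: "\<lbrakk>y \<in> Obj D; u \<in> el \<Omega> x y; v \<in> el \<Psi> y z\<rbrakk> \<Longrightarrow> cls x z y u v \<in> el compo x z"
  by (auto simp: comp_biset_def cls_def bal_pairs_def)

lemma cls_cases:
  assumes "K \<in> el compo x z"
  obtains y u v where "y \<in> Obj D" "u \<in> el \<Omega> x y" "v \<in> el \<Psi> y z" "K = cls x z y u v"
  using assms by (auto simp: comp_biset_def cls_def bal_pairs_def)

lemma cls_bal:
  assumes "y \<in> Obj D" "y' \<in> Obj D" "\<beta> \<in> Mor D y' y" "u \<in> el \<Omega> x y" "v \<in> el \<Psi> y' z"
  shows "cls x z y' (bact \<Omega> x y x y' (Ident C x) \<beta> u) v =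
    cls x z y u (bact \<Psi> y' z y z \<beta> (Ident E z) v)"
  unfolding cls_def using assms
  by (intro bal_class_eq r_into_rtrancl) (auto simp: bal_gen_def)

text \<open>Balancedness is invariance under one generating step, in either direction; chains of
  steps follow by induction.\<close>

lemma bal_invariant:
  assumes bal: "\<And>y y' \<beta> u v. \<lbrakk>y \<in> Obj D; y' \<in> Obj D; \<beta> \<in> Mor D y' y; u \<in> el \<Omega> x y; v \<in> el \<Psi> y' z\<rbrakk> \<Longrightarrow>
      \<psi> y' (bact \<Omega> x y x y' (Ident C x) \<beta> u) v = \<psi> y u (bact \<Psi> y' z y z \<beta> (Ident E z) v)"
    and "(t, t') \<in> bal x z"
  shows "\<psi> (ufst t) (ufst (usnd t)) (usnd (usnd t)) = \<psi> (ufst t') (ufst (usnd t')) (usnd (usnd t'))"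
  using assms(2)
proof (induction rule: rtrancl_induct)
  case (step t' t'')
  have "\<psi> (ufst a) (ufst (usnd a)) (usnd (usnd a)) = \<psi> (ufst b) (ufst (usnd b)) (usnd (usnd b))"
    if "(a, b) \<in> bal_gen C D E \<Omega> \<Psi> x z" for a b
    using that bal by (auto simp: bal_gen_def)
  with step show ?case by auto
qed simp

lemma lift_cls:
  assumes x: "x \<in> Obj C" "z \<in> Obj E" and y: "y \<in> Obj D" "u \<in> el \<Omega> x y" "v \<in> el \<Psi> y z"
    and bal: "\<And>y y' \<beta> u v. \<lbrakk>y \<in> Obj D; y' \<in> Obj D; \<beta> \<in> Mor D y' y; u \<in> el \<Omega> x y; v \<in> el \<Psi> y' z\<rbrakk> \<Longrightarrow>
      \<psi> y' (bact \<Omega> x y x y' (Ident C x) \<beta> u) v = \<psi> y u (bact \<Psi> y' z y z \<beta> (Ident E z) v)"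
  shows "lift \<psi> (cls x z y u v) = \<psi> y u v"
proof -
  let ?t = "UPair y (UPair u v)"
  define t where "t = (SOME t. t \<in> fset (uelems (cls x z y u v)))"
  have "?t \<in> bal_pairs D \<Omega> \<Psi> x z"
    using y by (auto simp: bal_pairs_def)
  then have eq: "fset (uelems (cls x z y u v)) = bal x z `` {?t}"
    using x by (simp add: cls_def fset_bal_class)
  then have "?t \<in> fset (uelems (cls x z y u v))" by auto
  then have "t \<in> fset (uelems (cls x z y u v))"
    unfolding t_def by (rule someI)
  then have "(?t, t) \<in> bal x z" by (simp add: eq)
  from bal_invariant[where \<psi> = \<psi>, OF bal this] show ?thesis
    by (simp add: lift_def t_def Let_def)
qed

text \<open>A balanced map cannot tell equal classes apart. With \<open>\<psi>\<close> taking
  classes of another composite as values, this transports equations from one quotient to another,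
  and most injectivity proofs below rest on it.\<close>

lemma cls_eqD:
  assumes "cls x z y u v = cls x z y' u' v'" and x: "x \<in> Obj C" "z \<in> Obj E"
    and "y \<in> Obj D" "u \<in> el \<Omega> x y" "v \<in> el \<Psi> y z" "y' \<in> Obj D" "u' \<in> el \<Omega> x y'" "v' \<in> el \<Psi> y' z"
    and bal: "\<And>y y' \<beta> u v. \<lbrakk>y \<in> Obj D; y' \<in> Obj D; \<beta> \<in> Mor D y' y; u \<in> el \<Omega> x y; v \<in> el \<Psi> y' z\<rbrakk> \<Longrightarrow>
      \<psi> y' (bact \<Omega> x y x y' (Ident C x) \<beta> u) v = \<psi> y u (bact \<Psi> y' z y z \<beta> (Ident E z) v)"
  shows "\<psi> y u v = \<psi> y' u' v'"
proof -
  have "\<psi> y u v = lift \<psi> (cls x z y u v)"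
    by (rule lift_cls[where \<psi> = \<psi>, OF assms(2-6), symmetric]) (rule bal; assumption)
  also have "\<dots> = \<psi> y' u' v'"
    unfolding assms(1) by (rule lift_cls[where \<psi> = \<psi>, OF assms(2,3,7-9)]) (rule bal; assumption)
  finally show ?thesis .
qed

lemma cls_act:
  assumes x: "x \<in> Obj C" "z \<in> Obj E" "x' \<in> Obj C" "z' \<in> Obj E" "\<alpha> \<in> Mor C x x'" "\<gamma> \<in> Mor E z' z"
    and y: "y \<in> Obj D" "u \<in> el \<Omega> x y" "v \<in> el \<Psi> y z"
  shows "bact compo x z x' z' \<alpha> \<gamma> (cls x z y u v) =
    cls x' z' y (bact \<Omega> x y x' y \<alpha> (Ident D y) u) (bact \<Psi> y z y z' (Ident D y) \<gamma> v)"
proof -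
  let ?\<psi> = "\<lambda>y u v. cls x' z' y (bact \<Omega> x y x' y \<alpha> (Ident D y) u) (bact \<Psi> y z y z' (Ident D y) \<gamma> v)"
  let ?f = "\<lambda>t. ?\<psi> (ufst t) (ufst (usnd t)) (usnd (usnd t))"
  let ?t = "UPair y (UPair u v)"
  have "?t \<in> bal_pairs D \<Omega> \<Psi> x z"
    using y by (auto simp: bal_pairs_def)
  then have eq: "fset (uelems (cls x z y u v)) = bal x z `` {?t}"
    using x by (simp add: cls_def fset_bal_class)
  \<comment> \<open>Left and right actions commute, so acting on both outer variables preserves
    balancing. Hence \<open>?f\<close> is constant on the class and \<open>the_elem\<close> is
    applied to a singleton.\<close>
  have bal: "?\<psi> y' (bact \<Omega> x y x y' (Ident C x) \<beta> u) v = ?\<psi> y u (bact \<Psi> y' z y z \<beta> (Ident E z) v)"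
    if "y \<in> Obj D" "y' \<in> Obj D" "\<beta> \<in> Mor D y' y" "u \<in> el \<Omega> x y" "v \<in> el \<Psi> y' z" for y y' \<beta> u v
    using that x cls_bal[of y y' \<beta> "bact \<Omega> x y x' y \<alpha> (Ident D y) u" x' "bact \<Psi> y' z y' z' (Ident D y') \<gamma> v" z']
    by simp
  have const: "?f t = ?f ?t" if "t \<in> bal x z `` {?t}" for t
  proof -
    have "(?t, t) \<in> bal x z" using that by simp
    from bal_invariant[where \<psi> = ?\<psi>, OF bal this] show ?thesis by simp
  qed
  have "bact compo x z x' z' \<alpha> \<gamma> (cls x z y u v) = the_elem (?f ` (bal x z `` {?t}))"
    using cls_in[OF y] by (simp add: comp_biset_def Let_def eq[unfolded cls_def] cls_def)
  also have "\<dots> = ?f ?t"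
    by (rule the_elem_image_unique) (use const in auto)
  finally show ?thesis by simp
qed

lemma finite_el_comp: "\<lbrakk>x \<in> Obj C; z \<in> Obj E\<rbrakk> \<Longrightarrow> finite (el compo x z)"
  using finite_bal_pairs by (simp add: comp_biset_def)

lemma bset_comp: "bset C E compo"
proof (unfold_locales, rule bisetI)
  fix x z x' z' \<alpha> \<gamma> K
  assume "x \<in> Obj C" "z \<in> Obj E" "x' \<in> Obj C" "z' \<in> Obj E" "\<alpha> \<in> Mor C x x'" "\<gamma> \<in> Mor E z' z"
  moreover assume "K \<in> el compo x z"
  ultimately show "bact compo x z x' z' \<alpha> \<gamma> K \<in> el compo x' z'"
    by (auto elim!: cls_cases simp: cls_act intro!: cls_in)
next
  fix x z x' z' \<alpha> \<gamma> K
  assume "K \<notin> el compo x z"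
  then show "bact compo x z x' z' \<alpha> \<gamma> K = undefined"
    by (auto simp: comp_biset_def)
next
  fix x z K
  assume "x \<in> Obj C" "z \<in> Obj E" "K \<in> el compo x z"
  then show "bact compo x z x z (Ident C x) (Ident E z) K = K"
    by (auto elim!: cls_cases simp: cls_act)
next
  fix x z x' z' x'' z'' \<alpha> \<gamma> \<alpha>' \<gamma>' K
  assume *: "x \<in> Obj C" "z \<in> Obj E" "x' \<in> Obj C" "z' \<in> Obj E" "x'' \<in> Obj C" "z'' \<in> Obj E"
    "\<alpha> \<in> Mor C x x'" "\<gamma> \<in> Mor E z' z" "\<alpha>' \<in> Mor C x' x''" "\<gamma>' \<in> Mor E z'' z'"
  moreover assume "K \<in> el compo x z"
  ultimately show "bact compo x' z' x'' z'' \<alpha>' \<gamma>' (bact compo x z x' z' \<alpha> \<gamma> K) =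
      bact compo x z x'' z'' (Comp C x x' x'' \<alpha>' \<alpha>) (Comp E z'' z' z \<gamma> \<gamma>') K"
    by (auto elim!: cls_cases simp: cls_act)
qed (simp_all add: finite_el_comp \<Omega>.C.category_axioms \<Psi>.D.category_axioms)

text \<open>By the universal property a balanced natural \<open>\<psi>\<close> induces a map of
  bisets. The premise \<open>inj\<close> speaks of representatives: equal values of
  \<open>\<psi>\<close> must come from one class. Applications verify this by a balanced map in the
  other direction or by a normal form for pairs.\<close>

lemma comp_isoI:
  assumes \<psi>_in: "\<And>x y z u v. \<lbrakk>x \<in> Obj C; y \<in> Obj D; z \<in> Obj E; u \<in> el \<Omega> x y; v \<in> el \<Psi> y z\<rbrakk>
      \<Longrightarrow> \<psi> x z y u v \<in> el \<Theta> x z"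
    and bal: "\<And>x y y' z \<beta> u v. \<lbrakk>x \<in> Obj C; y \<in> Obj D; y' \<in> Obj D; z \<in> Obj E; \<beta> \<in> Mor D y' y;
        u \<in> el \<Omega> x y; v \<in> el \<Psi> y' z\<rbrakk> \<Longrightarrow>
      \<psi> x z y' (bact \<Omega> x y x y' (Ident C x) \<beta> u) v = \<psi> x z y u (bact \<Psi> y' z y z \<beta> (Ident E z) v)"
    and nat: "\<And>x y z x' z' \<alpha> \<gamma> u v. \<lbrakk>x \<in> Obj C; y \<in> Obj D; z \<in> Obj E; x' \<in> Obj C; z' \<in> Obj E;
        \<alpha> \<in> Mor C x x'; \<gamma> \<in> Mor E z' z; u \<in> el \<Omega> x y; v \<in> el \<Psi> y z\<rbrakk> \<Longrightarrow>
      \<psi> x' z' y (bact \<Omega> x y x' y \<alpha> (Ident D y) u) (bact \<Psi> y z y z' (Ident D y) \<gamma> v) =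
      bact \<Theta> x z x' z' \<alpha> \<gamma> (\<psi> x z y u v)"
    and surj: "\<And>x z w. \<lbrakk>x \<in> Obj C; z \<in> Obj E; w \<in> el \<Theta> x z\<rbrakk>
      \<Longrightarrow> \<exists>y\<in>Obj D. \<exists>u\<in>el \<Omega> x y. \<exists>v\<in>el \<Psi> y z. w = \<psi> x z y u v"
    and inj: "\<And>x y y' z u v u' v'. \<lbrakk>x \<in> Obj C; y \<in> Obj D; y' \<in> Obj D; z \<in> Obj E;
        u \<in> el \<Omega> x y; v \<in> el \<Psi> y z; u' \<in> el \<Omega> x y'; v' \<in> el \<Psi> y' z;
        \<psi> x z y u v = \<psi> x z y' u' v'\<rbrakk> \<Longrightarrow> cls x z y u v = cls x z y' u' v'"
  shows "biset_iso C E compo \<Theta>"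
proof (rule biset_isoI[OF bset_comp, where \<eta> = "\<lambda>x z. lift (\<psi> x z)"])
  have L: "lift (\<psi> x z) (cls x z y u v) = \<psi> x z y u v"
    if "x \<in> Obj C" "z \<in> Obj E" "y \<in> Obj D" "u \<in> el \<Omega> x y" "v \<in> el \<Psi> y z" for x y z u v
    by (rule lift_cls[where \<psi> = "\<psi> x z", OF that]) (rule bal; (assumption | rule that))
  {
    fix x z assume x: "x \<in> Obj C" "z \<in> Obj E"
    show "bij_betw (lift (\<psi> x z)) (el compo x z) (el \<Theta> x z)"
      unfolding bij_betw_def
    proof (intro conjI inj_onI equalityI subsetI)
      fix K K'
      assume eq: "lift (\<psi> x z) K = lift (\<psi> x z) K'"
      assume "K \<in> el compo x z"
      then obtain y u v where K: "y \<in> Obj D" "u \<in> el \<Omega> x y" "v \<in> el \<Psi> y z" "K = cls x z y u v"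
        by (rule cls_cases)
      assume "K' \<in> el compo x z"
      then obtain y' u' v' where K': "y' \<in> Obj D" "u' \<in> el \<Omega> x y'" "v' \<in> el \<Psi> y' z"
        "K' = cls x z y' u' v'"
        by (rule cls_cases)
      show "K = K'"
        unfolding K(4) K'(4) by (rule inj) (use x K K' eq in \<open>simp_all add: L\<close>)
    next
      fix w assume "w \<in> lift (\<psi> x z) ` el compo x z"
      then show "w \<in> el \<Theta> x z"
        using x by (auto elim!: cls_cases simp: L intro: \<psi>_in)
    next
      fix w assume "w \<in> el \<Theta> x z"
      then obtain y u v where "y \<in> Obj D" "u \<in> el \<Omega> x y" "v \<in> el \<Psi> y z" "w = \<psi> x z y u v"
        using surj[OF x] by blast
      then show "w \<in> lift (\<psi> x z) ` el compo x z"
        using x by (intro image_eqI[of _ _ "cls x z y u v"]) (simp_all add: L cls_in)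
    qed
  next
    fix x z x' z' \<alpha> \<gamma> K
    assume "x \<in> Obj C" "z \<in> Obj E" "x' \<in> Obj C" "z' \<in> Obj E" "\<alpha> \<in> Mor C x x'" "\<gamma> \<in> Mor E z' z"
    moreover assume "K \<in> el compo x z"
    ultimately show "lift (\<psi> x' z') (bact compo x z x' z' \<alpha> \<gamma> K) = bact \<Theta> x z x' z' \<alpha> \<gamma> (lift (\<psi> x z) K)"
      by (auto elim!: cls_cases simp: cls_act L nat)
  }
qed

end

section \<open>Composition up to isomorphism: invariance, additivity, associativity\<close>

lemma finite_categoryD:
  "finite_category C \<Longrightarrow> category C" "finite_category C \<Longrightarrow> finite (Obj C)"
  by (simp_all add: finite_category_def)

lemma bcompI: "\<lbrakk>bset C D \<Omega>; bset D E \<Psi>; finite_category D\<rbrakk> \<Longrightarrow> bcomp C D E \<Omega> \<Psi>"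
  by (simp add: bcomp_def bcomp_axioms_def finite_category_def)

lemma biset_iso_inverseE:
  assumes \<Omega>: "bset C D \<Omega>" and iso: "biset_iso C D \<Omega> \<Psi>"
  obtains \<eta> \<theta> where
    "\<And>x y u. \<lbrakk>x \<in> Obj C; y \<in> Obj D; u \<in> el \<Omega> x y\<rbrakk> \<Longrightarrow> \<eta> x y u \<in> el \<Psi> x y"
    "\<And>x y u. \<lbrakk>x \<in> Obj C; y \<in> Obj D; u \<in> el \<Psi> x y\<rbrakk> \<Longrightarrow> \<theta> x y u \<in> el \<Omega> x y"
    "\<And>x y u. \<lbrakk>x \<in> Obj C; y \<in> Obj D; u \<in> el \<Omega> x y\<rbrakk> \<Longrightarrow> \<theta> x y (\<eta> x y u) = u"
    "\<And>x y u. \<lbrakk>x \<in> Obj C; y \<in> Obj D; u \<in> el \<Psi> x y\<rbrakk> \<Longrightarrow> \<eta> x y (\<theta> x y u) = u"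
    "\<And>x y x' y' \<alpha> \<beta> u. \<lbrakk>x \<in> Obj C; y \<in> Obj D; x' \<in> Obj C; y' \<in> Obj D; \<alpha> \<in> Mor C x x';
      \<beta> \<in> Mor D y' y; u \<in> el \<Omega> x y\<rbrakk> \<Longrightarrow>
      \<eta> x' y' (bact \<Omega> x y x' y' \<alpha> \<beta> u) = bact \<Psi> x y x' y' \<alpha> \<beta> (\<eta> x y u)"
    "\<And>x y x' y' \<alpha> \<beta> u. \<lbrakk>x \<in> Obj C; y \<in> Obj D; x' \<in> Obj C; y' \<in> Obj D; \<alpha> \<in> Mor C x x';
      \<beta> \<in> Mor D y' y; u \<in> el \<Psi> x y\<rbrakk> \<Longrightarrow>
      \<theta> x' y' (bact \<Psi> x y x' y' \<alpha> \<beta> u) = bact \<Omega> x y x' y' \<alpha> \<beta> (\<theta> x y u)"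
proof -
  interpret \<Omega>: bset C D \<Omega> by fact
  obtain \<eta> where bij: "\<And>x y. \<lbrakk>x \<in> Obj C; y \<in> Obj D\<rbrakk> \<Longrightarrow> bij_betw (\<eta> x y) (el \<Omega> x y) (el \<Psi> x y)"
    and nat: "\<And>x y x' y' \<alpha> \<beta> u. \<lbrakk>x \<in> Obj C; y \<in> Obj D; x' \<in> Obj C; y' \<in> Obj D; \<alpha> \<in> Mor C x x';
      \<beta> \<in> Mor D y' y; u \<in> el \<Omega> x y\<rbrakk> \<Longrightarrow>
      \<eta> x' y' (bact \<Omega> x y x' y' \<alpha> \<beta> u) = bact \<Psi> x y x' y' \<alpha> \<beta> (\<eta> x y u)"
    by (rule biset_isoE[OF iso]) blast
  define \<theta> where "\<theta> x y = inv_into (el \<Omega> x y) (\<eta> x y)" for x y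
  have \<eta>\<theta>: "\<eta> x y (\<theta> x y u) = u" "\<theta> x y u \<in> el \<Omega> x y"
    if "x \<in> Obj C" "y \<in> Obj D" "u \<in> el \<Psi> x y" for x y u
    using that bij_betw_inv_into_right[OF bij] bij_betw_apply[OF bij_betw_inv_into[OF bij]]
    by (simp_all add: \<theta>_def)
  have \<theta>\<eta>: "\<theta> x y (\<eta> x y u) = u" if "x \<in> Obj C" "y \<in> Obj D" "u \<in> el \<Omega> x y" for x y u
    using that bij_betw_inv_into_left[OF bij] by (simp add: \<theta>_def)
  have "\<theta> x' y' (bact \<Psi> x y x' y' \<alpha> \<beta> u) = bact \<Omega> x y x' y' \<alpha> \<beta> (\<theta> x y u)"
    if "x \<in> Obj C" "y \<in> Obj D" "x' \<in> Obj C" "y' \<in> Obj D" "\<alpha> \<in> Mor C x x'"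
      "\<beta> \<in> Mor D y' y" "u \<in> el \<Psi> x y" for x y x' y' \<alpha> \<beta> u
    using that \<theta>\<eta>[of x' y' "bact \<Omega> x y x' y' \<alpha> \<beta> (\<theta> x y u)"] by (simp add: nat \<eta>\<theta>)
  with bij_betw_apply[OF bij] \<eta>\<theta> \<theta>\<eta> nat show thesis
    by (intro that[of \<eta> \<theta>])
qed

lemma comp_biset_cong:
  assumes D: "finite_category D" and \<Omega>: "bset C D \<Omega>" and \<Omega>': "bset C D \<Omega>'"
    and \<Psi>: "bset D E \<Psi>" and \<Psi>': "bset D E \<Psi>'"
    and "biset_iso C D \<Omega> \<Omega>'" "biset_iso D E \<Psi> \<Psi>'"
  shows "biset_iso C E (comp_biset C D E \<Omega> \<Psi>) (comp_biset C D E \<Omega>' \<Psi>')"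
proof -
  interpret c: bcomp C D E \<Omega> \<Psi> by (rule bcompI[OF \<Omega> \<Psi> D])
  interpret c': bcomp C D E \<Omega>' \<Psi>' by (rule bcompI[OF \<Omega>' \<Psi>' D])
  obtain \<eta> \<eta>' where \<eta>:
    "\<And>x y u. \<lbrakk>x \<in> Obj C; y \<in> Obj D; u \<in> el \<Omega> x y\<rbrakk> \<Longrightarrow> \<eta> x y u \<in> el \<Omega>' x y"
    "\<And>x y u. \<lbrakk>x \<in> Obj C; y \<in> Obj D; u \<in> el \<Omega>' x y\<rbrakk> \<Longrightarrow> \<eta>' x y u \<in> el \<Omega> x y"
    "\<And>x y u. \<lbrakk>x \<in> Obj C; y \<in> Obj D; u \<in> el \<Omega> x y\<rbrakk> \<Longrightarrow> \<eta>' x y (\<eta> x y u) = u"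
    "\<And>x y u. \<lbrakk>x \<in> Obj C; y \<in> Obj D; u \<in> el \<Omega>' x y\<rbrakk> \<Longrightarrow> \<eta> x y (\<eta>' x y u) = u"
    "\<And>x y x' y' \<alpha> \<beta> u. \<lbrakk>x \<in> Obj C; y \<in> Obj D; x' \<in> Obj C; y' \<in> Obj D; \<alpha> \<in> Mor C x x';
      \<beta> \<in> Mor D y' y; u \<in> el \<Omega> x y\<rbrakk> \<Longrightarrow>
      \<eta> x' y' (bact \<Omega> x y x' y' \<alpha> \<beta> u) = bact \<Omega>' x y x' y' \<alpha> \<beta> (\<eta> x y u)"
    "\<And>x y x' y' \<alpha> \<beta> u. \<lbrakk>x \<in> Obj C; y \<in> Obj D; x' \<in> Obj C; y' \<in> Obj D; \<alpha> \<in> Mor C x x';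
      \<beta> \<in> Mor D y' y; u \<in> el \<Omega>' x y\<rbrakk> \<Longrightarrow>
      \<eta>' x' y' (bact \<Omega>' x y x' y' \<alpha> \<beta> u) = bact \<Omega> x y x' y' \<alpha> \<beta> (\<eta>' x y u)"
    by (rule biset_iso_inverseE[OF \<Omega> assms(6)]) blast
  obtain \<theta> \<theta>' where \<theta>:
    "\<And>x y u. \<lbrakk>x \<in> Obj D; y \<in> Obj E; u \<in> el \<Psi> x y\<rbrakk> \<Longrightarrow> \<theta> x y u \<in> el \<Psi>' x y"
    "\<And>x y u. \<lbrakk>x \<in> Obj D; y \<in> Obj E; u \<in> el \<Psi>' x y\<rbrakk> \<Longrightarrow> \<theta>' x y u \<in> el \<Psi> x y"
    "\<And>x y u. \<lbrakk>x \<in> Obj D; y \<in> Obj E; u \<in> el \<Psi> x y\<rbrakk> \<Longrightarrow> \<theta>' x y (\<theta> x y u) = u"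
    "\<And>x y u. \<lbrakk>x \<in> Obj D; y \<in> Obj E; u \<in> el \<Psi>' x y\<rbrakk> \<Longrightarrow> \<theta> x y (\<theta>' x y u) = u"
    "\<And>x y x' y' \<alpha> \<beta> u. \<lbrakk>x \<in> Obj D; y \<in> Obj E; x' \<in> Obj D; y' \<in> Obj E; \<alpha> \<in> Mor D x x';
      \<beta> \<in> Mor E y' y; u \<in> el \<Psi> x y\<rbrakk> \<Longrightarrow>
      \<theta> x' y' (bact \<Psi> x y x' y' \<alpha> \<beta> u) = bact \<Psi>' x y x' y' \<alpha> \<beta> (\<theta> x y u)"
    "\<And>x y x' y' \<alpha> \<beta> u. \<lbrakk>x \<in> Obj D; y \<in> Obj E; x' \<in> Obj D; y' \<in> Obj E; \<alpha> \<in> Mor D x x';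
      \<beta> \<in> Mor E y' y; u \<in> el \<Psi>' x y\<rbrakk> \<Longrightarrow>
      \<theta>' x' y' (bact \<Psi>' x y x' y' \<alpha> \<beta> u) = bact \<Psi> x y x' y' \<alpha> \<beta> (\<theta>' x y u)"
    by (rule biset_iso_inverseE[OF \<Psi> assms(7)]) blast
  show ?thesis
  proof (rule c.comp_isoI[where \<psi> = "\<lambda>x z y u v. c'.cls x z y (\<eta> x y u) (\<theta> y z v)"])
    fix x z w
    assume x: "x \<in> Obj C" "z \<in> Obj E" and "w \<in> el (comp_biset C D E \<Omega>' \<Psi>') x z"
    then obtain y u v where yuv: "y \<in> Obj D" "u \<in> el \<Omega>' x y" "v \<in> el \<Psi>' y z" "w = c'.cls x z y u v"
      by (auto elim: c'.cls_cases)
    with x show "\<exists>y\<in>Obj D. \<exists>u\<in>el \<Omega> x y. \<exists>v\<in>el \<Psi> y z. w = c'.cls x z y (\<eta> x y u) (\<theta> y z v)"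
      by (intro bexI[of _ y] bexI[of _ "\<eta>' x y u"] bexI[of _ "\<theta>' y z v"]) (simp_all add: \<eta> \<theta>)
  next
    fix x y y' z u v u' v'
    assume *: "x \<in> Obj C" "y \<in> Obj D" "y' \<in> Obj D" "z \<in> Obj E"
        "u \<in> el \<Omega> x y" "v \<in> el \<Psi> y z" "u' \<in> el \<Omega> x y'" "v' \<in> el \<Psi> y' z"
      and eq: "c'.cls x z y (\<eta> x y u) (\<theta> y z v) = c'.cls x z y' (\<eta> x y' u') (\<theta> y' z v')"
    \<comment> \<open>The inverse isomorphisms give a balanced map back to the first composite;
      applied to \<open>eq\<close> it undoes \<open>\<eta>\<close> and
      \<open>\<theta>\<close>.\<close>
    let ?\<psi> = "\<lambda>y a b. c.cls x z y (\<eta>' x y a) (\<theta>' y z b)"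
    have "?\<psi> y (\<eta> x y u) (\<theta> y z v) = ?\<psi> y' (\<eta> x y' u') (\<theta> y' z v')"
      by (rule c'.cls_eqD[OF eq]) (use * in \<open>simp_all add: \<eta> \<theta> c.cls_bal\<close>)
    then show "c.cls x z y u v = c.cls x z y' u' v'"
      using * by (simp add: \<eta> \<theta>)
  qed (simp_all add: \<eta> \<theta> c'.cls_in c'.cls_bal c'.cls_act)
qed

lemma comp_biset_sum_left:
  assumes D: "finite_category D" and \<Omega>: "bset C D \<Omega>" and \<Omega>': "bset C D \<Omega>'" and \<Psi>: "bset D E \<Psi>"
  shows "biset_iso C E (comp_biset C D E (sum_biset \<Omega> \<Omega>') \<Psi>)
    (sum_biset (comp_biset C D E \<Omega> \<Psi>) (comp_biset C D E \<Omega>' \<Psi>))"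
proof -
  interpret s: bcomp C D E "sum_biset \<Omega> \<Omega>'" \<Psi> by (rule bcompI[OF bset_sum[OF \<Omega> \<Omega>'] \<Psi> D])
  interpret c: bcomp C D E \<Omega> \<Psi> by (rule bcompI[OF \<Omega> \<Psi> D])
  interpret c': bcomp C D E \<Omega>' \<Psi> by (rule bcompI[OF \<Omega>' \<Psi> D])
  let ?\<psi> = "\<lambda>x z y w v. case w of UInl u \<Rightarrow> UInl (c.cls x z y u v) | UInr u \<Rightarrow> UInr (c'.cls x z y u v)"
  show ?thesis
  proof (rule s.comp_isoI[where \<psi> = ?\<psi>])
    fix x z w
    assume x: "x \<in> Obj C" "z \<in> Obj E"
      and "w \<in> el (sum_biset (comp_biset C D E \<Omega> \<Psi>) (comp_biset C D E \<Omega>' \<Psi>)) x z"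
    then consider K where "w = UInl K" "K \<in> el (comp_biset C D E \<Omega> \<Psi>) x z"
      | K where "w = UInr K" "K \<in> el (comp_biset C D E \<Omega>' \<Psi>) x z"
      by auto
    then show "\<exists>y\<in>Obj D. \<exists>u\<in>el (sum_biset \<Omega> \<Omega>') x y. \<exists>v\<in>el \<Psi> y z. w = ?\<psi> x z y u v"
    proof cases
      case 1
      obtain y u v where "y \<in> Obj D" "u \<in> el \<Omega> x y" "v \<in> el \<Psi> y z" "K = c.cls x z y u v"
        using 1(2) by (rule c.cls_cases)
      then show ?thesis using 1 by (intro bexI[of _ y] bexI[of _ "UInl u"] bexI[of _ v]) simp_all
    next
      case 2
      obtain y u v where "y \<in> Obj D" "u \<in> el \<Omega>' x y" "v \<in> el \<Psi> y z" "K = c'.cls x z y u v"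
        using 2(2) by (rule c'.cls_cases)
      then show ?thesis using 2 by (intro bexI[of _ y] bexI[of _ "UInr u"] bexI[of _ v]) simp_all
    qed
  next
    fix x y y' z u v u' v'
    assume *: "x \<in> Obj C" "y \<in> Obj D" "y' \<in> Obj D" "z \<in> Obj E"
        "u \<in> el (sum_biset \<Omega> \<Omega>') x y" "v \<in> el \<Psi> y z" "u' \<in> el (sum_biset \<Omega> \<Omega>') x y'" "v' \<in> el \<Psi> y' z"
      and eq: "?\<psi> x z y u v = ?\<psi> x z y' u' v'"
    \<comment> \<open>Equal values of \<open>?\<psi>\<close> carry the same tag, so both
      representatives come from the same summand.\<close>
    consider a a' where "u = UInl a" "u' = UInl a'" "a \<in> el \<Omega> x y" "a' \<in> el \<Omega> x y'"
        "c.cls x z y a v = c.cls x z y' a' v'"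
      | a a' where "u = UInr a" "u' = UInr a'" "a \<in> el \<Omega>' x y" "a' \<in> el \<Omega>' x y'"
        "c'.cls x z y a v = c'.cls x z y' a' v'"
      using * eq by auto
    then show "s.cls x z y u v = s.cls x z y' u' v'"
    proof cases
      case 1
      have "s.cls x z y (UInl a) v = s.cls x z y' (UInl a') v'"
      proof (rule c.cls_eqD[where \<psi> = "\<lambda>y a v. s.cls x z y (UInl a) v", OF 1(5)])
        fix y y' \<beta> u v
        assume "y \<in> Obj D" "y' \<in> Obj D" "\<beta> \<in> Mor D y' y" "u \<in> el \<Omega> x y" "v \<in> el \<Psi> y' z"
        then show "s.cls x z y' (UInl (bact \<Omega> x y x y' (Ident C x) \<beta> u)) v =
            s.cls x z y (UInl u) (bact \<Psi> y' z y z \<beta> (Ident E z) v)"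
          using s.cls_bal[of y y' \<beta> "UInl u" x v z] by simp
      qed (use * 1(3,4) in simp_all)
      then show ?thesis by (simp add: 1)
    next
      case 2
      have "s.cls x z y (UInr a) v = s.cls x z y' (UInr a') v'"
      proof (rule c'.cls_eqD[where \<psi> = "\<lambda>y a v. s.cls x z y (UInr a) v", OF 2(5)])
        fix y y' \<beta> u v
        assume "y \<in> Obj D" "y' \<in> Obj D" "\<beta> \<in> Mor D y' y" "u \<in> el \<Omega>' x y" "v \<in> el \<Psi> y' z"
        then show "s.cls x z y' (UInr (bact \<Omega>' x y x y' (Ident C x) \<beta> u)) v =
            s.cls x z y (UInr u) (bact \<Psi> y' z y z \<beta> (Ident E z) v)"
          using s.cls_bal[of y y' \<beta> "UInr u" x v z] by simp
      qed (use * 2(3,4) in simp_all)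
      then show ?thesis by (simp add: 2)
    qed
  qed (auto simp: c.cls_in c.cls_bal c.cls_act c'.cls_in c'.cls_bal c'.cls_act)
qed

lemma comp_biset_sum_right:
  assumes D: "finite_category D" and \<Omega>: "bset C D \<Omega>" and \<Psi>: "bset D E \<Psi>" and \<Psi>': "bset D E \<Psi>'"
  shows "biset_iso C E (comp_biset C D E \<Omega> (sum_biset \<Psi> \<Psi>'))
    (sum_biset (comp_biset C D E \<Omega> \<Psi>) (comp_biset C D E \<Omega> \<Psi>'))"
proof -
  interpret s: bcomp C D E \<Omega> "sum_biset \<Psi> \<Psi>'" by (rule bcompI[OF \<Omega> bset_sum[OF \<Psi> \<Psi>'] D])
  interpret c: bcomp C D E \<Omega> \<Psi> by (rule bcompI[OF \<Omega> \<Psi> D])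
  interpret c': bcomp C D E \<Omega> \<Psi>' by (rule bcompI[OF \<Omega> \<Psi>' D])
  let ?\<psi> = "\<lambda>x z y u w. case w of UInl v \<Rightarrow> UInl (c.cls x z y u v) | UInr v \<Rightarrow> UInr (c'.cls x z y u v)"
  show ?thesis
  proof (rule s.comp_isoI[where \<psi> = ?\<psi>])
    fix x z w
    assume x: "x \<in> Obj C" "z \<in> Obj E"
      and "w \<in> el (sum_biset (comp_biset C D E \<Omega> \<Psi>) (comp_biset C D E \<Omega> \<Psi>')) x z"
    then consider K where "w = UInl K" "K \<in> el (comp_biset C D E \<Omega> \<Psi>) x z"
      | K where "w = UInr K" "K \<in> el (comp_biset C D E \<Omega> \<Psi>') x z"
      by auto
    then show "\<exists>y\<in>Obj D. \<exists>u\<in>el \<Omega> x y. \<exists>v\<in>el (sum_biset \<Psi> \<Psi>') y z. w = ?\<psi> x z y u v"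
    proof cases
      case 1
      obtain y u v where "y \<in> Obj D" "u \<in> el \<Omega> x y" "v \<in> el \<Psi> y z" "K = c.cls x z y u v"
        using 1(2) by (rule c.cls_cases)
      then show ?thesis using 1 by (intro bexI[of _ y] bexI[of _ u] bexI[of _ "UInl v"]) simp_all
    next
      case 2
      obtain y u v where "y \<in> Obj D" "u \<in> el \<Omega> x y" "v \<in> el \<Psi>' y z" "K = c'.cls x z y u v"
        using 2(2) by (rule c'.cls_cases)
      then show ?thesis using 2 by (intro bexI[of _ y] bexI[of _ u] bexI[of _ "UInr v"]) simp_all
    qed
  next
    fix x y y' z u v u' v'
    assume *: "x \<in> Obj C" "y \<in> Obj D" "y' \<in> Obj D" "z \<in> Obj E"
        "u \<in> el \<Omega> x y" "v \<in> el (sum_biset \<Psi> \<Psi>') y z" "u' \<in> el \<Omega> x y'" "v' \<in> el (sum_biset \<Psi> \<Psi>') y' z"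
      and eq: "?\<psi> x z y u v = ?\<psi> x z y' u' v'"
    consider a a' where "v = UInl a" "v' = UInl a'" "a \<in> el \<Psi> y z" "a' \<in> el \<Psi> y' z"
        "c.cls x z y u a = c.cls x z y' u' a'"
      | a a' where "v = UInr a" "v' = UInr a'" "a \<in> el \<Psi>' y z" "a' \<in> el \<Psi>' y' z"
        "c'.cls x z y u a = c'.cls x z y' u' a'"
      using * eq by auto
    then show "s.cls x z y u v = s.cls x z y' u' v'"
    proof cases
      case 1
      have "s.cls x z y u (UInl a) = s.cls x z y' u' (UInl a')"
      proof (rule c.cls_eqD[where \<psi> = "\<lambda>y u a. s.cls x z y u (UInl a)", OF 1(5)])
        fix y y' \<beta> u v
        assume "y \<in> Obj D" "y' \<in> Obj D" "\<beta> \<in> Mor D y' y" "u \<in> el \<Omega> x y" "v \<in> el \<Psi> y' z"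
        then show "s.cls x z y' (bact \<Omega> x y x y' (Ident C x) \<beta> u) (UInl v) =
            s.cls x z y u (UInl (bact \<Psi> y' z y z \<beta> (Ident E z) v))"
          using s.cls_bal[of y y' \<beta> u x "UInl v" z] by simp
      qed (use * 1(3,4) in simp_all)
      then show ?thesis by (simp add: 1)
    next
      case 2
      have "s.cls x z y u (UInr a) = s.cls x z y' u' (UInr a')"
      proof (rule c'.cls_eqD[where \<psi> = "\<lambda>y u a. s.cls x z y u (UInr a)", OF 2(5)])
        fix y y' \<beta> u v
        assume "y \<in> Obj D" "y' \<in> Obj D" "\<beta> \<in> Mor D y' y" "u \<in> el \<Omega> x y" "v \<in> el \<Psi>' y' z"
        then show "s.cls x z y' (bact \<Omega> x y x y' (Ident C x) \<beta> u) (UInr v) =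
            s.cls x z y u (UInr (bact \<Psi>' y' z y z \<beta> (Ident E z) v))"
          using s.cls_bal[of y y' \<beta> u x "UInr v" z] by simp
      qed (use * 2(3,4) in simp_all)
      then show ?thesis by (simp add: 2)
    qed
  qed (auto simp: c.cls_in c.cls_bal c.cls_act c'.cls_in c'.cls_bal c'.cls_act)
qed

text \<open>Both sides are quotients of the same triples \<open>u\<close>, \<open>v\<close>,
  \<open>t\<close>, with the classes nested differently. Regrouping is defined by lifting over the
  inner class, \<open>?\<psi>\<close> in one direction and \<open>?\<chi>\<close> in the other; each
  lift is legitimate because balancing over the inner middle variable holds in the target composite
  too.\<close>

lemma comp_biset_assoc:
  assumes D: "finite_category D" and E: "finite_category E"
    and \<Omega>: "bset C D \<Omega>" and \<Psi>: "bset D E \<Psi>" and \<Theta>: "bset E F \<Theta>"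
  shows "biset_iso C F (comp_biset C E F (comp_biset C D E \<Omega> \<Psi>) \<Theta>)
    (comp_biset C D F \<Omega> (comp_biset D E F \<Psi> \<Theta>))"
proof -
  interpret a: bcomp C D E \<Omega> \<Psi> by (rule bcompI[OF \<Omega> \<Psi> D])
  interpret b: bcomp D E F \<Psi> \<Theta> by (rule bcompI[OF \<Psi> \<Theta> E])
  interpret l: bcomp C E F "comp_biset C D E \<Omega> \<Psi>" \<Theta> by (rule bcompI[OF a.bset_comp \<Theta> E])
  interpret r: bcomp C D F \<Omega> "comp_biset D E F \<Psi> \<Theta>" by (rule bcompI[OF \<Omega> b.bset_comp D])
  let ?\<psi> = "\<lambda>x w z K t. a.lift (\<lambda>y u v. r.cls x w y u (b.cls y w z v t)) K"
  let ?\<chi> = "\<lambda>x w y u L. b.lift (\<lambda>z v t. l.cls x w z (a.cls x z y u v) t) L"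
  have \<psi>: "?\<psi> x w z (a.cls x z y u v) t = r.cls x w y u (b.cls y w z v t)"
    if "x \<in> Obj C" "z \<in> Obj E" "y \<in> Obj D" "u \<in> el \<Omega> x y" "v \<in> el \<Psi> y z" "w \<in> Obj F" "t \<in> el \<Theta> z w"
    for x y z w u v t
  proof (rule a.lift_cls[OF that(1-5)])
    fix y y' \<beta> u v
    assume "y \<in> Obj D" "y' \<in> Obj D" "\<beta> \<in> Mor D y' y" "u \<in> el \<Omega> x y" "v \<in> el \<Psi> y' z"
    with that show "r.cls x w y' (bact \<Omega> x y x y' (Ident C x) \<beta> u) (b.cls y' w z v t) =
        r.cls x w y u (b.cls y w z (bact \<Psi> y' z y z \<beta> (Ident E z) v) t)"
      by (simp add: r.cls_bal b.cls_in b.cls_act)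
  qed
  have \<chi>: "?\<chi> x w y u (b.cls y w z v t) = l.cls x w z (a.cls x z y u v) t"
    if "y \<in> Obj D" "w \<in> Obj F" "z \<in> Obj E" "v \<in> el \<Psi> y z" "t \<in> el \<Theta> z w" "x \<in> Obj C" "u \<in> el \<Omega> x y"
    for x y z w u v t
  proof (rule b.lift_cls[OF that(1-5)])
    fix z z' \<beta> v t
    assume "z \<in> Obj E" "z' \<in> Obj E" "\<beta> \<in> Mor E z' z" "v \<in> el \<Psi> y z" "t \<in> el \<Theta> z' w"
    with that show "l.cls x w z' (a.cls x z' y u (bact \<Psi> y z y z' (Ident D y) \<beta> v)) t =
        l.cls x w z (a.cls x z y u v) (bact \<Theta> z' w z w \<beta> (Ident F w) t)"
      by (simp add: l.cls_bal[symmetric] a.cls_in a.cls_act)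
  qed
  show ?thesis
  proof (rule l.comp_isoI[where \<psi> = ?\<psi>])
    fix x w L
    assume x: "x \<in> Obj C" "w \<in> Obj F" and "L \<in> el (comp_biset C D F \<Omega> (comp_biset D E F \<Psi> \<Theta>)) x w"
    then obtain y u M where y: "y \<in> Obj D" "u \<in> el \<Omega> x y" "M \<in> el (comp_biset D E F \<Psi> \<Theta>) y w"
      "L = r.cls x w y u M"
      by (auto elim: r.cls_cases)
    from y(3) obtain z v t where z: "z \<in> Obj E" "v \<in> el \<Psi> y z" "t \<in> el \<Theta> z w" "M = b.cls y w z v t"
      by (auto elim: b.cls_cases)
    show "\<exists>z\<in>Obj E. \<exists>K\<in>el (comp_biset C D E \<Omega> \<Psi>) x z. \<exists>t\<in>el \<Theta> z w. L = ?\<psi> x w z K t"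
      using x y z
      by (intro bexI[of _ z] bexI[of _ "a.cls x z y u v"] bexI[of _ t]) (simp_all add: \<psi> a.cls_in)
  next
    fix x z z' w K t K' t'
    assume *: "x \<in> Obj C" "z \<in> Obj E" "z' \<in> Obj E" "w \<in> Obj F"
      "t \<in> el \<Theta> z w" "t' \<in> el \<Theta> z' w"
      and K: "K \<in> el (comp_biset C D E \<Omega> \<Psi>) x z" "K' \<in> el (comp_biset C D E \<Omega> \<Psi>) x z'"
      and eq: "?\<psi> x w z K t = ?\<psi> x w z' K' t'"
    obtain y u v where y: "y \<in> Obj D" "u \<in> el \<Omega> x y" "v \<in> el \<Psi> y z" "K = a.cls x z y u v"
      using K(1) by (rule a.cls_cases)
    obtain y' u' v' where y': "y' \<in> Obj D" "u' \<in> el \<Omega> x y'" "v' \<in> el \<Psi> y' z'" "K' = a.cls x z' y' u' v'"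
      using K(2) by (rule a.cls_cases)
    have eq': "r.cls x w y u (b.cls y w z v t) = r.cls x w y' u' (b.cls y' w z' v' t')"
      using eq * y y' by (simp add: \<psi>)
    \<comment> \<open>The regrouping back is balanced in the outer variable \<open>y\<close>, so it
      may be applied to \<open>eq'\<close>; on representatives it returns the original
      classes.\<close>
    have "?\<chi> x w y u (b.cls y w z v t) = ?\<chi> x w y' u' (b.cls y' w z' v' t')"
    proof (rule r.cls_eqD[where \<psi> = "?\<chi> x w", OF eq'])
      fix y y' \<beta> u L
      assume y: "y \<in> Obj D" "y' \<in> Obj D" "\<beta> \<in> Mor D y' y" "u \<in> el \<Omega> x y"
        and "L \<in> el (comp_biset D E F \<Psi> \<Theta>) y' w"
      then obtain z v t where z: "z \<in> Obj E" "v \<in> el \<Psi> y' z" "t \<in> el \<Theta> z w" "L = b.cls y' w z v t"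
        by (auto elim: b.cls_cases)
      then show "?\<chi> x w y' (bact \<Omega> x y x y' (Ident C x) \<beta> u) L =
          ?\<chi> x w y u (bact (comp_biset D E F \<Psi> \<Theta>) y' w y w \<beta> (Ident F w) L)"
        using * y by (simp add: \<chi> b.cls_act a.cls_bal)
    qed (use * y y' in \<open>simp_all add: b.cls_in\<close>)
    then show "l.cls x w z K t = l.cls x w z' K' t'"
      using * y y' by (simp add: \<chi>)
  next
    fix x z w K t
    assume "x \<in> Obj C" "z \<in> Obj E" "w \<in> Obj F" "K \<in> el (comp_biset C D E \<Omega> \<Psi>) x z" "t \<in> el \<Theta> z w"
    then show "?\<psi> x w z K t \<in> el (comp_biset C D F \<Omega> (comp_biset D E F \<Psi> \<Theta>)) x w"
      by (auto elim!: a.cls_cases simp: \<psi> intro!: r.cls_in b.cls_in)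
  next
    fix x z z' w \<beta> K t
    assume *: "x \<in> Obj C" "z \<in> Obj E" "z' \<in> Obj E" "w \<in> Obj F" "\<beta> \<in> Mor E z' z" "t \<in> el \<Theta> z' w"
      and "K \<in> el (comp_biset C D E \<Omega> \<Psi>) x z"
    then obtain y u v where y: "y \<in> Obj D" "u \<in> el \<Omega> x y" "v \<in> el \<Psi> y z" "K = a.cls x z y u v"
      by (auto elim: a.cls_cases)
    with * show "?\<psi> x w z' (bact (comp_biset C D E \<Omega> \<Psi>) x z x z' (Ident C x) \<beta> K) t =
        ?\<psi> x w z K (bact \<Theta> z' w z w \<beta> (Ident F w) t)"
      by (simp add: \<psi> a.cls_act b.cls_bal)
  next
    fix x z w x' w' \<alpha> \<gamma> K t
    assume *: "x \<in> Obj C" "z \<in> Obj E" "w \<in> Obj F" "x' \<in> Obj C" "w' \<in> Obj F" "\<alpha> \<in> Mor C x x'"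
      "\<gamma> \<in> Mor F w' w" "t \<in> el \<Theta> z w"
      and "K \<in> el (comp_biset C D E \<Omega> \<Psi>) x z"
    then obtain y u v where y: "y \<in> Obj D" "u \<in> el \<Omega> x y" "v \<in> el \<Psi> y z" "K = a.cls x z y u v"
      by (auto elim: a.cls_cases)
    with * show "?\<psi> x' w' z (bact (comp_biset C D E \<Omega> \<Psi>) x z x' z \<alpha> (Ident E z) K)
          (bact \<Theta> z w z w' (Ident E z) \<gamma> t) =
        bact (comp_biset C D F \<Omega> (comp_biset D E F \<Psi> \<Theta>)) x w x' w' \<alpha> \<gamma> (?\<psi> x w z K t)"
      by (simp add: \<psi> a.cls_act b.cls_act r.cls_act b.cls_in)
  qed
qed

section \<open>Bisets of functors\<close>

definition functor_biset :: "'a ucat \<Rightarrow> ('a univ \<Rightarrow> 'a univ) \<Rightarrow> 'a ubiset" where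
  "functor_biset D \<phi> = res_biset (\<lambda>x. x) \<phi> (id_biset D)"

lemma functor_biset_simps [simp]:
  "el (functor_biset D \<phi>) y x = Mor D (\<phi> x) y"
  "f \<in> Mor D (\<phi> x) y \<Longrightarrow> bact (functor_biset D \<phi>) y x y' x' \<alpha> \<beta> f =
     Comp D (\<phi> x') y y' \<alpha> (Comp D (\<phi> x') (\<phi> x) y f (\<phi> \<beta>))"
  by (simp_all add: functor_biset_def)

lemma bset_functor_biset:
  "ufunctor C D \<phi> \<Longrightarrow> finite_category D \<Longrightarrow> bset D C (functor_biset D \<phi>)"
  unfolding functor_biset_def
  by (rule bset_res[OF ufunctor_id _ bset_id]) (simp_all add: finite_categoryD)

text \<open>Co-Yoneda: sliding \<open>f\<close> across brings every pair \<open>(u, f)\<close> to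
  the form \<open>(u f, id)\<close>, and \<open>u f\<close> is then a complete invariant of the
  class.\<close>

lemma comp_functor_biset_right:
  assumes \<phi>: "ufunctor X D \<phi>" and D: "finite_category D" and \<Omega>: "bset C D \<Omega>"
  shows "biset_iso C X (comp_biset C D X \<Omega> (functor_biset D \<phi>)) (res_biset (\<lambda>x. x) \<phi> \<Omega>)"
proof -
  interpret \<phi>: ufunctor X D \<phi> by fact
  interpret c: bcomp C D X \<Omega> "functor_biset D \<phi>"
    by (rule bcompI[OF \<Omega> bset_functor_biset[OF \<phi> D] D])
  have normal: "c.cls x z y u f = c.cls x z (\<phi> z) (bact \<Omega> x y x (\<phi> z) (Ident C x) f u) (Ident D (\<phi> z))"
    if "x \<in> Obj C" "y \<in> Obj D" "z \<in> Obj X" "u \<in> el \<Omega> x y" "f \<in> Mor D (\<phi> z) y" for x y z u f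
    using that by (simp add: c.cls_bal)
  show ?thesis
  proof (rule c.comp_isoI[where \<psi> = "\<lambda>x z y u f. bact \<Omega> x y x (\<phi> z) (Ident C x) f u"])
    fix x z w
    assume "x \<in> Obj C" "z \<in> Obj X" "w \<in> el (res_biset (\<lambda>x. x) \<phi> \<Omega>) x z"
    then show "\<exists>y\<in>Obj D. \<exists>u\<in>el \<Omega> x y. \<exists>f\<in>el (functor_biset D \<phi>) y z.
        w = bact \<Omega> x y x (\<phi> z) (Ident C x) f u"
      by (intro bexI[of _ "\<phi> z"] bexI[of _ w] bexI[of _ "Ident D (\<phi> z)"]) simp_all
  next
    fix x y y' z u f u' f'
    assume "x \<in> Obj C" "y \<in> Obj D" "y' \<in> Obj D" "z \<in> Obj X" "u \<in> el \<Omega> x y" "u' \<in> el \<Omega> x y'"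
      "f \<in> el (functor_biset D \<phi>) y z" "f' \<in> el (functor_biset D \<phi>) y' z"
      "bact \<Omega> x y x (\<phi> z) (Ident C x) f u = bact \<Omega> x y' x (\<phi> z) (Ident C x) f' u'"
    then show "c.cls x z y u f = c.cls x z y' u' f'"
      using normal[of x y z u f] normal[of x y' z u' f'] by simp
  qed simp_all
qed

text \<open>\<open>\<phi>\<close> and \<open>\<psi>\<close> are total maps of the universe, so they
  are required to be inverse to each other only on the objects and morphisms of the two
  categories.\<close>

locale uiso = ufunctor C D \<phi> + inv: ufunctor D C \<psi>
  for C D :: "'a ucat" and \<phi> \<psi> :: "'a univ \<Rightarrow> 'a univ" +
  assumes inv_Obj [simp]: "x \<in> Obj C \<Longrightarrow> \<psi> (\<phi> x) = x" "y \<in> Obj D \<Longrightarrow> \<phi> (\<psi> y) = y"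
    and inv_Mor [simp]: "\<lbrakk>x \<in> Obj C; y \<in> Obj C; f \<in> Mor C x y\<rbrakk> \<Longrightarrow> \<psi> (\<phi> f) = f"
      "\<lbrakk>x' \<in> Obj D; y' \<in> Obj D; g \<in> Mor D x' y'\<rbrakk> \<Longrightarrow> \<phi> (\<psi> g) = g"

text \<open>Invertibility makes every \<open>f : \<phi> y \<rightarrow> d\<close> the image of a
  morphism \<open>y \<rightarrow> \<phi>' d\<close>, which slides across and leaves an identity. So
  the classes at \<open>d\<close> correspond to the elements of \<open>\<Omega>\<close> at
  \<open>\<phi>' d\<close>, and by \<open>iso\<close> to those of \<open>\<Theta>\<close> at
  \<open>d\<close>.\<close>

lemma comp_functor_biset_left:
  assumes "uiso C D \<phi> \<phi>'" and C: "finite_category C" and D: "finite_category D"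
    and \<Omega>: "bset C X \<Omega>" and \<Theta>: "bset D X \<Theta>"
    and iso: "biset_iso C X \<Omega> (res_biset \<phi> (\<lambda>x. x) \<Theta>)"
  shows "biset_iso D X (comp_biset D C X (functor_biset D \<phi>) \<Omega>) \<Theta>"
proof -
  interpret uiso C D \<phi> \<phi>' by fact
  interpret c: bcomp D C X "functor_biset D \<phi>" \<Omega>
    by (rule bcompI[OF bset_functor_biset[OF ufunctor_axioms D] \<Omega> C])
  interpret \<Theta>: bset D X \<Theta> by fact
  obtain \<eta> \<theta> where \<eta>:
    "\<And>x y u. \<lbrakk>x \<in> Obj C; y \<in> Obj X; u \<in> el \<Omega> x y\<rbrakk> \<Longrightarrow> \<eta> x y u \<in> el \<Theta> (\<phi> x) y"
    "\<And>x y u. \<lbrakk>x \<in> Obj C; y \<in> Obj X; u \<in> el \<Theta> (\<phi> x) y\<rbrakk> \<Longrightarrow> \<theta> x y u \<in> el \<Omega> x y"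
    "\<And>x y u. \<lbrakk>x \<in> Obj C; y \<in> Obj X; u \<in> el \<Omega> x y\<rbrakk> \<Longrightarrow> \<theta> x y (\<eta> x y u) = u"
    "\<And>x y u. \<lbrakk>x \<in> Obj C; y \<in> Obj X; u \<in> el \<Theta> (\<phi> x) y\<rbrakk> \<Longrightarrow> \<eta> x y (\<theta> x y u) = u"
    "\<And>x y x' y' \<alpha> \<beta> u. \<lbrakk>x \<in> Obj C; y \<in> Obj X; x' \<in> Obj C; y' \<in> Obj X; \<alpha> \<in> Mor C x x';
      \<beta> \<in> Mor X y' y; u \<in> el \<Omega> x y\<rbrakk> \<Longrightarrow>
      \<eta> x' y' (bact \<Omega> x y x' y' \<alpha> \<beta> u) = bact \<Theta> (\<phi> x) y (\<phi> x') y' (\<phi> \<alpha>) \<beta> (\<eta> x y u)"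
    by (rule biset_iso_inverseE[OF \<Omega> iso]) (simp only: res_biset_simps, blast)
  have normal: "c.cls d x y f u =
      c.cls d x (\<phi>' d) (Ident D d) (\<theta> (\<phi>' d) x (bact \<Theta> (\<phi> y) x d x f (Ident X x) (\<eta> y x u)))"
    if "d \<in> Obj D" "y \<in> Obj C" "x \<in> Obj X" "f \<in> Mor D (\<phi> y) d" "u \<in> el \<Omega> y x" for d x y f u
  proof -
    have f': "\<phi>' f \<in> Mor C y (\<phi>' d)"
      using that inv.map_Mor[of "\<phi> y" d f] by simp
    have f: "\<phi> (\<phi>' f) = f"
      using that by (intro inv_Mor) auto
    have "\<eta> (\<phi>' d) x (bact \<Omega> y x (\<phi>' d) x (\<phi>' f) (Ident X x) u) =
        bact \<Theta> (\<phi> y) x d x f (Ident X x) (\<eta> y x u)"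
      using that f' by (simp add: \<eta> f)
    then have "\<theta> (\<phi>' d) x (bact \<Theta> (\<phi> y) x d x f (Ident X x) (\<eta> y x u)) =
        bact \<Omega> y x (\<phi>' d) x (\<phi>' f) (Ident X x) u"
      using that f' \<eta>(3)[of "\<phi>' d" x "bact \<Omega> y x (\<phi>' d) x (\<phi>' f) (Ident X x) u"] by simp
    then show ?thesis
      using that f' c.cls_bal[of "\<phi>' d" y "\<phi>' f" "Ident D d" d u x] by (simp add: f)
  qed
  show ?thesis
  proof (rule c.comp_isoI[where \<psi> = "\<lambda>d x y f u. bact \<Theta> (\<phi> y) x d x f (Ident X x) (\<eta> y x u)"])
    fix d x w
    assume "d \<in> Obj D" "x \<in> Obj X" "w \<in> el \<Theta> d x"
    then show "\<exists>y\<in>Obj C. \<exists>f\<in>el (functor_biset D \<phi>) d y. \<exists>u\<in>el \<Omega> y x.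
        w = bact \<Theta> (\<phi> y) x d x f (Ident X x) (\<eta> y x u)"
      by (intro bexI[of _ "\<phi>' d"] bexI[of _ "Ident D d"] bexI[of _ "\<theta> (\<phi>' d) x w"]) (simp_all add: \<eta>)
  next
    fix d y y' x f u f' u'
    assume "d \<in> Obj D" "y \<in> Obj C" "y' \<in> Obj C" "x \<in> Obj X" "f \<in> el (functor_biset D \<phi>) d y"
      "u \<in> el \<Omega> y x" "f' \<in> el (functor_biset D \<phi>) d y'" "u' \<in> el \<Omega> y' x"
      "bact \<Theta> (\<phi> y) x d x f (Ident X x) (\<eta> y x u) = bact \<Theta> (\<phi> y') x d x f' (Ident X x) (\<eta> y' x u')"
    then show "c.cls d x y f u = c.cls d x y' f' u'"
      using normal[of d y x f u] normal[of d y' x f' u'] by simp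
  qed (simp_all add: \<eta>)
qed

lemma biset_isoI_inverse:
  assumes \<Omega>: "bset C D \<Omega>"
    and "\<And>x y u. \<lbrakk>x \<in> Obj C; y \<in> Obj D; u \<in> el \<Omega> x y\<rbrakk> \<Longrightarrow> \<eta> x y u \<in> el \<Psi> x y \<and> \<theta> x y (\<eta> x y u) = u"
    and "\<And>x y u. \<lbrakk>x \<in> Obj C; y \<in> Obj D; u \<in> el \<Psi> x y\<rbrakk> \<Longrightarrow> \<theta> x y u \<in> el \<Omega> x y \<and> \<eta> x y (\<theta> x y u) = u"
    and nat: "\<And>x y x' y' \<alpha> \<beta> u. \<lbrakk>x \<in> Obj C; y \<in> Obj D; x' \<in> Obj C; y' \<in> Obj D; \<alpha> \<in> Mor C x x';
      \<beta> \<in> Mor D y' y; u \<in> el \<Omega> x y\<rbrakk> \<Longrightarrow>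
      \<eta> x' y' (bact \<Omega> x y x' y' \<alpha> \<beta> u) = bact \<Psi> x y x' y' \<alpha> \<beta> (\<eta> x y u)"
  shows "biset_iso C D \<Omega> \<Psi>"
proof (rule biset_isoI[OF \<Omega> _ nat])
  show "bij_betw (\<eta> x y) (el \<Omega> x y) (el \<Psi> x y)" if "x \<in> Obj C" "y \<in> Obj D" for x y
    using that assms(2,3) by (intro bij_betw_byWitness[where f' = "\<theta> x y"]) auto
qed

section \<open>Products\<close>

lemma category_prod:
  assumes "category C" "category D"
  shows "category (prod_cat C D)"
proof -
  interpret C: category C by fact
  interpret D: category D by fact
  show ?thesis
    by unfold_locales
      (auto elim!: Obj_prod_catE Mor_prod_catE simp: C.Comp_assoc D.Comp_assoc)
qed

lemma finite_category_prod:
  assumes "finite_category C" "finite_category D"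
  shows "finite_category (prod_cat C D)"
proof -
  have "Obj (prod_cat C D) = (\<lambda>(x, y). UPair x y) ` (Obj C \<times> Obj D)"
    by (auto simp: prod_cat_def)
  moreover have "Mor (prod_cat C D) p q =
      (\<lambda>(f, g). UPair f g) ` (Mor C (ufst p) (ufst q) \<times> Mor D (usnd p) (usnd q))" for p q
    by (auto simp: prod_cat_def)
  ultimately show ?thesis
    using assms by (auto simp: finite_category_def category_prod elim!: Obj_prod_catE)
qed

lemma prod_biset_simps [simp]:
  "UPair u v \<in> el (prod_biset \<Omega> \<Psi>) (UPair x x') (UPair y y') \<longleftrightarrow> u \<in> el \<Omega> x y \<and> v \<in> el \<Psi> x' y'"
  "\<lbrakk>u \<in> el \<Omega> x y; v \<in> el \<Psi> x' y'\<rbrakk> \<Longrightarrow>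
    bact (prod_biset \<Omega> \<Psi>) (UPair x x') (UPair y y') (UPair x1 x1') (UPair y1 y1')
      (UPair \<alpha> \<alpha>') (UPair \<beta> \<beta>') (UPair u v) =
    UPair (bact \<Omega> x y x1 y1 \<alpha> \<beta> u) (bact \<Psi> x' y' x1' y1' \<alpha>' \<beta>' v)"
  by (simp_all add: prod_biset_def)

lemma el_prod_bisetE:
  assumes "w \<in> el (prod_biset \<Omega> \<Psi>) (UPair x x') (UPair y y')"
  obtains u v where "w = UPair u v" "u \<in> el \<Omega> x y" "v \<in> el \<Psi> x' y'"
  using assms by (auto simp: prod_biset_def)

lemmas pairE = Obj_prod_catE Mor_prod_catE el_prod_bisetE

lemma bset_prod:
  assumes "bset C D \<Omega>" "bset C' D' \<Psi>"
  shows "bset (prod_cat C C') (prod_cat D D') (prod_biset \<Omega> \<Psi>)"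
proof -
  interpret \<Omega>: bset C D \<Omega> by fact
  interpret \<Psi>: bset C' D' \<Psi> by fact
  interpret C: category "prod_cat C C'"
    by (rule category_prod[OF \<Omega>.C.category_axioms \<Psi>.C.category_axioms])
  interpret D: category "prod_cat D D'"
    by (rule category_prod[OF \<Omega>.D.category_axioms \<Psi>.D.category_axioms])
  show ?thesis
  proof (unfold_locales, rule bisetI)
    fix p q assume "p \<in> Obj (prod_cat C C')" "q \<in> Obj (prod_cat D D')"
    then obtain x x' y y' where p: "p = UPair x x'" "x \<in> Obj C" "x' \<in> Obj C'"
      and q: "q = UPair y y'" "y \<in> Obj D" "y' \<in> Obj D'"
      by (auto elim!: Obj_prod_catE)
    have "el (prod_biset \<Omega> \<Psi>) p q = (\<lambda>(u, v). UPair u v) ` (el \<Omega> x y \<times> el \<Psi> x' y')"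
      by (auto simp: prod_biset_def p q)
    then show "finite (el (prod_biset \<Omega> \<Psi>) p q)"
      using p q by (simp add: \<Omega>.finite_el \<Psi>.finite_el)
  next
    fix p q p' q' \<alpha> \<beta> w
    assume "w \<notin> el (prod_biset \<Omega> \<Psi>) p q"
    then show "bact (prod_biset \<Omega> \<Psi>) p q p' q' \<alpha> \<beta> w = undefined"
      by (auto simp: prod_biset_def)
  qed (auto elim!: pairE simp: C.category_axioms D.category_axioms)
qed

lemma prod_biset_cong:
  assumes \<Omega>: "bset C D \<Omega>" and \<Psi>: "bset C' D' \<Psi>"
    and "biset_iso C D \<Omega> \<Omega>'" "biset_iso C' D' \<Psi> \<Psi>'"
  shows "biset_iso (prod_cat C C') (prod_cat D D') (prod_biset \<Omega> \<Psi>) (prod_biset \<Omega>' \<Psi>')"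
proof -
  obtain \<eta> \<eta>' where \<eta>:
    "\<And>x y u. \<lbrakk>x \<in> Obj C; y \<in> Obj D; u \<in> el \<Omega> x y\<rbrakk> \<Longrightarrow> \<eta> x y u \<in> el \<Omega>' x y"
    "\<And>x y u. \<lbrakk>x \<in> Obj C; y \<in> Obj D; u \<in> el \<Omega>' x y\<rbrakk> \<Longrightarrow> \<eta>' x y u \<in> el \<Omega> x y"
    "\<And>x y u. \<lbrakk>x \<in> Obj C; y \<in> Obj D; u \<in> el \<Omega> x y\<rbrakk> \<Longrightarrow> \<eta>' x y (\<eta> x y u) = u"
    "\<And>x y u. \<lbrakk>x \<in> Obj C; y \<in> Obj D; u \<in> el \<Omega>' x y\<rbrakk> \<Longrightarrow> \<eta> x y (\<eta>' x y u) = u"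
    "\<And>x y x' y' \<alpha> \<beta> u. \<lbrakk>x \<in> Obj C; y \<in> Obj D; x' \<in> Obj C; y' \<in> Obj D; \<alpha> \<in> Mor C x x';
      \<beta> \<in> Mor D y' y; u \<in> el \<Omega> x y\<rbrakk> \<Longrightarrow>
      \<eta> x' y' (bact \<Omega> x y x' y' \<alpha> \<beta> u) = bact \<Omega>' x y x' y' \<alpha> \<beta> (\<eta> x y u)"
    by (rule biset_iso_inverseE[OF \<Omega> assms(3)]) blast
  obtain \<theta> \<theta>' where \<theta>:
    "\<And>x y u. \<lbrakk>x \<in> Obj C'; y \<in> Obj D'; u \<in> el \<Psi> x y\<rbrakk> \<Longrightarrow> \<theta> x y u \<in> el \<Psi>' x y"
    "\<And>x y u. \<lbrakk>x \<in> Obj C'; y \<in> Obj D'; u \<in> el \<Psi>' x y\<rbrakk> \<Longrightarrow> \<theta>' x y u \<in> el \<Psi> x y"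
    "\<And>x y u. \<lbrakk>x \<in> Obj C'; y \<in> Obj D'; u \<in> el \<Psi> x y\<rbrakk> \<Longrightarrow> \<theta>' x y (\<theta> x y u) = u"
    "\<And>x y u. \<lbrakk>x \<in> Obj C'; y \<in> Obj D'; u \<in> el \<Psi>' x y\<rbrakk> \<Longrightarrow> \<theta> x y (\<theta>' x y u) = u"
    "\<And>x y x' y' \<alpha> \<beta> u. \<lbrakk>x \<in> Obj C'; y \<in> Obj D'; x' \<in> Obj C'; y' \<in> Obj D'; \<alpha> \<in> Mor C' x x';
      \<beta> \<in> Mor D' y' y; u \<in> el \<Psi> x y\<rbrakk> \<Longrightarrow>
      \<theta> x' y' (bact \<Psi> x y x' y' \<alpha> \<beta> u) = bact \<Psi>' x y x' y' \<alpha> \<beta> (\<theta> x y u)"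
    by (rule biset_iso_inverseE[OF \<Psi> assms(4)]) blast
  show ?thesis
    by (rule biset_isoI_inverse[OF bset_prod[OF \<Omega> \<Psi>], where
          \<eta> = "\<lambda>p q w. UPair (\<eta> (ufst p) (ufst q) (ufst w)) (\<theta> (usnd p) (usnd q) (usnd w))" and
          \<theta> = "\<lambda>p q w. UPair (\<eta>' (ufst p) (ufst q) (ufst w)) (\<theta>' (usnd p) (usnd q) (usnd w))"])
      (auto elim!: pairE simp: \<eta> \<theta>)
qed

lemma prod_biset_sum_left:
  assumes \<Omega>: "bset C D \<Omega>" and \<Omega>': "bset C D \<Omega>'" and \<Psi>: "bset C' D' \<Psi>"
  shows "biset_iso (prod_cat C C') (prod_cat D D') (prod_biset (sum_biset \<Omega> \<Omega>') \<Psi>)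
    (sum_biset (prod_biset \<Omega> \<Psi>) (prod_biset \<Omega>' \<Psi>))"
  by (rule biset_isoI_inverse[OF bset_prod[OF bset_sum[OF \<Omega> \<Omega>'] \<Psi>], where
        \<eta> = "\<lambda>p q w. case ufst w of UInl u \<Rightarrow> UInl (UPair u (usnd w)) | UInr u \<Rightarrow> UInr (UPair u (usnd w))" and
        \<theta> = "\<lambda>p q w. case w of UInl t \<Rightarrow> UPair (UInl (ufst t)) (usnd t) | UInr t \<Rightarrow> UPair (UInr (ufst t)) (usnd t)"])
    (auto elim!: pairE)

lemma prod_biset_sum_right:
  assumes \<Omega>: "bset C D \<Omega>" and \<Psi>: "bset C' D' \<Psi>" and \<Psi>': "bset C' D' \<Psi>'"
  shows "biset_iso (prod_cat C C') (prod_cat D D') (prod_biset \<Omega> (sum_biset \<Psi> \<Psi>'))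
    (sum_biset (prod_biset \<Omega> \<Psi>) (prod_biset \<Omega> \<Psi>'))"
  by (rule biset_isoI_inverse[OF bset_prod[OF \<Omega> bset_sum[OF \<Psi> \<Psi>']], where
        \<eta> = "\<lambda>p q w. case usnd w of UInl u \<Rightarrow> UInl (UPair (ufst w) u) | UInr u \<Rightarrow> UInr (UPair (ufst w) u)" and
        \<theta> = "\<lambda>p q w. case w of UInl t \<Rightarrow> UPair (ufst t) (UInl (usnd t)) | UInr t \<Rightarrow> UPair (ufst t) (UInr (usnd t))"])
    (auto elim!: pairE)

text \<open>A class over the product category determines a class in each factor. Conversely the two
  coordinates of a representative can be changed one after the other, because a morphism of one
  factor paired with an identity is a morphism of the product.\<close>

lemma prod_biset_interchange:
  assumes D: "finite_category D" and D': "finite_category D'"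
    and \<Omega>: "bset C D \<Omega>" and \<Omega>': "bset D E \<Omega>'" and \<Psi>: "bset C' D' \<Psi>" and \<Psi>': "bset D' E' \<Psi>'"
  shows "biset_iso (prod_cat C C') (prod_cat E E')
    (comp_biset (prod_cat C C') (prod_cat D D') (prod_cat E E') (prod_biset \<Omega> \<Psi>) (prod_biset \<Omega>' \<Psi>'))
    (prod_biset (comp_biset C D E \<Omega> \<Omega>') (comp_biset C' D' E' \<Psi> \<Psi>'))"
proof -
  interpret a: bcomp C D E \<Omega> \<Omega>' by (rule bcompI[OF \<Omega> \<Omega>' D])
  interpret b: bcomp C' D' E' \<Psi> \<Psi>' by (rule bcompI[OF \<Psi> \<Psi>' D'])
  interpret c: bcomp "prod_cat C C'" "prod_cat D D'" "prod_cat E E'" "prod_biset \<Omega> \<Psi>" "prod_biset \<Omega>' \<Psi>'"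
    by (rule bcompI[OF bset_prod[OF \<Omega> \<Psi>] bset_prod[OF \<Omega>' \<Psi>'] finite_category_prod[OF D D']])
  let ?\<psi> = "\<lambda>p r q s t. UPair (a.cls (ufst p) (ufst r) (ufst q) (ufst s) (ufst t))
      (b.cls (usnd p) (usnd r) (usnd q) (usnd s) (usnd t))"
  show ?thesis
  proof (rule c.comp_isoI[where \<psi> = ?\<psi>])
    fix p r w
    assume "p \<in> Obj (prod_cat C C')" "r \<in> Obj (prod_cat E E')"
      "w \<in> el (prod_biset (comp_biset C D E \<Omega> \<Omega>') (comp_biset C' D' E' \<Psi> \<Psi>')) p r"
    then obtain x x' z z' K L where p: "p = UPair x x'" "r = UPair z z'" and w: "w = UPair K L"
      and K: "K \<in> el (comp_biset C D E \<Omega> \<Omega>') x z" and L: "L \<in> el (comp_biset C' D' E' \<Psi> \<Psi>') x' z'"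
      by (auto elim!: pairE)
    obtain y u v where y: "y \<in> Obj D" "u \<in> el \<Omega> x y" "v \<in> el \<Omega>' y z" "K = a.cls x z y u v"
      using K by (rule a.cls_cases)
    obtain y' u' v' where y': "y' \<in> Obj D'" "u' \<in> el \<Psi> x' y'" "v' \<in> el \<Psi>' y' z'" "L = b.cls x' z' y' u' v'"
      using L by (rule b.cls_cases)
    show "\<exists>q\<in>Obj (prod_cat D D'). \<exists>s\<in>el (prod_biset \<Omega> \<Psi>) p q. \<exists>t\<in>el (prod_biset \<Omega>' \<Psi>') q r. w = ?\<psi> p r q s t"
      using y y' p w
      by (intro bexI[of _ "UPair y y'"] bexI[of _ "UPair u u'"] bexI[of _ "UPair v v'"]) simp_all
  next
    fix p q q' r s t s' t'
    assume p: "p \<in> Obj (prod_cat C C')" and q: "q \<in> Obj (prod_cat D D')" "q' \<in> Obj (prod_cat D D')"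
      and r: "r \<in> Obj (prod_cat E E')"
      and el: "s \<in> el (prod_biset \<Omega> \<Psi>) p q" "t \<in> el (prod_biset \<Omega>' \<Psi>') q r"
      "s' \<in> el (prod_biset \<Omega> \<Psi>) p q'" "t' \<in> el (prod_biset \<Omega>' \<Psi>') q' r"
      and eq: "?\<psi> p r q s t = ?\<psi> p r q' s' t'"
    obtain x x' where p: "p = UPair x x'" "x \<in> Obj C" "x' \<in> Obj C'" using p by (rule Obj_prod_catE)
    obtain z z' where r: "r = UPair z z'" "z \<in> Obj E" "z' \<in> Obj E'" using r by (rule Obj_prod_catE)
    obtain y1 y1' where q: "q = UPair y1 y1'" "y1 \<in> Obj D" "y1' \<in> Obj D'" using q(1) by (rule Obj_prod_catE)
    obtain y2 y2' where q': "q' = UPair y2 y2'" "y2 \<in> Obj D" "y2' \<in> Obj D'" using \<open>q' \<in> _\<close> by (rule Obj_prod_catE)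
    obtain s1 s1' where s: "s = UPair s1 s1'" "s1 \<in> el \<Omega> x y1" "s1' \<in> el \<Psi> x' y1'"
      using el(1) unfolding p q by (rule el_prod_bisetE)
    obtain t1 t1' where t: "t = UPair t1 t1'" "t1 \<in> el \<Omega>' y1 z" "t1' \<in> el \<Psi>' y1' z'"
      using el(2) unfolding r q by (rule el_prod_bisetE)
    obtain s2 s2' where s': "s' = UPair s2 s2'" "s2 \<in> el \<Omega> x y2" "s2' \<in> el \<Psi> x' y2'"
      using el(3) unfolding p q' by (rule el_prod_bisetE)
    obtain t2 t2' where t': "t' = UPair t2 t2'" "t2 \<in> el \<Omega>' y2 z" "t2' \<in> el \<Psi>' y2' z'"
      using el(4) unfolding r q' by (rule el_prod_bisetE)
    have eqs: "a.cls x z y1 s1 t1 = a.cls x z y2 s2 t2" "b.cls x' z' y1' s1' t1' = b.cls x' z' y2' s2' t2'"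
      using eq by (simp_all add: p q r q' s t s' t')
    have "c.cls p r (UPair y1 y1') (UPair s1 s1') (UPair t1 t1') =
        c.cls p r (UPair y2 y1') (UPair s2 s1') (UPair t2 t1')"
    proof (rule a.cls_eqD[where \<psi> = "\<lambda>y s t. c.cls p r (UPair y y1') (UPair s s1') (UPair t t1')", OF eqs(1)])
      fix y y' \<beta> u v
      assume "y \<in> Obj D" "y' \<in> Obj D" "\<beta> \<in> Mor D y' y" "u \<in> el \<Omega> x y" "v \<in> el \<Omega>' y' z"
      then show "c.cls p r (UPair y' y1') (UPair (bact \<Omega> x y x y' (Ident C x) \<beta> u) s1') (UPair v t1') =
          c.cls p r (UPair y y1') (UPair u s1') (UPair (bact \<Omega>' y' z y z \<beta> (Ident E z) v) t1')"
        using p q r s t c.cls_bal[of "UPair y y1'" "UPair y' y1'" "UPair \<beta> (Ident D' y1')" "UPair u s1'" p "UPair v t1'" r]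
        by simp
    qed (use p q r q' s t s' t' in simp_all)
    also have "\<dots> = c.cls p r (UPair y2 y2') (UPair s2 s2') (UPair t2 t2')"
    proof (rule b.cls_eqD[where \<psi> = "\<lambda>y s t. c.cls p r (UPair y2 y) (UPair s2 s) (UPair t2 t)", OF eqs(2)])
      fix y y' \<beta> u v
      assume "y \<in> Obj D'" "y' \<in> Obj D'" "\<beta> \<in> Mor D' y' y" "u \<in> el \<Psi> x' y" "v \<in> el \<Psi>' y' z'"
      then show "c.cls p r (UPair y2 y') (UPair s2 (bact \<Psi> x' y x' y' (Ident C' x') \<beta> u)) (UPair t2 v) =
          c.cls p r (UPair y2 y) (UPair s2 u) (UPair t2 (bact \<Psi>' y' z' y z' \<beta> (Ident E' z') v))"
        using p q' r s' t' c.cls_bal[of "UPair y2 y" "UPair y2 y'" "UPair (Ident D y2) \<beta>" "UPair s2 u" p "UPair t2 v" r]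
        by simp
    qed (use p q r q' s t s' t' in simp_all)
    finally show "c.cls p r q s t = c.cls p r q' s' t'"
      by (simp add: q q' s t s' t')
  qed (auto elim!: pairE simp: a.cls_in a.cls_bal a.cls_act b.cls_in b.cls_bal b.cls_act)
qed

section \<open>Structural isomorphisms\<close>

lemma res_res_biset: "res_biset \<phi> \<psi> (res_biset \<phi>' \<psi>' \<Omega>) = res_biset (\<lambda>x. \<phi>' (\<phi> x)) (\<lambda>x. \<psi>' (\<psi> x)) \<Omega>"
  by (simp add: res_biset_def Let_def)

text \<open>Restricting the biset of \<open>\<psi>\<close> along \<open>\<phi>\<close> on the right
  literally gives the biset of the composite functor.\<close>

lemma functor_biset_comp:
  assumes \<phi>: "ufunctor C D \<phi>" and \<psi>: "ufunctor D E \<psi>" and D: "finite_category D" and E: "finite_category E"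
  shows "biset_iso E C (comp_biset E D C (functor_biset E \<psi>) (functor_biset D \<phi>))
    (functor_biset E (\<lambda>x. \<psi> (\<phi> x)))"
  using comp_functor_biset_right[OF \<phi> D bset_functor_biset[OF \<psi> E]]
  by (simp add: functor_biset_def res_res_biset)

text \<open>Distinct maps of the universe may describe the same functor; what they do off
  \<open>C\<close> does not affect the biset up to isomorphism.\<close>

lemma functor_biset_cong:
  assumes \<phi>: "ufunctor C D \<phi>" and \<psi>: "ufunctor C D \<psi>" and D: "finite_category D"
    and Obj: "\<And>x. x \<in> Obj C \<Longrightarrow> \<phi> x = \<psi> x"
    and Mor: "\<And>x y f. \<lbrakk>x \<in> Obj C; y \<in> Obj C; f \<in> Mor C x y\<rbrakk> \<Longrightarrow> \<phi> f = \<psi> f"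
  shows "biset_iso D C (functor_biset D \<phi>) (functor_biset D \<psi>)"
proof (rule biset_isoI_inverse[OF bset_functor_biset[OF \<phi> D], where \<eta> = "\<lambda>x y u. u" and \<theta> = "\<lambda>x y u. u"])
  fix x y x' y' \<alpha> \<beta> u
  assume "y \<in> Obj C" "y' \<in> Obj C" "\<beta> \<in> Mor C y' y" "u \<in> el (functor_biset D \<phi>) x y"
  then show "bact (functor_biset D \<phi>) x y x' y' \<alpha> \<beta> u = bact (functor_biset D \<psi>) x y x' y' \<alpha> \<beta> u"
    using Mor[of y' y \<beta>] by (simp add: Obj)
qed (simp_all add: Obj)

lemma functor_biset_ident:
  assumes "finite_category C"
  shows "biset_iso C C (functor_biset C (\<lambda>x. x)) (id_biset C)"
  by (rule biset_isoI_inverse[where \<eta> = "\<lambda>x y u. u" and \<theta> = "\<lambda>x y u. u"])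
    (simp_all add: bset_functor_biset ufunctor_id finite_categoryD assms)

section \<open>Functors between product categories and the structure functors\<close>

definition map_pair :: "('a univ \<Rightarrow> 'a univ) \<Rightarrow> ('a univ \<Rightarrow> 'a univ) \<Rightarrow> 'a univ \<Rightarrow> 'a univ" where
  "map_pair \<phi> \<psi> p = UPair (\<phi> (ufst p)) (\<psi> (usnd p))"

lemma map_pair_simps [simp]: "map_pair \<phi> \<psi> (UPair x y) = UPair (\<phi> x) (\<psi> y)"
  by (simp add: map_pair_def)

lemma ufunctor_map_pair:
  assumes "ufunctor C D \<phi>" "ufunctor C' D' \<psi>"
  shows "ufunctor (prod_cat C C') (prod_cat D D') (map_pair \<phi> \<psi>)"
proof -
  interpret \<phi>: ufunctor C D \<phi> by fact
  interpret \<psi>: ufunctor C' D' \<psi> by fact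
  show ?thesis
    by (rule ufunctor.intro)
      (auto intro!: category_prod \<phi>.C.category_axioms \<phi>.D.category_axioms \<psi>.C.category_axioms
         \<psi>.D.category_axioms ufunctor_axioms.intro elim!: pairE)
qed

lemma prod_functor_biset:
  assumes \<phi>: "ufunctor C D \<phi>" and \<psi>: "ufunctor C' D' \<psi>" and D: "finite_category D" and D': "finite_category D'"
  shows "biset_iso (prod_cat D D') (prod_cat C C') (prod_biset (functor_biset D \<phi>) (functor_biset D' \<psi>))
    (functor_biset (prod_cat D D') (map_pair \<phi> \<psi>))"
  by (rule biset_isoI_inverse[OF bset_prod[OF bset_functor_biset[OF \<phi> D] bset_functor_biset[OF \<psi> D']],
        where \<eta> = "\<lambda>x y u. u" and \<theta> = "\<lambda>x y u. u"])
    (auto elim!: pairE)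

text \<open>If \<open>\<phi>'\<close> is invertible, both composites are isomorphic to \<open>(y', x) \<mapsto> \<Omega>\<^sub>2(y', \<phi> x)\<close>.\<close>

lemma functor_biset_square:
  assumes \<phi>': "uiso X' Y' \<phi>' \<psi>'" and \<phi>: "ufunctor X Y \<phi>"
    and X': "finite_category X'" and Y': "finite_category Y'" and Y: "finite_category Y"
    and \<Omega>1: "bset X' X \<Omega>1" and \<Omega>2: "bset Y' Y \<Omega>2" and iso: "biset_iso X' X \<Omega>1 (res_biset \<phi>' \<phi> \<Omega>2)"
  shows "biset_iso Y' X (comp_biset Y' X' X (functor_biset Y' \<phi>') \<Omega>1)
    (comp_biset Y' Y X \<Omega>2 (functor_biset Y \<phi>))"
proof -
  interpret uiso X' Y' \<phi>' \<psi>' by fact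
  interpret l: bcomp Y' X' X "functor_biset Y' \<phi>'" \<Omega>1
    by (rule bcompI[OF bset_functor_biset[OF ufunctor_axioms Y'] \<Omega>1 X'])
  interpret r: bcomp Y' Y X \<Omega>2 "functor_biset Y \<phi>"
    by (rule bcompI[OF \<Omega>2 bset_functor_biset[OF \<phi> Y] Y])
  have m: "bset Y' X (res_biset (\<lambda>x. x) \<phi> \<Omega>2)"
    by (rule bset_res[OF ufunctor_id \<phi> \<Omega>2]) (rule D.category_axioms)
  have "biset_iso Y' X (comp_biset Y' X' X (functor_biset Y' \<phi>') \<Omega>1) (res_biset (\<lambda>x. x) \<phi> \<Omega>2)"
    by (rule comp_functor_biset_left[OF \<phi>' X' Y' \<Omega>1 m]) (simp add: res_res_biset iso)
  then show ?thesis
    by (rule biset_iso_trans[OF l.bset_comp])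
      (rule biset_iso_sym[OF r.bset_comp m comp_functor_biset_right[OF \<phi> Y \<Omega>2]])
qed

lemma uisoI:
  assumes "ufunctor C D \<phi>" "ufunctor D C \<psi>"
    and "\<And>x. x \<in> Obj C \<Longrightarrow> \<psi> (\<phi> x) = x" "\<And>y. y \<in> Obj D \<Longrightarrow> \<phi> (\<psi> y) = y"
    and "\<And>x y f. \<lbrakk>x \<in> Obj C; y \<in> Obj C; f \<in> Mor C x y\<rbrakk> \<Longrightarrow> \<psi> (\<phi> f) = f"
    and "\<And>x y f. \<lbrakk>x \<in> Obj D; y \<in> Obj D; f \<in> Mor D x y\<rbrakk> \<Longrightarrow> \<phi> (\<psi> f) = f"
  shows "uiso C D \<phi> \<psi>"
  using assms by (simp add: uiso_def uiso_axioms_def)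

lemma uiso_ident: "category C \<Longrightarrow> uiso C C (\<lambda>x. x) (\<lambda>x. x)"
  by (simp add: uisoI ufunctor_id)

definition assoc :: "'a univ \<Rightarrow> 'a univ" where
  "assoc p = UPair (ufst (ufst p)) (UPair (usnd (ufst p)) (usnd p))"

definition coassoc :: "'a univ \<Rightarrow> 'a univ" where
  "coassoc p = UPair (UPair (ufst p) (ufst (usnd p))) (usnd (usnd p))"

definition swap :: "'a univ \<Rightarrow> 'a univ" where
  "swap p = UPair (usnd p) (ufst p)"

abbreviation pt :: "'a univ" where
  "pt \<equiv> USet {||}"

lemma structure_simps [simp]:
  "assoc (UPair (UPair x y) z) = UPair x (UPair y z)"
  "coassoc (UPair x (UPair y z)) = UPair (UPair x y) z"
  "swap (UPair x y) = UPair y x"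
  by (simp_all add: assoc_def coassoc_def swap_def)

lemma unit_cat_simps [simp]:
  "x \<in> Obj unit_cat \<longleftrightarrow> x = pt" "f \<in> Mor unit_cat x y \<longleftrightarrow> f = pt" "Ident unit_cat x = pt"
  "Comp unit_cat x y z g f = pt"
  by (simp_all add: unit_cat_def)

lemma finite_category_unit: "finite_category unit_cat"
  unfolding finite_category_def by (auto simp: category_def unit_cat_def)

lemma uiso_assoc:
  assumes "category C" "category D" "category E"
  shows "uiso (prod_cat (prod_cat C D) E) (prod_cat C (prod_cat D E)) assoc coassoc"
  by (rule uisoI)
    (auto simp: ufunctor_def ufunctor_axioms_def assms category_prod elim!: pairE)

lemma uiso_swap:
  assumes "category C" "category D"
  shows "uiso (prod_cat C D) (prod_cat D C) swap swap"
  by (rule uisoI) (auto simp: ufunctor_def ufunctor_axioms_def assms category_prod elim!: pairE)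

lemma uiso_lunit:
  assumes "category C"
  shows "uiso (prod_cat unit_cat C) C usnd (UPair pt)"
  by (rule uisoI)
    (auto simp: ufunctor_def ufunctor_axioms_def assms category_prod finite_category_unit
      finite_categoryD elim!: pairE)

lemma uiso_runit:
  assumes "category C"
  shows "uiso (prod_cat C unit_cat) C ufst (\<lambda>x. UPair x pt)"
  by (rule uisoI)
    (auto simp: ufunctor_def ufunctor_axioms_def assms category_prod finite_category_unit
      finite_categoryD elim!: pairE)

text \<open>Elements of product bisets are nested pairs, just as objects and morphisms are, so
  \<open>assoc\<close> itself serves as the isomorphism. The statement has the form required by
  \<open>functor_biset_square\<close>; so do the ones for the symmetry and the units.\<close>

lemma prod_biset_assoc:
  assumes \<Omega>: "bset C D \<Omega>" and \<Psi>: "bset C' D' \<Psi>" and \<Theta>: "bset C'' D'' \<Theta>"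
  shows "biset_iso (prod_cat (prod_cat C C') C'') (prod_cat (prod_cat D D') D'')
    (prod_biset (prod_biset \<Omega> \<Psi>) \<Theta>) (res_biset assoc assoc (prod_biset \<Omega> (prod_biset \<Psi> \<Theta>)))"
  by (rule biset_isoI_inverse[OF bset_prod[OF bset_prod[OF \<Omega> \<Psi>] \<Theta>],
        where \<eta> = "\<lambda>x y. assoc" and \<theta> = "\<lambda>x y. coassoc"])
    (auto elim!: pairE)

lemma prod_biset_swap:
  assumes \<Omega>: "bset C D \<Omega>" and \<Psi>: "bset C' D' \<Psi>"
  shows "biset_iso (prod_cat C C') (prod_cat D D') (prod_biset \<Omega> \<Psi>) (res_biset swap swap (prod_biset \<Psi> \<Omega>))"
  by (rule biset_isoI_inverse[OF bset_prod[OF \<Omega> \<Psi>], where \<eta> = "\<lambda>x y. swap" and \<theta> = "\<lambda>x y. swap"])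
    (auto elim!: pairE)

lemma prod_biset_lunit:
  assumes \<Omega>: "bset C D \<Omega>"
  shows "biset_iso (prod_cat unit_cat C) (prod_cat unit_cat D) (prod_biset (id_biset unit_cat) \<Omega>)
    (res_biset usnd usnd \<Omega>)"
  by (rule biset_isoI_inverse[OF bset_prod[OF bset_id[OF finite_category_unit] \<Omega>],
        where \<eta> = "\<lambda>x y. usnd" and \<theta> = "\<lambda>x y. UPair pt"])
    (auto elim!: pairE)

lemma prod_biset_runit:
  assumes \<Omega>: "bset C D \<Omega>"
  shows "biset_iso (prod_cat C unit_cat) (prod_cat D unit_cat) (prod_biset \<Omega> (id_biset unit_cat))
    (res_biset ufst ufst \<Omega>)"
  by (rule biset_isoI_inverse[OF bset_prod[OF \<Omega> bset_id[OF finite_category_unit]],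
        where \<eta> = "\<lambda>x y. ufst" and \<theta> = "\<lambda>x y u. UPair u pt"])
    (auto elim!: pairE)

section \<open>Disjoint unions of categories\<close>

definition untag :: "'a univ \<Rightarrow> 'a univ" where
  "untag p = (case p of UInl x \<Rightarrow> x | UInr x \<Rightarrow> x)"

text \<open>No morphism joins the two halves, so the tag of the source decides composition and the
  other arguments only have to be stripped of their tags.\<close>

definition sum_cat :: "'a ucat \<Rightarrow> 'a ucat \<Rightarrow> 'a ucat" where
  "sum_cat C D = \<lparr>
     Obj = UInl ` Obj C \<union> UInr ` Obj D,
     Mor = (\<lambda>p q. case (p, q) of (UInl x, UInl y) \<Rightarrow> UInl ` Mor C x y
        | (UInr x, UInr y) \<Rightarrow> UInr ` Mor D x y | _ \<Rightarrow> {}),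
     Ident = (\<lambda>p. case p of UInl x \<Rightarrow> UInl (Ident C x) | UInr x \<Rightarrow> UInr (Ident D x)),
     Comp = (\<lambda>p q r n m. case p of
          UInl x \<Rightarrow> UInl (Comp C x (untag q) (untag r) (untag n) (untag m))
        | UInr x \<Rightarrow> UInr (Comp D x (untag q) (untag r) (untag n) (untag m)))\<rparr>"

lemma sum_cat_simps [simp]:
  "Obj (sum_cat C D) = UInl ` Obj C \<union> UInr ` Obj D"
  "Mor (sum_cat C D) (UInl x) (UInl x') = UInl ` Mor C x x'"
  "Mor (sum_cat C D) (UInr y) (UInr y') = UInr ` Mor D y y'"
  "Mor (sum_cat C D) (UInl x) (UInr y) = {}" "Mor (sum_cat C D) (UInr y) (UInl x) = {}"
  "Ident (sum_cat C D) (UInl x) = UInl (Ident C x)" "Ident (sum_cat C D) (UInr y) = UInr (Ident D y)"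
  "Comp (sum_cat C D) (UInl x) (UInl x') (UInl x'') (UInl f') (UInl f) = UInl (Comp C x x' x'' f' f)"
  "Comp (sum_cat C D) (UInr y) (UInr y') (UInr y'') (UInr g') (UInr g) = UInr (Comp D y y' y'' g' g)"
  by (simp_all add: sum_cat_def untag_def)

lemma finite_category_sum:
  assumes "finite_category C" "finite_category D"
  shows "finite_category (sum_cat C D)"
proof -
  interpret C: category C using assms by (simp add: finite_category_def)
  interpret D: category D using assms by (simp add: finite_category_def)
  have "category (sum_cat C D)"
    by unfold_locales (auto simp: C.Comp_assoc D.Comp_assoc)
  then show ?thesis
    using assms by (auto simp: finite_category_def)
qed

text \<open>A fully faithful functor whose image on objects is a union of connected components. Full
  faithfulness makes projection after injection the identity; together with closedness it makes
  injection after projection a direct summand of the identity biset.\<close>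

locale component = ufunctor C S \<iota> for C S :: "'a ucat" and \<iota> +
  assumes full: "\<lbrakk>x \<in> Obj C; y \<in> Obj C\<rbrakk> \<Longrightarrow> bij_betw \<iota> (Mor C x y) (Mor S (\<iota> x) (\<iota> y))"
    and closed: "\<lbrakk>s \<in> Obj S; t \<in> Obj S; f \<in> Mor S s t\<rbrakk> \<Longrightarrow> s \<in> \<iota> ` Obj C \<longleftrightarrow> t \<in> \<iota> ` Obj C"

text \<open>The counterpart of \<open>functor_biset\<close> with hom-sets D(y, \<phi> x) in place of
  D(\<phi> x, y). For the inclusion of a summand it gives the projection of the biproduct.\<close>

definition cofunctor_biset :: "'a ucat \<Rightarrow> ('a univ \<Rightarrow> 'a univ) \<Rightarrow> 'a ubiset" where
  "cofunctor_biset D \<phi> = res_biset \<phi> (\<lambda>x. x) (id_biset D)"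

lemma cofunctor_biset_simps [simp]:
  "el (cofunctor_biset D \<phi>) x y = Mor D y (\<phi> x)"
  "f \<in> Mor D y (\<phi> x) \<Longrightarrow> bact (cofunctor_biset D \<phi>) x y x' y' \<alpha> \<beta> f =
     Comp D y' (\<phi> x) (\<phi> x') (\<phi> \<alpha>) (Comp D y' y (\<phi> x) f \<beta>)"
  by (simp_all add: cofunctor_biset_def)

lemma bset_cofunctor_biset:
  "ufunctor C D \<phi> \<Longrightarrow> finite_category D \<Longrightarrow> bset C D (cofunctor_biset D \<phi>)"
  unfolding cofunctor_biset_def
  by (rule bset_res[OF _ ufunctor_id bset_id]) (simp_all add: finite_categoryD)

text \<open>\<open>ufst p\<close> is the target of a morphism, so this is a summand of the identity
  biset when \<open>A\<close> is closed under morphisms. Where the value is empty, the constant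
  \<open>undefined\<close> is the only extensional function.\<close>

definition part_biset :: "'a ucat \<Rightarrow> 'a univ set \<Rightarrow> 'a ubiset" where
  "part_biset S A = \<lparr>
     FObj = (\<lambda>p. if ufst p \<in> A then FObj (id_biset S) p else {}),
     FMor = (\<lambda>p q m. if ufst p \<in> A then FMor (id_biset S) p q m else (\<lambda>_. undefined))\<rparr>"

lemma part_biset_simps [simp]:
  "el (part_biset S A) s t = (if s \<in> A then Mor S t s else {})"
  "\<lbrakk>s \<in> A; f \<in> Mor S t s\<rbrakk> \<Longrightarrow> bact (part_biset S A) s t s' t' \<alpha> \<beta> f = bact (id_biset S) s t s' t' \<alpha> \<beta> f"
  by (simp_all add: part_biset_def)

text \<open>The left action by \<open>\<alpha>\<close> moves the target along
  \<open>\<alpha>\<close>, so closure of \<open>A\<close> under morphisms keeps the action inside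
  the part.\<close>

lemma bset_part:
  assumes S: "finite_category S"
    and A: "\<And>s t f. \<lbrakk>s \<in> Obj S; t \<in> Obj S; f \<in> Mor S s t; s \<in> A\<rbrakk> \<Longrightarrow> t \<in> A"
  shows "bset S S (part_biset S A)"
proof -
  interpret id: bset S S "id_biset S" by (rule bset_id[OF S])
  show ?thesis
  proof (unfold_locales, rule bisetI)
    show "finite (el (part_biset S A) x y)" if "x \<in> Obj S" "y \<in> Obj S" for x y
      using that id.finite_el[of x y] by simp
  next
    fix s t s' t' \<alpha> \<beta> f
    assume "s \<in> Obj S" "t \<in> Obj S" "s' \<in> Obj S" "t' \<in> Obj S" "\<alpha> \<in> Mor S s s'" "\<beta> \<in> Mor S t' t"
      and "f \<notin> el (part_biset S A) s t"
    then show "bact (part_biset S A) s t s' t' \<alpha> \<beta> f = undefined"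
      using id.act_undefined[of s t s' t' \<alpha> \<beta> f] by (simp add: part_biset_def split: if_splits)
  next
    fix s t s' t' s'' t'' \<alpha> \<beta> \<alpha>' \<beta>' f
    assume "s \<in> Obj S" "t \<in> Obj S" "s' \<in> Obj S" "t' \<in> Obj S" "s'' \<in> Obj S" "t'' \<in> Obj S"
      "\<alpha> \<in> Mor S s s'" "\<beta> \<in> Mor S t' t" "\<alpha>' \<in> Mor S s' s''" "\<beta>' \<in> Mor S t'' t'"
      "f \<in> el (part_biset S A) s t"
    then show "bact (part_biset S A) s' t' s'' t'' \<alpha>' \<beta>' (bact (part_biset S A) s t s' t' \<alpha> \<beta> f) =
        bact (part_biset S A) s t s'' t'' (Comp S s s' s'' \<alpha>' \<alpha>) (Comp S t'' t' t \<beta> \<beta>') f"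
      using A[of s s' \<alpha>] by (simp add: id.C.Comp_assoc split: if_splits)
  qed (auto simp: id.C.category_axioms split: if_splits dest: A)
qed

context component
begin

text \<open>Restriction along \<open>\<iota>\<close> on the right identifies the composite with
  \<open>(x, y) \<mapsto> S(\<iota> y, \<iota> x)\<close>, and \<open>full\<close> identifies that
  with the hom-set of \<open>C\<close>.\<close>

lemma cofunctor_functor_biset:
  assumes C: "finite_category C" and S: "finite_category S"
  shows "biset_iso C C (id_biset C) (comp_biset C S C (cofunctor_biset S \<iota>) (functor_biset S \<iota>))"
proof -
  have b: "bset C S (cofunctor_biset S \<iota>)"
    by (rule bset_cofunctor_biset[OF ufunctor_axioms S])
  interpret c: bcomp C S C "cofunctor_biset S \<iota>" "functor_biset S \<iota>"
    by (rule bcompI[OF b bset_functor_biset[OF ufunctor_axioms S] S])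
  have r: "bset C C (res_biset (\<lambda>x. x) \<iota> (cofunctor_biset S \<iota>))"
    by (rule bset_res[OF ufunctor_id ufunctor_axioms b]) (rule C.category_axioms)
  have "biset_iso C C (id_biset C) (res_biset (\<lambda>x. x) \<iota> (cofunctor_biset S \<iota>))"
    by (rule biset_isoI[OF bset_id[OF C], where \<eta> = "\<lambda>x y. \<iota>"]) (simp_all add: full)
  then show ?thesis
    by (rule biset_iso_trans[OF bset_id[OF C]])
      (rule biset_iso_sym[OF c.bset_comp r comp_functor_biset_right[OF ufunctor_axioms S b]])
qed

text \<open>The isomorphism composes the two legs through \<open>\<iota> x\<close>. Closedness puts
  \<open>s\<close> itself in the image, say \<open>s = \<iota> y\<close>; by fullness the leg into
  \<open>s\<close> comes from \<open>C\<close> and slides across, leaving an identity and the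
  composite.\<close>

lemma functor_cofunctor_biset:
  assumes C: "finite_category C" and S: "finite_category S"
  shows "biset_iso S S (comp_biset S C S (functor_biset S \<iota>) (cofunctor_biset S \<iota>)) (part_biset S (\<iota> ` Obj C))"
proof -
  interpret c: bcomp S C S "functor_biset S \<iota>" "cofunctor_biset S \<iota>"
    by (rule bcompI[OF bset_functor_biset[OF ufunctor_axioms S] bset_cofunctor_biset[OF ufunctor_axioms S] C])
  have normal: "c.cls s t x f g = c.cls s t y (Ident S s) (Comp S t (\<iota> x) s f g)"
    if h: "s \<in> Obj S" "t \<in> Obj S" "x \<in> Obj C" "y \<in> Obj C" "s = \<iota> y" "f \<in> Mor S (\<iota> x) s" "g \<in> Mor S t (\<iota> x)"
    for s t x y f g
  proof -
    obtain f' where "f' \<in> Mor C x y" "f = \<iota> f'"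
      using h bij_betw_imp_surj_on[OF full[of x y]] by blast
    then show ?thesis
      using h c.cls_bal[of y x f' "Ident S s" s g t] by simp
  qed
  show ?thesis
  proof (rule c.comp_isoI[where \<psi> = "\<lambda>s t x f g. Comp S t (\<iota> x) s f g"])
    fix s x t f g
    assume "s \<in> Obj S" "x \<in> Obj C" "t \<in> Obj S" "f \<in> el (functor_biset S \<iota>) s x" "g \<in> el (cofunctor_biset S \<iota>) x t"
    then show "Comp S t (\<iota> x) s f g \<in> el (part_biset S (\<iota> ` Obj C)) s t"
      using closed[of "\<iota> x" s f] by auto
  next
    fix s x t s' t' \<alpha> \<gamma> f g
    assume "s \<in> Obj S" "x \<in> Obj C" "t \<in> Obj S" "s' \<in> Obj S" "t' \<in> Obj S" "\<alpha> \<in> Mor S s s'" "\<gamma> \<in> Mor S t' t"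
      "f \<in> el (functor_biset S \<iota>) s x" "g \<in> el (cofunctor_biset S \<iota>) x t"
    then show "Comp S t' (\<iota> x) s' (bact (functor_biset S \<iota>) s x s' x \<alpha> (Ident C x) f)
          (bact (cofunctor_biset S \<iota>) x t x t' (Ident C x) \<gamma> g) =
        bact (part_biset S (\<iota> ` Obj C)) s t s' t' \<alpha> \<gamma> (Comp S t (\<iota> x) s f g)"
      using closed[of "\<iota> x" s f] by (auto simp: D.Comp_assoc)
  next
    fix s t w
    assume *: "s \<in> Obj S" "t \<in> Obj S" and w: "w \<in> el (part_biset S (\<iota> ` Obj C)) s t"
    then obtain x where "x \<in> Obj C" "s = \<iota> x" "w \<in> Mor S t s"
      by (auto split: if_splits)
    with * show "\<exists>x\<in>Obj C. \<exists>f\<in>el (functor_biset S \<iota>) s x. \<exists>g\<in>el (cofunctor_biset S \<iota>) x t.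
        w = Comp S t (\<iota> x) s f g"
      by (intro bexI[of _ x] bexI[of _ "Ident S s"] bexI[of _ w]) simp_all
  next
    fix s x x' t f g f' g'
    assume *: "s \<in> Obj S" "x \<in> Obj C" "x' \<in> Obj C" "t \<in> Obj S" "f \<in> el (functor_biset S \<iota>) s x"
      "g \<in> el (cofunctor_biset S \<iota>) x t" "f' \<in> el (functor_biset S \<iota>) s x'" "g' \<in> el (cofunctor_biset S \<iota>) x' t"
      "Comp S t (\<iota> x) s f g = Comp S t (\<iota> x') s f' g'"
    obtain y where "y \<in> Obj C" "s = \<iota> y"
      using * closed[of "\<iota> x" s f] by auto
    then show "c.cls s t x f g = c.cls s t x' f' g'"
      using * normal[of s t x y f g] normal[of s t x' y f' g'] by simp
  qed (simp_all add: D.Comp_assoc)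
qed

end

lemma component_sum_cat:
  assumes "category C" "category D" "category (sum_cat C D)"
  shows "component C (sum_cat C D) UInl" "component D (sum_cat C D) UInr"
  using assms
  by (auto simp: component_def component_axioms_def ufunctor_def ufunctor_axioms_def bij_betw_def inj_on_def)

text \<open>Every morphism lies in exactly one part, the one containing its target, so forgetting
  the tags is bijective; the action preserves the tag by \<open>closed\<close>.\<close>

lemma sum_part_biset:
  assumes S: "finite_category S" and A: "bset S S (part_biset S A)" and B: "bset S S (part_biset S B)"
    and AB: "Obj S = A \<union> B" "A \<inter> B = {}"
    and closed: "\<And>s t f. \<lbrakk>s \<in> Obj S; t \<in> Obj S; f \<in> Mor S s t\<rbrakk> \<Longrightarrow> s \<in> A \<longleftrightarrow> t \<in> A"
  shows "biset_iso S S (sum_biset (part_biset S A) (part_biset S B)) (id_biset S)"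
proof -
  interpret bset S S "part_biset S A" by fact
  have B': "s \<in> B \<longleftrightarrow> s \<notin> A" if "s \<in> Obj S" for s
    using that AB by auto
  show ?thesis
  proof (rule biset_isoI_inverse[OF bset_sum[OF A B], where \<eta> = "\<lambda>s t. untag" and
        \<theta> = "\<lambda>s t f. if s \<in> A then UInl f else UInr f"])
    fix s t s' t' \<alpha> \<beta> u
    assume *: "s \<in> Obj S" "t \<in> Obj S" "s' \<in> Obj S" "t' \<in> Obj S" "\<alpha> \<in> Mor S s s'" "\<beta> \<in> Mor S t' t"
    assume "u \<in> el (sum_biset (part_biset S A) (part_biset S B)) s t"
    with * show "untag (bact (sum_biset (part_biset S A) (part_biset S B)) s t s' t' \<alpha> \<beta> u) =
        bact (id_biset S) s t s' t' \<alpha> \<beta> (untag u)"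
      by (auto simp: B' untag_def split: if_splits)
  qed (auto simp: B' untag_def split: if_splits)
qed

definition empty_cat :: "'a ucat" where
  "empty_cat = \<lparr>Obj = {}, Mor = (\<lambda>_ _. {}), Ident = (\<lambda>_. undefined), Comp = (\<lambda>_ _ _ _ _. undefined)\<rparr>"

lemma finite_category_empty: "finite_category empty_cat"
  by (simp add: finite_category_def category_def empty_cat_def)

text \<open>This makes the class of an empty biset equal to its own double, hence zero in the module
  of bisets.\<close>

lemma biset_iso_empty:
  assumes "bset C D \<Omega>" "\<And>x y. \<lbrakk>x \<in> Obj C; y \<in> Obj D\<rbrakk> \<Longrightarrow> el \<Omega> x y = {}"
  shows "biset_iso C D \<Omega> (sum_biset \<Omega> \<Omega>)"
  using assms by (intro biset_isoI) (auto simp: bij_betw_def)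

section \<open>Modules of bisets\<close>

lemma linear_map_add:
  assumes "module R N" and f: "linear_map R M N f" and g: "linear_map R M N g"
  shows "linear_map R M N (\<lambda>x. f x \<oplus>\<^bsub>N\<^esub> g x)"
proof -
  interpret N: module R N by fact
  show ?thesis
    using f g by (simp add: linear_map_def N.smult_r_distr N.add.m_ac)
qed

lemma linear_map_smult:
  assumes "module R N" and f: "linear_map R M N f" and r: "r \<in> carrier R"
  shows "linear_map R M N (\<lambda>x. r \<odot>\<^bsub>N\<^esub> f x)"
proof -
  interpret N: module R N by fact
  \<comment> \<open>Commutativity of \<open>R\<close> enters here: multiplication by
    \<open>r\<close> has to commute with the action of every scalar \<open>s\<close>.\<close>
  have "r \<odot>\<^bsub>N\<^esub> (s \<odot>\<^bsub>N\<^esub> y) = s \<odot>\<^bsub>N\<^esub> (r \<odot>\<^bsub>N\<^esub> y)" if "s \<in> carrier R" "y \<in> carrier N" for s y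
    using that r N.smult_assoc1[of r s y] N.smult_assoc1[of s r y] by (simp add: N.m_comm)
  then show ?thesis
    using f r by (simp add: linear_map_def N.smult_r_distr)
qed

lemma bset_iff: "bset C D \<Omega> \<longleftrightarrow> category C \<and> category D \<and> biset C D \<Omega>"
  by (auto simp: bset_def bset_axioms_def)

section \<open>The modules of bisets and their universal property\<close>

locale biset_module = R?: cring R + C: category C + D: category D
  for R :: "('r, 'k) ring_scheme" (structure) and C D :: "'a ucat"
begin

definition sum_rels :: "('a ubiset set \<times> 'a ubiset set \<times> 'a ubiset set) set" where
  "sum_rels = {(iso_class C D (sum_biset \<Omega> \<Psi>), iso_class C D \<Omega>, iso_class C D \<Psi>) | \<Omega> \<Psi>.
     biset C D \<Omega> \<and> biset C D \<Psi>}"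

lemma biset_relators_eq: "biset_relators C D = additive_relators sum_rels"
  by (force simp: biset_relators_def additive_relators_def sum_rels_def)

lemma bset_iff_biset: "bset C D \<Omega> \<longleftrightarrow> biset C D \<Omega>"
  by (simp add: bset_iff C.category_axioms D.category_axioms)

sublocale G: additive_presentation "iso_classes C D" sum_rels
  using bset_sum[of C D] by unfold_locales (auto simp: sum_rels_def iso_classes_def bset_iff_biset)

lemma grothendieck_eq: "grothendieck C D = G.P"
  by (simp add: grothendieck_def biset_relators_eq)

sublocale scalar_extension R "grothendieck C D"
  unfolding grothendieck_eq by unfold_locales

abbreviation "belt \<equiv> biset_elt R C D"

lemma belt_eq: "belt \<Omega> = pure \<one> (G.gen (iso_class C D \<Omega>))"
  by (simp add: biset_elt_def biset_relators_eq)

lemma module_A_mod: "module R (A_mod R C D)"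
  unfolding A_mod_def by (rule module_T)

lemma gen_iso_class_in: "bset C D \<Omega> \<Longrightarrow> G.gen (iso_class C D \<Omega>) \<in> carrier (grothendieck C D)"
  unfolding grothendieck_eq by (rule G.gen_in) (auto simp: iso_classes_def bset_iff_biset)

lemma belt_in: "bset C D \<Omega> \<Longrightarrow> belt \<Omega> \<in> carrier (A_mod R C D)"
  by (simp add: belt_eq A_mod_def pure_in gen_iso_class_in)

lemma belt_cong: "\<lbrakk>bset C D \<Omega>; bset C D \<Psi>; biset_iso C D \<Omega> \<Psi>\<rbrakk> \<Longrightarrow> belt \<Omega> = belt \<Psi>"
  by (simp add: belt_eq iso_class_eq)

lemma belt_sum:
  assumes "bset C D \<Omega>" "bset C D \<Psi>"
  shows "belt (sum_biset \<Omega> \<Psi>) = belt \<Omega> \<oplus>\<^bsub>A_mod R C D\<^esub> belt \<Psi>"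
proof -
  have "G.gen (iso_class C D (sum_biset \<Omega> \<Psi>)) =
      G.gen (iso_class C D \<Omega>) \<otimes>\<^bsub>grothendieck C D\<^esub> G.gen (iso_class C D \<Psi>)"
    unfolding grothendieck_eq
    by (rule G.gen_relation) (use assms in \<open>auto simp: sum_rels_def bset_iff_biset\<close>)
  then show ?thesis
    using hom_mult[OF pure_hom[OF one_closed]] assms
    by (simp add: belt_eq A_mod_def gen_iso_class_in)
qed

text \<open>Linearity reduces the claim to the elements \<open>pure \<one> x\<close>. These are
  additive in \<open>x\<close>, and the Grothendieck group is generated by the classes of
  bisets.\<close>

lemma A_mod_linear_ext:
  assumes M: "module R M" and f: "linear_map R (A_mod R C D) M f" and g: "linear_map R (A_mod R C D) M g"
    and eq: "\<And>\<Omega>. bset C D \<Omega> \<Longrightarrow> f (belt \<Omega>) = g (belt \<Omega>)" and a: "a \<in> carrier (A_mod R C D)"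
  shows "f a = g a"
proof (rule T_linear_ext[OF M f[unfolded A_mod_def] g[unfolded A_mod_def] _ a[unfolded A_mod_def]])
  interpret M: module R M by fact
  note ph = pure_hom[OF one_closed]
  fix x assume x: "x \<in> carrier (grothendieck C D)"
  show "f (pure \<one> x) = g (pure \<one> x)"
  proof (rule G.P_hom_ext[of "add_monoid M"])
    show "(\<lambda>x. f (pure \<one> x)) \<in> hom G.P (add_monoid M)" "(\<lambda>x. g (pure \<one> x)) \<in> hom G.P (add_monoid M)"
      using hom_compose[OF ph linear_map_hom[OF f[unfolded A_mod_def]]]
        hom_compose[OF ph linear_map_hom[OF g[unfolded A_mod_def]]]
      by (simp_all add: comp_def grothendieck_eq)
    fix K assume "K \<in> iso_classes C D"
    then obtain \<Omega> where "K = iso_class C D \<Omega>" "bset C D \<Omega>"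
      by (auto simp: iso_classes_def bset_iff_biset)
    then show "f (pure \<one> (G.gen K)) = g (pure \<one> (G.gen K))"
      using eq[of \<Omega>] by (simp add: belt_eq)
  qed (use x in \<open>simp_all add: grothendieck_eq M.add.group_axioms\<close>)
qed

text \<open>Two universal properties in succession: an additive invariant extends to the
  Grothendieck group, and from there linearly to the extension of scalars.\<close>

lemma A_mod_universal:
  assumes M: "module R M" and closed: "\<And>\<Omega>. bset C D \<Omega> \<Longrightarrow> f \<Omega> \<in> carrier M"
    and cong: "\<And>\<Omega> \<Psi>. \<lbrakk>bset C D \<Omega>; bset C D \<Psi>; biset_iso C D \<Omega> \<Psi>\<rbrakk> \<Longrightarrow> f \<Omega> = f \<Psi>"
    and sum: "\<And>\<Omega> \<Psi>. \<lbrakk>bset C D \<Omega>; bset C D \<Psi>\<rbrakk> \<Longrightarrow> f (sum_biset \<Omega> \<Psi>) = f \<Omega> \<oplus>\<^bsub>M\<^esub> f \<Psi>"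
  obtains h where "linear_map R (A_mod R C D) M h" "\<And>\<Omega>. bset C D \<Omega> \<Longrightarrow> h (belt \<Omega>) = f \<Omega>"
proof -
  interpret M: module R M by fact
  \<comment> \<open>The generators are isomorphism classes; invariance of \<open>f\<close> makes the
    choice of a representative immaterial.\<close>
  define f' where "f' K = f (SOME \<Omega>. \<Omega> \<in> K)" for K
  have f': "f' (iso_class C D \<Omega>) = f \<Omega>" if "bset C D \<Omega>" for \<Omega>
  proof -
    have "\<Omega> \<in> iso_class C D \<Omega>"
      using that biset_iso_refl[OF that] by (simp add: iso_class_def bset_iff_biset)
    then have "(SOME \<Psi>. \<Psi> \<in> iso_class C D \<Omega>) \<in> iso_class C D \<Omega>"
      by (rule someI)
    then show ?thesis
      using that cong[OF that, of "SOME \<Psi>. \<Psi> \<in> iso_class C D \<Omega>"]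
      by (simp add: f'_def iso_class_def bset_iff_biset)
  qed
  have sum': "bset C D (sum_biset \<Omega> \<Psi>)" if "biset C D \<Omega>" "biset C D \<Psi>" for \<Omega> \<Psi>
    using that bset_sum[of C D \<Omega> \<Psi>] by (simp add: bset_iff_biset)
  obtain h0 where h0: "h0 \<in> hom G.P (add_monoid M)"
    and h0_gen: "\<And>K. K \<in> iso_classes C D \<Longrightarrow> h0 (G.gen K) = f' K"
  proof (rule G.P_universal[of "add_monoid M" f'])
    show "comm_group (add_monoid M)"
      by (rule M.a_comm_group)
  qed (use closed sum sum' in \<open>auto simp: sum_rels_def iso_classes_def f' simp flip: bset_iff_biset\<close>)
  obtain h where h: "linear_map R (tensor_Z R (grothendieck C D)) M h"
    and h_pure: "\<And>x. x \<in> carrier (grothendieck C D) \<Longrightarrow> h (pure \<one> x) = h0 x"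
    using T_universal[OF M h0[folded grothendieck_eq]] by blast
  show thesis
  proof (rule that)
    show "linear_map R (A_mod R C D) M h"
      using h by (simp add: A_mod_def)
    show "h (belt \<Omega>) = f \<Omega>" if "bset C D \<Omega>" for \<Omega>
    proof -
      have "iso_class C D \<Omega> \<in> iso_classes C D"
        using that by (auto simp: iso_classes_def bset_iff_biset)
      then show ?thesis
        using that by (simp add: belt_eq h_pure gen_iso_class_in h0_gen f')
    qed
  qed
qed

end

text \<open>Currying. For a fixed biset \<open>\<Omega>\<close> the second argument is extended
  linearly to \<open>g \<Omega>\<close>. For a fixed \<open>b\<close> the function
  \<open>\<Omega> \<mapsto> g \<Omega> b\<close> is again an additive invariant, and its extension
  is \<open>k b\<close>. This exhibits a map of the kind that the definition selects by
  \<open>SOME\<close>.\<close>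

lemma bilinear_extension:
  assumes R: "cring R"
    and cat: "category C1" "category D1" "category C2" "category D2" "category C3" "category D3"
    and closed: "\<And>\<Omega> \<Psi>. \<lbrakk>bset C1 D1 \<Omega>; bset C2 D2 \<Psi>\<rbrakk> \<Longrightarrow> bset C3 D3 (h \<Omega> \<Psi>)"
    and cong: "\<And>\<Omega> \<Omega>' \<Psi> \<Psi>'. \<lbrakk>bset C1 D1 \<Omega>; bset C1 D1 \<Omega>'; bset C2 D2 \<Psi>; bset C2 D2 \<Psi>';
        biset_iso C1 D1 \<Omega> \<Omega>'; biset_iso C2 D2 \<Psi> \<Psi>'\<rbrakk> \<Longrightarrow> biset_iso C3 D3 (h \<Omega> \<Psi>) (h \<Omega>' \<Psi>')"
    and sum_left: "\<And>\<Omega> \<Omega>' \<Psi>. \<lbrakk>bset C1 D1 \<Omega>; bset C1 D1 \<Omega>'; bset C2 D2 \<Psi>\<rbrakk>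
        \<Longrightarrow> biset_iso C3 D3 (h (sum_biset \<Omega> \<Omega>') \<Psi>) (sum_biset (h \<Omega> \<Psi>) (h \<Omega>' \<Psi>))"
    and sum_right: "\<And>\<Omega> \<Psi> \<Psi>'. \<lbrakk>bset C1 D1 \<Omega>; bset C2 D2 \<Psi>; bset C2 D2 \<Psi>'\<rbrakk>
        \<Longrightarrow> biset_iso C3 D3 (h \<Omega> (sum_biset \<Psi> \<Psi>')) (sum_biset (h \<Omega> \<Psi>) (h \<Omega> \<Psi>'))"
  defines "f \<equiv> bilinear_extension R C1 D1 C2 D2 C3 D3 h"
  shows "bilinear_map R (A_mod R C1 D1) (A_mod R C2 D2) (A_mod R C3 D3) f"
    and "\<And>\<Omega> \<Psi>. \<lbrakk>bset C1 D1 \<Omega>; bset C2 D2 \<Psi>\<rbrakk> \<Longrightarrow>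
      f (biset_elt R C1 D1 \<Omega>) (biset_elt R C2 D2 \<Psi>) = biset_elt R C3 D3 (h \<Omega> \<Psi>)"
proof -
  interpret M1: biset_module R C1 D1 by (simp add: biset_module_def R cat)
  interpret M2: biset_module R C2 D2 by (simp add: biset_module_def R cat)
  interpret M3: biset_module R C3 D3 by (simp add: biset_module_def R cat)
  let ?M1 = "A_mod R C1 D1" and ?M2 = "A_mod R C2 D2" and ?M3 = "A_mod R C3 D3"
  interpret N: module R ?M3 by (rule M3.module_A_mod)
  note refl1 = biset_iso_refl[of C1 D1] and refl2 = biset_iso_refl[of C2 D2]
  have "\<exists>g. linear_map R ?M2 ?M3 g \<and> (\<forall>\<Psi>. bset C2 D2 \<Psi> \<longrightarrow> g (M2.belt \<Psi>) = M3.belt (h \<Omega> \<Psi>))"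
    if \<Omega>: "bset C1 D1 \<Omega>" for \<Omega>
  proof (rule M2.A_mod_universal[OF M3.module_A_mod, of "\<lambda>\<Psi>. M3.belt (h \<Omega> \<Psi>)"])
    fix \<Psi> assume "bset C2 D2 \<Psi>"
    then show "M3.belt (h \<Omega> \<Psi>) \<in> carrier ?M3"
      using \<Omega> by (intro M3.belt_in closed)
    fix \<Psi>' assume "bset C2 D2 \<Psi>'"
    then show "M3.belt (h \<Omega> (sum_biset \<Psi> \<Psi>')) = M3.belt (h \<Omega> \<Psi>) \<oplus>\<^bsub>?M3\<^esub> M3.belt (h \<Omega> \<Psi>')"
      using \<Omega> \<open>bset C2 D2 \<Psi>\<close> M3.belt_cong[OF _ _ sum_right[of \<Omega> \<Psi> \<Psi>']] M3.belt_sum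
      by (simp add: closed bset_sum)
    assume "biset_iso C2 D2 \<Psi> \<Psi>'"
    then show "M3.belt (h \<Omega> \<Psi>) = M3.belt (h \<Omega> \<Psi>')"
      using \<Omega> \<open>bset C2 D2 \<Psi>\<close> \<open>bset C2 D2 \<Psi>'\<close> by (intro M3.belt_cong closed cong refl1)
  qed blast
  then obtain g where g: "\<And>\<Omega>. bset C1 D1 \<Omega> \<Longrightarrow> linear_map R ?M2 ?M3 (g \<Omega>)"
    and g_belt: "\<And>\<Omega> \<Psi>. \<lbrakk>bset C1 D1 \<Omega>; bset C2 D2 \<Psi>\<rbrakk> \<Longrightarrow> g \<Omega> (M2.belt \<Psi>) = M3.belt (h \<Omega> \<Psi>)"
    by metis
  have "\<exists>k. linear_map R ?M1 ?M3 k \<and> (\<forall>\<Omega>. bset C1 D1 \<Omega> \<longrightarrow> k (M1.belt \<Omega>) = g \<Omega> b)"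
    if b: "b \<in> carrier ?M2" for b
  proof (rule M1.A_mod_universal[OF M3.module_A_mod, of "\<lambda>\<Omega>. g \<Omega> b"])
    fix \<Omega> assume \<Omega>: "bset C1 D1 \<Omega>"
    show "g \<Omega> b \<in> carrier ?M3"
      by (rule linear_map_closed[OF g[OF \<Omega>] b])
    fix \<Omega>' assume \<Omega>': "bset C1 D1 \<Omega>'"
    \<comment> \<open>Both sides are linear in \<open>b\<close>, so \<open>b\<close> may be taken to
      be the class of a biset, where \<open>sum_left\<close> applies.\<close>
    show "g (sum_biset \<Omega> \<Omega>') b = g \<Omega> b \<oplus>\<^bsub>?M3\<^esub> g \<Omega>' b"
    proof (rule M2.A_mod_linear_ext[OF M3.module_A_mod _ _ _ b])
      show "linear_map R ?M2 ?M3 (g (sum_biset \<Omega> \<Omega>'))"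
        using \<Omega> \<Omega>' by (intro g bset_sum)
      show "linear_map R ?M2 ?M3 (\<lambda>b. g \<Omega> b \<oplus>\<^bsub>?M3\<^esub> g \<Omega>' b)"
        by (rule linear_map_add[OF M3.module_A_mod g[OF \<Omega>] g[OF \<Omega>']])
      fix \<Psi> assume "bset C2 D2 \<Psi>"
      then show "g (sum_biset \<Omega> \<Omega>') (M2.belt \<Psi>) = g \<Omega> (M2.belt \<Psi>) \<oplus>\<^bsub>?M3\<^esub> g \<Omega>' (M2.belt \<Psi>)"
        using \<Omega> \<Omega>' M3.belt_cong[OF _ _ sum_left[of \<Omega> \<Omega>' \<Psi>]] M3.belt_sum
        by (simp add: closed bset_sum g_belt)
    qed
    assume iso: "biset_iso C1 D1 \<Omega> \<Omega>'"
    show "g \<Omega> b = g \<Omega>' b"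
    proof (rule M2.A_mod_linear_ext[OF M3.module_A_mod g[OF \<Omega>] g[OF \<Omega>'] _ b])
      fix \<Psi> assume \<Psi>: "bset C2 D2 \<Psi>"
      show "g \<Omega> (M2.belt \<Psi>) = g \<Omega>' (M2.belt \<Psi>)"
        using \<Omega> \<Omega>' \<Psi> M3.belt_cong[OF _ _ cong[OF \<Omega> \<Omega>' \<Psi> \<Psi> iso refl2[OF \<Psi>]]]
        by (simp add: closed g_belt)
    qed
  qed blast
  then obtain k where k: "\<And>b. b \<in> carrier ?M2 \<Longrightarrow> linear_map R ?M1 ?M3 (k b)"
    and k_belt: "\<And>b \<Omega>. \<lbrakk>b \<in> carrier ?M2; bset C1 D1 \<Omega>\<rbrakk> \<Longrightarrow> k b (M1.belt \<Omega>) = g \<Omega> b"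
    by metis
  interpret N2: module R ?M2 by (rule M2.module_A_mod)
  \<comment> \<open>Linearity in the first argument holds by construction. In the second it is
    compared on bisets \<open>\<Omega>\<close>, where \<open>k b\<close> takes the value
    \<open>g \<Omega> b\<close>, which is linear in \<open>b\<close>.\<close>
  have k_add: "k (b \<oplus>\<^bsub>?M2\<^esub> b') a = k b a \<oplus>\<^bsub>?M3\<^esub> k b' a"
    if b: "b \<in> carrier ?M2" "b' \<in> carrier ?M2" and a: "a \<in> carrier ?M1" for a b b'
  proof (rule M1.A_mod_linear_ext[OF M3.module_A_mod _ _ _ a])
    show "linear_map R ?M1 ?M3 (k (b \<oplus>\<^bsub>?M2\<^esub> b'))"
      using b by (intro k N2.a_closed)
    show "linear_map R ?M1 ?M3 (\<lambda>a. k b a \<oplus>\<^bsub>?M3\<^esub> k b' a)"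
      by (rule linear_map_add[OF M3.module_A_mod k[OF b(1)] k[OF b(2)]])
  qed (use b g in \<open>simp add: k_belt linear_map_def\<close>)
  have k_smult: "k (r \<odot>\<^bsub>?M2\<^esub> b) a = r \<odot>\<^bsub>?M3\<^esub> k b a"
    if r: "r \<in> carrier R" and b: "b \<in> carrier ?M2" and a: "a \<in> carrier ?M1" for r a b
  proof (rule M1.A_mod_linear_ext[OF M3.module_A_mod _ _ _ a])
    show "linear_map R ?M1 ?M3 (k (r \<odot>\<^bsub>?M2\<^esub> b))"
      using r b by (intro k N2.smult_closed)
    show "linear_map R ?M1 ?M3 (\<lambda>a. r \<odot>\<^bsub>?M3\<^esub> k b a)"
      by (rule linear_map_smult[OF M3.module_A_mod k[OF b] r])
  qed (use r b g in \<open>simp add: k_belt linear_map_def\<close>)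
  let ?P = "\<lambda>f. bilinear_map R ?M1 ?M2 ?M3 f \<and> (\<forall>\<Omega> \<Psi>. biset C1 D1 \<Omega> \<longrightarrow> biset C2 D2 \<Psi> \<longrightarrow>
       f (M1.belt \<Omega>) (M2.belt \<Psi>) = M3.belt (h \<Omega> \<Psi>))"
  have "?P (\<lambda>a b. k b a)"
    using k k_add k_smult
    by (auto simp: bilinear_map_def linear_map_def k_belt g_belt M2.belt_in
      simp flip: M1.bset_iff_biset M2.bset_iff_biset)
  then have f: "?P f"
    unfolding f_def bilinear_extension_def by (rule someI[of ?P])
  show "bilinear_map R ?M1 ?M2 ?M3 f"
    using f by blast
  show "f (M1.belt \<Omega>) (M2.belt \<Psi>) = M3.belt (h \<Omega> \<Psi>)" if "bset C1 D1 \<Omega>" "bset C2 D2 \<Psi>" for \<Omega> \<Psi>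
    using f that by (simp add: M1.bset_iff_biset M2.bset_iff_biset)
qed

section \<open>The biset category\<close>

locale biset_cat = R?: cring R for R :: "('r, 'k) ring_scheme" (structure)
begin

abbreviation "B \<equiv> biset_category R"
abbreviation "elt \<equiv> biset_elt R"

lemma B_simps [simp]:
  "X \<in> Obj B \<longleftrightarrow> finite_category X" "Mor B X Y = carrier (A_mod R Y X)" "HomMod B X Y = A_mod R Y X"
  "Ident B X = elt X X (id_biset X)"
  by (simp_all add: biset_category_def)

lemma biset_module: "\<lbrakk>finite_category X; finite_category Y\<rbrakk> \<Longrightarrow> biset_module R X Y"
  by (simp add: biset_module_def finite_categoryD R.cring_axioms)

lemmas module_A = biset_module.module_A_mod[OF biset_module]
lemmas elt_in = biset_module.belt_in[OF biset_module]
lemmas elt_cong = biset_module.belt_cong[OF biset_module]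
lemmas elt_sum = biset_module.belt_sum[OF biset_module]

text \<open>The linearity premises precede \<open>module R M\<close> because under
  \<open>rule\<close> the module \<open>M\<close> is unknown until the first of them has been
  solved.\<close>

lemma A_ext:
  assumes "linear_map R (A_mod R C D) M f" "linear_map R (A_mod R C D) M g"
    and "\<And>\<Omega>. bset C D \<Omega> \<Longrightarrow> f (elt C D \<Omega>) = g (elt C D \<Omega>)"
    and "a \<in> carrier (A_mod R C D)" "module R M" "finite_category C" "finite_category D"
  shows "f a = g a"
  by (rule biset_module.A_mod_linear_ext[OF biset_module[OF assms(6,7)] assms(5,1-4)])

lemma bset_comp_biset:
  "\<lbrakk>finite_category D; bset C D \<Omega>; bset D E \<Psi>\<rbrakk> \<Longrightarrow> bset C E (comp_biset C D E \<Omega> \<Psi>)"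
  by (rule bcomp.bset_comp[OF bcompI])

lemma Comp_B:
  assumes "finite_category X" "finite_category Y" "finite_category Z"
  shows Comp_bilinear: "bilinear_map R (A_mod R Z Y) (A_mod R Y X) (A_mod R Z X) (Comp B X Y Z)"
    and Comp_elt: "\<And>\<Omega> \<Psi>. \<lbrakk>bset Z Y \<Omega>; bset Y X \<Psi>\<rbrakk>
      \<Longrightarrow> Comp B X Y Z (elt Z Y \<Omega>) (elt Y X \<Psi>) = elt Z X (comp_biset Z Y X \<Omega> \<Psi>)"
proof -
  have eq: "Comp B X Y Z = bilinear_extension R Z Y Y X Z X (comp_biset Z Y X)"
    by (simp add: biset_category_def)
  note * = bilinear_extension[OF R.cring_axioms, of Z Y Y X Z X "comp_biset Z Y X", folded eq]
  note c = finite_categoryD(1)[OF assms(1)] finite_categoryD(1)[OF assms(2)] finite_categoryD(1)[OF assms(3)]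
  show "bilinear_map R (A_mod R Z Y) (A_mod R Y X) (A_mod R Z X) (Comp B X Y Z)"
    by (rule *(1)) (auto intro: c bset_comp_biset comp_biset_cong comp_biset_sum_left comp_biset_sum_right assms)
  show "Comp B X Y Z (elt Z Y \<Omega>) (elt Y X \<Psi>) = elt Z X (comp_biset Z Y X \<Omega> \<Psi>)"
    if "bset Z Y \<Omega>" "bset Y X \<Psi>" for \<Omega> \<Psi>
    by (rule *(2)) (auto intro: that c bset_comp_biset comp_biset_cong comp_biset_sum_left comp_biset_sum_right assms)
qed

lemma tensor_mor_B:
  assumes "finite_category X" "finite_category X'" "finite_category Y" "finite_category Y'"
  shows tm_bilinear: "bilinear_map R (A_mod R X' X) (A_mod R Y' Y)
      (A_mod R (prod_cat X' Y') (prod_cat X Y)) (tensor_mor R X X' Y Y')"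
    and tm_elt: "\<And>\<Omega> \<Psi>. \<lbrakk>bset X' X \<Omega>; bset Y' Y \<Psi>\<rbrakk> \<Longrightarrow>
      tensor_mor R X X' Y Y' (elt X' X \<Omega>) (elt Y' Y \<Psi>) = elt (prod_cat X' Y') (prod_cat X Y) (prod_biset \<Omega> \<Psi>)"
proof -
  note * = bilinear_extension[OF R.cring_axioms, of X' X Y' Y "prod_cat X' Y'" "prod_cat X Y" prod_biset,
      folded tensor_mor_def]
  note c = finite_categoryD(1)[OF assms(1)] finite_categoryD(1)[OF assms(2)] finite_categoryD(1)[OF assms(3)]
    finite_categoryD(1)[OF assms(4)]
  show "bilinear_map R (A_mod R X' X) (A_mod R Y' Y)
      (A_mod R (prod_cat X' Y') (prod_cat X Y)) (tensor_mor R X X' Y Y')"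
    by (rule *(1)) (auto intro: c category_prod bset_prod prod_biset_cong prod_biset_sum_left prod_biset_sum_right)
  show "tensor_mor R X X' Y Y' (elt X' X \<Omega>) (elt Y' Y \<Psi>) = elt (prod_cat X' Y') (prod_cat X Y) (prod_biset \<Omega> \<Psi>)"
    if "bset X' X \<Omega>" "bset Y' Y \<Psi>" for \<Omega> \<Psi>
    by (rule *(2)) (auto intro: that c category_prod bset_prod prod_biset_cong prod_biset_sum_left prod_biset_sum_right)
qed

text \<open>An expression built from composition and tensor product in which a variable occurs once
  is linear in it. These rules descend along the path to that variable and discharge the side
  conditions.\<close>

lemmas linear_intros =
  bilinear_map_left[OF Comp_bilinear] bilinear_map_right[OF Comp_bilinear]
  bilinear_map_left[OF tm_bilinear] bilinear_map_right[OF tm_bilinear] linear_map_ident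
  module_A bilinear_map_closed[OF Comp_bilinear] bilinear_map_closed[OF tm_bilinear] elt_in bset_id
  finite_category_prod finite_category_unit bset_functor_biset

section \<open>The laws of a linear category\<close>

lemma Comp_assoc:
  assumes fc: "finite_category W" "finite_category X" "finite_category Y" "finite_category Z"
    and f: "f \<in> carrier (A_mod R X W)" and g: "g \<in> carrier (A_mod R Y X)" and h: "h \<in> carrier (A_mod R Z Y)"
  shows "Comp B W Y Z h (Comp B W X Y g f) = Comp B W X Z (Comp B X Y Z h g) f"
proof -
  have 1: "Comp B W Y Z (elt Z Y \<Omega>) (Comp B W X Y (elt Y X \<Psi>) (elt X W \<Theta>)) =
      Comp B W X Z (Comp B X Y Z (elt Z Y \<Omega>) (elt Y X \<Psi>)) (elt X W \<Theta>)"
    if "bset Z Y \<Omega>" "bset Y X \<Psi>" "bset X W \<Theta>" for \<Omega> \<Psi> \<Theta>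
    using that fc
    by (simp add: Comp_elt bset_comp_biset elt_cong[OF _ _ _ _ comp_biset_assoc])
  \<comment> \<open>Bisets are replaced by arbitrary elements one argument at a time, each time
    using linearity in that argument alone. Functoriality of the tensor product and the naturality
    laws are extended from bisets in the same way.\<close>
  have 2: "Comp B W Y Z (elt Z Y \<Omega>) (Comp B W X Y (elt Y X \<Psi>) f) =
      Comp B W X Z (Comp B X Y Z (elt Z Y \<Omega>) (elt Y X \<Psi>)) f"
    if "bset Z Y \<Omega>" "bset Y X \<Psi>" for \<Omega> \<Psi>
    by (rule A_ext[OF _ _ _ f]) (rule linear_intros fc that 1 | assumption)+
  have 3: "Comp B W Y Z (elt Z Y \<Omega>) (Comp B W X Y g f) = Comp B W X Z (Comp B X Y Z (elt Z Y \<Omega>) g) f"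
    if "bset Z Y \<Omega>" for \<Omega>
    by (rule A_ext[OF _ _ _ g]) (rule linear_intros fc f that 2 | assumption)+
  show ?thesis
    by (rule A_ext[OF _ _ _ h]) (rule linear_intros fc f g 3 | assumption)+
qed


lemma Comp_Ident:
  assumes fc: "finite_category X" "finite_category Y" and f: "f \<in> carrier (A_mod R Y X)"
  shows "Comp B X Y Y (elt Y Y (id_biset Y)) f = f" "Comp B X X Y f (elt X X (id_biset X)) = f"
proof -
  \<comment> \<open>Identity bisets are bisets of identity functors, so both unit laws become cases
    of composition with a functor biset.\<close>
  have id: "elt C C (id_biset C) = elt C C (functor_biset C (\<lambda>x. x))" if "finite_category C" for C :: "'b ucat"
    using that
    by (intro elt_cong[symmetric] functor_biset_ident bset_functor_biset ufunctor_id bset_id finite_categoryD)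
  have l: "Comp B X Y Y (elt Y Y (id_biset Y)) (elt Y X \<Omega>) = elt Y X \<Omega>" if "bset Y X \<Omega>" for \<Omega>
  proof -
    have "biset_iso Y X \<Omega> (res_biset (\<lambda>x. x) (\<lambda>x. x) \<Omega>)"
      by (rule biset_isoI_inverse[OF that, where \<eta> = "\<lambda>x y u. u" and \<theta> = "\<lambda>x y u. u"]) simp_all
    then have iso: "biset_iso Y X (comp_biset Y Y X (functor_biset Y (\<lambda>x. x)) \<Omega>) \<Omega>"
      using fc that by (intro comp_functor_biset_left[OF uiso_ident] finite_categoryD)
    have "bset Y X (comp_biset Y Y X (functor_biset Y (\<lambda>x. x)) \<Omega>)"
      using fc that by (intro bset_comp_biset bset_functor_biset ufunctor_id finite_categoryD)
    from elt_cong[OF fc(2,1) this that iso] show ?thesis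
      using fc that by (simp add: id Comp_elt bset_functor_biset ufunctor_id finite_categoryD)
  qed
  have r: "Comp B X X Y (elt Y X \<Omega>) (elt X X (id_biset X)) = elt Y X \<Omega>" if "bset Y X \<Omega>" for \<Omega>
  proof -
    have "biset_iso Y X (comp_biset Y X X \<Omega> (functor_biset X (\<lambda>x. x))) (res_biset (\<lambda>x. x) (\<lambda>x. x) \<Omega>)"
      using fc that by (intro comp_functor_biset_right ufunctor_id finite_categoryD)
    moreover have "biset_iso Y X (res_biset (\<lambda>x. x) (\<lambda>x. x) \<Omega>) \<Omega>"
      using fc that
      by (intro biset_isoI_inverse[OF bset_res[OF ufunctor_id ufunctor_id that], where
            \<eta> = "\<lambda>x y u. u" and \<theta> = "\<lambda>x y u. u"]) (simp_all add: finite_categoryD)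
    moreover have c: "bset Y X (comp_biset Y X X \<Omega> (functor_biset X (\<lambda>x. x)))"
      using fc that by (intro bset_comp_biset bset_functor_biset ufunctor_id finite_categoryD)
    ultimately have "biset_iso Y X (comp_biset Y X X \<Omega> (functor_biset X (\<lambda>x. x))) \<Omega>"
      by (rule biset_iso_trans[rotated 1])
    from elt_cong[OF fc(2,1) c that this] show ?thesis
      using fc that by (simp add: id Comp_elt bset_functor_biset ufunctor_id finite_categoryD)
  qed
  show "Comp B X Y Y (elt Y Y (id_biset Y)) f = f"
    by (rule A_ext[OF _ _ _ f]) (rule linear_intros fc l | assumption)+
  show "Comp B X X Y f (elt X X (id_biset X)) = f"
    by (rule A_ext[OF _ _ _ f]) (rule linear_intros fc r | assumption)+
qed

lemma linear_category_B: "linear_category R (B :: ('a ucat, ('r, 'a) bmor, 'r) lin_category)"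
proof (intro linear_category.intro category.intro linear_category_axioms.intro)
  fix W X Y Z :: "'a ucat" and f g h
  assume "W \<in> Obj B" "X \<in> Obj B" "Y \<in> Obj B" "Z \<in> Obj B" "f \<in> Mor B W X" "g \<in> Mor B X Y" "h \<in> Mor B Y Z"
  then show "Comp B W Y Z h (Comp B W X Y g f) = Comp B W X Z (Comp B X Y Z h g) f"
    by (simp add: Comp_assoc)
qed (simp_all add: R.cring_axioms Comp_Ident elt_in bset_id bilinear_map_closed[OF Comp_bilinear] Comp_bilinear module_A)

section \<open>Zero object and biproducts\<close>

definition zero_like :: "'a ucat \<Rightarrow> 'a ucat \<Rightarrow> 'a ubiset \<Rightarrow> bool" where
  "zero_like C D \<Omega> \<longleftrightarrow> (\<forall>x\<in>Obj C. \<forall>y\<in>Obj D. el \<Omega> x y = {})"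

lemma elt_zero:
  assumes fc: "finite_category C" "finite_category D" and \<Omega>: "bset C D \<Omega>" and "zero_like C D \<Omega>"
  shows "elt C D \<Omega> = \<zero>\<^bsub>A_mod R C D\<^esub>"
proof -
  interpret A: module R "A_mod R C D" by (rule module_A[OF fc])
  have "elt C D \<Omega> = elt C D \<Omega> \<oplus>\<^bsub>A_mod R C D\<^esub> elt C D \<Omega>"
    using assms elt_cong[OF fc \<Omega> bset_sum[OF \<Omega> \<Omega>] biset_iso_empty[OF \<Omega>]]
    by (simp add: elt_sum zero_like_def)
  then show ?thesis
    using elt_in[OF fc \<Omega>] A.add.l_cancel_one' by metis
qed

lemma A_mod_zero:
  assumes fc: "finite_category C" "finite_category D" and "Obj C = {} \<or> Obj D = {}"
  shows "carrier (A_mod R C D) = {\<zero>\<^bsub>A_mod R C D\<^esub>}"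
proof -
  interpret A: module R "A_mod R C D" by (rule module_A[OF fc])
  have zero: "linear_map R (A_mod R C D) (A_mod R C D) (\<lambda>_. \<zero>\<^bsub>A_mod R C D\<^esub>)"
    by (simp add: linear_map_def A.smult_r_null)
  have "a = \<zero>\<^bsub>A_mod R C D\<^esub>" if a: "a \<in> carrier (A_mod R C D)" for a
  proof (rule A_ext[OF linear_map_ident zero _ a module_A[OF fc] fc])
    show "elt C D \<Omega> = \<zero>\<^bsub>A_mod R C D\<^esub>" if "bset C D \<Omega>" for \<Omega>
      using elt_zero[OF fc that] assms(3) by (auto simp: zero_like_def)
  qed
  then show ?thesis by auto
qed

lemma zero_object_empty_cat: "zero_object B empty_cat"
  by (simp add: zero_object_def finite_category_empty A_mod_zero empty_cat_def[THEN arg_cong[where f = Obj]])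

lemma is_biproduct_sum_cat:
  assumes X: "finite_category X" and Y: "finite_category Y"
  defines "S \<equiv> sum_cat X Y"
  shows "is_biproduct B X Y S (elt S X (functor_biset S UInl)) (elt S Y (functor_biset S UInr))
    (elt X S (cofunctor_biset S UInl)) (elt Y S (cofunctor_biset S UInr))"
proof -
  have S: "finite_category S"
    unfolding S_def by (rule finite_category_sum[OF X Y])
  note cat = finite_categoryD(1)[OF X] finite_categoryD(1)[OF Y]
  interpret l: component X S UInl
    using component_sum_cat(1)[OF cat] S by (simp add: S_def finite_categoryD)
  interpret r: component Y S UInr
    using component_sum_cat(2)[OF cat] S by (simp add: S_def finite_categoryD)
  note bsets = bset_functor_biset[OF l.ufunctor_axioms S] bset_functor_biset[OF r.ufunctor_axioms S]
    bset_cofunctor_biset[OF l.ufunctor_axioms S] bset_cofunctor_biset[OF r.ufunctor_axioms S]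
  have zero: "Comp B Y S X (elt X S (cofunctor_biset S UInl)) (elt S Y (functor_biset S UInr)) = \<zero>\<^bsub>A_mod R X Y\<^esub>"
    "Comp B X S Y (elt Y S (cofunctor_biset S UInr)) (elt S X (functor_biset S UInl)) = \<zero>\<^bsub>A_mod R Y X\<^esub>"
  proof -
    \<comment> \<open>A balanced pair at an object \<open>s\<close> of \<open>S\<close> would need a
      morphism between \<open>s\<close> and an object of each half, but \<open>s\<close> lies in
      only one half.\<close>
    have "zero_like X Y (comp_biset X S Y (cofunctor_biset S UInl) (functor_biset S UInr))"
      "zero_like Y X (comp_biset Y S X (cofunctor_biset S UInr) (functor_biset S UInl))"
      by (auto simp: zero_like_def comp_biset_def bal_pairs_def S_def)
    then show "Comp B Y S X (elt X S (cofunctor_biset S UInl)) (elt S Y (functor_biset S UInr)) = \<zero>\<^bsub>A_mod R X Y\<^esub>"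
      "Comp B X S Y (elt Y S (cofunctor_biset S UInr)) (elt S X (functor_biset S UInl)) = \<zero>\<^bsub>A_mod R Y X\<^esub>"
      using X Y S bsets by (simp_all add: Comp_elt elt_zero bset_comp_biset)
  qed
  let ?L = "part_biset S (UInl ` Obj X)" and ?R = "part_biset S (UInr ` Obj Y)"
  have parts: "bset S S ?L" "bset S S ?R"
    by (rule bset_part[OF S]; use l.closed r.closed in blast)+
  \<comment> \<open>Each injection after its projection is the part of the identity biset over one
    half, and the two parts add up to the identity.\<close>
  have "elt S S (comp_biset S X S (functor_biset S UInl) (cofunctor_biset S UInl)) \<oplus>\<^bsub>A_mod R S S\<^esub>
      elt S S (comp_biset S Y S (functor_biset S UInr) (cofunctor_biset S UInr)) =
      elt S S ?L \<oplus>\<^bsub>A_mod R S S\<^esub> elt S S ?R"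
    using X Y S bsets parts
      elt_cong[OF S S bset_comp_biset[OF X bsets(1,3)] parts(1) l.functor_cofunctor_biset[OF X S]]
      elt_cong[OF S S bset_comp_biset[OF Y bsets(2,4)] parts(2) r.functor_cofunctor_biset[OF Y S]]
    by simp
  also have "\<dots> = elt S S (sum_biset ?L ?R)"
    by (rule elt_sum[OF S S parts, symmetric])
  also have "\<dots> = elt S S (id_biset S)"
    by (rule elt_cong[OF S S bset_sum[OF parts] bset_id[OF S] sum_part_biset[OF S parts _ _ l.closed]])
      (auto simp: S_def)
  finally show ?thesis
    using X Y S bsets zero
      elt_cong[OF X X bset_id[OF X] bset_comp_biset[OF S bsets(3,1)] l.cofunctor_functor_biset[OF X S]]
      elt_cong[OF Y Y bset_id[OF Y] bset_comp_biset[OF S bsets(4,2)] r.cofunctor_functor_biset[OF Y S]]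
    by (simp add: is_biproduct_def elt_in Comp_elt)
qed

lemma additive_linear_category_B:
  "additive_linear_category R (B :: ('a ucat, ('r, 'a) bmor, 'r) lin_category)"
proof -
  interpret L: linear_category R "B :: ('a ucat, ('r, 'a) bmor, 'r) lin_category"
    by (rule linear_category_B)
  show ?thesis
  proof unfold_locales
    show "\<exists>Z. zero_object B Z"
      using zero_object_empty_cat by blast
    show "\<exists>S i j p q. is_biproduct B X Y S i j p q" if "X \<in> Obj B" "Y \<in> Obj B" for X Y :: "'a ucat"
      using is_biproduct_sum_cat that by fastforce
  qed
qed

section \<open>Morphisms induced by functors\<close>

definition functor_elt :: "'a ucat \<Rightarrow> 'a ucat \<Rightarrow> ('a univ \<Rightarrow> 'a univ) \<Rightarrow> ('r, 'a) bmor" where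
  "functor_elt X Y \<phi> = elt Y X (functor_biset Y \<phi>)"

text \<open>A relation rather than a function, so that the functor of a compound morphism can be
  built by resolution from the functors of its pieces, with the finiteness and functor conditions
  carried along.\<close>

definition induced :: "'a ucat \<Rightarrow> 'a ucat \<Rightarrow> ('r, 'a) bmor \<Rightarrow> ('a univ \<Rightarrow> 'a univ) \<Rightarrow> bool" where
  "induced X Y f \<phi> \<longleftrightarrow> finite_category X \<and> finite_category Y \<and> ufunctor X Y \<phi> \<and> f = functor_elt X Y \<phi>"

lemma induced_in: "induced X Y f \<phi> \<Longrightarrow> f \<in> carrier (A_mod R Y X)"
  by (simp add: induced_def functor_elt_def elt_in bset_functor_biset)

lemma functor_elt_induced:
  "\<lbrakk>uiso X Y \<phi> \<psi>; finite_category X; finite_category Y\<rbrakk> \<Longrightarrow> induced X Y (functor_elt X Y \<phi>) \<phi>"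
  by (simp add: induced_def uiso_def)

lemma Ident_induced:
  assumes "finite_category X"
  shows "induced X X (Ident B X) (\<lambda>x. x)"
proof -
  have "elt X X (id_biset X) = elt X X (functor_biset X (\<lambda>x. x))"
    using assms
    by (intro elt_cong[symmetric] functor_biset_ident bset_functor_biset ufunctor_id bset_id finite_categoryD)
  with assms show ?thesis
    by (simp add: induced_def functor_elt_def ufunctor_id finite_categoryD)
qed

lemma Comp_induced:
  assumes "induced Y Z g \<psi>" "induced X Y f \<phi>"
  shows "induced X Z (Comp B X Y Z g f) (\<lambda>x. \<psi> (\<phi> x))"
proof -
  have h: "finite_category X" "finite_category Y" "finite_category Z" "ufunctor X Y \<phi>" "ufunctor Y Z \<psi>"
    "g = functor_elt Y Z \<psi>" "f = functor_elt X Y \<phi>"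
    using assms by (simp_all add: induced_def)
  note b = bset_functor_biset[OF h(4,2)] bset_functor_biset[OF h(5,3)]
  have "elt Z X (comp_biset Z Y X (functor_biset Z \<psi>) (functor_biset Y \<phi>)) =
      elt Z X (functor_biset Z (\<lambda>x. \<psi> (\<phi> x)))"
    by (rule elt_cong[OF h(3,1) bset_comp_biset[OF h(2) b(2,1)] bset_functor_biset[OF ufunctor_comp[OF h(4,5)] h(3)]
          functor_biset_comp[OF h(4,5,2,3)]])
  then show ?thesis
    using h b by (simp add: induced_def functor_elt_def Comp_elt ufunctor_comp[OF h(4,5)])
qed

lemma tensor_induced:
  assumes "induced X X' f \<phi>" "induced Y Y' g \<psi>"
  shows "induced (prod_cat X Y) (prod_cat X' Y') (tensor_mor R X X' Y Y' f g) (map_pair \<phi> \<psi>)"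
proof -
  have h: "finite_category X" "finite_category X'" "finite_category Y" "finite_category Y'"
    "ufunctor X X' \<phi>" "ufunctor Y Y' \<psi>" "f = functor_elt X X' \<phi>" "g = functor_elt Y Y' \<psi>"
    using assms by (simp_all add: induced_def)
  note b = bset_functor_biset[OF h(5,2)] bset_functor_biset[OF h(6,4)]
  have "elt (prod_cat X' Y') (prod_cat X Y) (prod_biset (functor_biset X' \<phi>) (functor_biset Y' \<psi>)) =
      elt (prod_cat X' Y') (prod_cat X Y) (functor_biset (prod_cat X' Y') (map_pair \<phi> \<psi>))"
    by (rule elt_cong[OF finite_category_prod[OF h(2,4)] finite_category_prod[OF h(1,3)] bset_prod[OF b]
          bset_functor_biset[OF ufunctor_map_pair[OF h(5,6)] finite_category_prod[OF h(2,4)]]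
          prod_functor_biset[OF h(5,6,2,4)]])
  then show ?thesis
    using h b by (simp add: induced_def functor_elt_def tm_elt ufunctor_map_pair finite_category_prod)
qed

text \<open>Here coherence becomes combinatorics: it is left to compare two functors on objects and
  morphisms, which for the structure functors is an identity between nested pairs.\<close>

lemma induced_unique:
  assumes f: "induced X Y f \<phi>" and g: "induced X Y g \<psi>"
    and Obj: "\<And>x. x \<in> Obj X \<Longrightarrow> \<phi> x = \<psi> x"
    and Mor: "\<And>x y m. \<lbrakk>x \<in> Obj X; y \<in> Obj X; m \<in> Mor X x y\<rbrakk> \<Longrightarrow> \<phi> m = \<psi> m"
  shows "f = g"
proof -
  have h: "finite_category X" "finite_category Y" "ufunctor X Y \<phi>" "ufunctor X Y \<psi>"
    "f = functor_elt X Y \<phi>" "g = functor_elt X Y \<psi>"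
    using f g by (simp_all add: induced_def)
  show ?thesis
    unfolding h(5,6) functor_elt_def
    by (rule elt_cong[OF h(2,1) bset_functor_biset[OF h(3,2)] bset_functor_biset[OF h(4,2)]
          functor_biset_cong[OF h(3,4,2) Obj Mor]])
qed

text \<open>The inverse functor induces the inverse morphism, since both composites are induced by
  functors that agree with identity functors.\<close>

lemma induced_iso_arrow:
  assumes iso: "uiso X Y \<phi> \<psi>" and fc: "finite_category X" "finite_category Y"
  shows "iso_arrow B X Y (functor_elt X Y \<phi>)"
proof -
  interpret uiso X Y \<phi> \<psi> by fact
  have f: "induced X Y (functor_elt X Y \<phi>) \<phi>" and g: "induced Y X (functor_elt Y X \<psi>) \<psi>"
    using fc ufunctor_axioms inv.ufunctor_axioms by (simp_all add: induced_def)
  have "Comp B X Y X (functor_elt Y X \<psi>) (functor_elt X Y \<phi>) = Ident B X"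
    by (rule induced_unique[OF Comp_induced[OF g f] Ident_induced[OF fc(1)]]) simp_all
  moreover have "Comp B Y X Y (functor_elt X Y \<phi>) (functor_elt Y X \<psi>) = Ident B Y"
    by (rule induced_unique[OF Comp_induced[OF f g] Ident_induced[OF fc(2)]]) simp_all
  ultimately show ?thesis
    using induced_in[OF f] induced_in[OF g] unfolding iso_arrow_def B_simps(2) by blast
qed

text \<open>The common form of all naturality squares on bisets. The premise \<open>iso\<close> is
  supplied by the associativity, symmetry and unit isomorphisms of product bisets.\<close>

lemma functor_elt_square:
  assumes \<phi>': "uiso X' Y' \<phi>' \<psi>'" and \<phi>: "uiso X Y \<phi> \<psi>"
    and fc: "finite_category X" "finite_category X'" "finite_category Y" "finite_category Y'"
    and \<Omega>: "bset X' X \<Omega>1" "bset Y' Y \<Omega>2" and iso: "biset_iso X' X \<Omega>1 (res_biset \<phi>' \<phi> \<Omega>2)"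
  shows "Comp B X X' Y' (functor_elt X' Y' \<phi>') (elt X' X \<Omega>1) =
    Comp B X Y Y' (elt Y' Y \<Omega>2) (functor_elt X Y \<phi>)"
proof -
  have u: "ufunctor X Y \<phi>" "ufunctor X' Y' \<phi>'"
    using \<phi> \<phi>' by (simp_all add: uiso_def)
  note b = bset_functor_biset[OF u(1) fc(3)] bset_functor_biset[OF u(2) fc(4)]
  have "elt Y' X (comp_biset Y' X' X (functor_biset Y' \<phi>') \<Omega>1) =
      elt Y' X (comp_biset Y' Y X \<Omega>2 (functor_biset Y \<phi>))"
    by (rule elt_cong[OF fc(4,1) bset_comp_biset[OF fc(2) b(2) \<Omega>(1)] bset_comp_biset[OF fc(3) \<Omega>(2) b(1)]
          functor_biset_square[OF \<phi>' u(1) fc(2,4,3) \<Omega> iso]])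
  then show ?thesis
    using fc \<Omega> b by (simp add: functor_elt_def Comp_elt)
qed

section \<open>The structure morphisms\<close>

definition associator :: "'a ucat \<Rightarrow> 'a ucat \<Rightarrow> 'a ucat \<Rightarrow> ('r, 'a) bmor" where
  "associator X Y Z = functor_elt (prod_cat (prod_cat X Y) Z) (prod_cat X (prod_cat Y Z)) assoc"

definition lunitor :: "'a ucat \<Rightarrow> ('r, 'a) bmor" where
  "lunitor X = functor_elt (prod_cat unit_cat X) X usnd"

definition runitor :: "'a ucat \<Rightarrow> ('r, 'a) bmor" where
  "runitor X = functor_elt (prod_cat X unit_cat) X ufst"

definition braiding :: "'a ucat \<Rightarrow> 'a ucat \<Rightarrow> ('r, 'a) bmor" where
  "braiding X Y = functor_elt (prod_cat X Y) (prod_cat Y X) swap"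

lemmas uisos = uiso_assoc[OF finite_categoryD(1) finite_categoryD(1) finite_categoryD(1)]
  uiso_lunit[OF finite_categoryD(1)] uiso_runit[OF finite_categoryD(1)]
  uiso_swap[OF finite_categoryD(1) finite_categoryD(1)]

lemmas fcs = finite_category_prod finite_category_unit

lemma structure_induced:
  "\<lbrakk>finite_category X; finite_category Y; finite_category Z\<rbrakk> \<Longrightarrow>
    induced (prod_cat (prod_cat X Y) Z) (prod_cat X (prod_cat Y Z)) (associator X Y Z) assoc"
  "finite_category X \<Longrightarrow> induced (prod_cat unit_cat X) X (lunitor X) usnd"
  "finite_category X \<Longrightarrow> induced (prod_cat X unit_cat) X (runitor X) ufst"
  "\<lbrakk>finite_category X; finite_category Y\<rbrakk> \<Longrightarrow> induced (prod_cat X Y) (prod_cat Y X) (braiding X Y) swap"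
  unfolding associator_def lunitor_def runitor_def braiding_def
  by (rule functor_elt_induced; (rule uisos fcs | assumption)+)+

lemma structure_iso:
  "\<lbrakk>finite_category X; finite_category Y; finite_category Z\<rbrakk> \<Longrightarrow>
    iso_arrow B (prod_cat (prod_cat X Y) Z) (prod_cat X (prod_cat Y Z)) (associator X Y Z)"
  "finite_category X \<Longrightarrow> iso_arrow B (prod_cat unit_cat X) X (lunitor X)"
  "finite_category X \<Longrightarrow> iso_arrow B (prod_cat X unit_cat) X (runitor X)"
  unfolding associator_def lunitor_def runitor_def
  by (rule induced_iso_arrow; (rule uisos fcs | assumption)+)+

lemmas closed_intros = linear_intros induced_in[OF structure_induced(1)] induced_in[OF structure_induced(2)]
  induced_in[OF structure_induced(3)] induced_in[OF structure_induced(4)]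

section \<open>Functoriality of the tensor product and naturality of the structure morphisms\<close>

lemma tensor_Comp:
  assumes fc: "finite_category X" "finite_category X'" "finite_category X''"
      "finite_category Y" "finite_category Y'" "finite_category Y''"
    and f: "f \<in> carrier (A_mod R X' X)" and f': "f' \<in> carrier (A_mod R X'' X')"
    and g: "g \<in> carrier (A_mod R Y' Y)" and g': "g' \<in> carrier (A_mod R Y'' Y')"
  shows "tensor_mor R X X'' Y Y'' (Comp B X X' X'' f' f) (Comp B Y Y' Y'' g' g) =
    Comp B (prod_cat X Y) (prod_cat X' Y') (prod_cat X'' Y'')
      (tensor_mor R X' X'' Y' Y'' f' g') (tensor_mor R X X' Y Y' f g)"
    (is "?l f' f g' g = ?r f' f g' g")
proof -
  have 1: "?l (elt X'' X' \<Omega>') (elt X' X \<Omega>) (elt Y'' Y' \<Psi>') (elt Y' Y \<Psi>) =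
      ?r (elt X'' X' \<Omega>') (elt X' X \<Omega>) (elt Y'' Y' \<Psi>') (elt Y' Y \<Psi>)"
    if b: "bset X'' X' \<Omega>'" "bset X' X \<Omega>" "bset Y'' Y' \<Psi>'" "bset Y' Y \<Psi>" for \<Omega> \<Omega>' \<Psi> \<Psi>'
  proof -
    have "elt (prod_cat X'' Y'') (prod_cat X Y)
          (prod_biset (comp_biset X'' X' X \<Omega>' \<Omega>) (comp_biset Y'' Y' Y \<Psi>' \<Psi>)) =
        elt (prod_cat X'' Y'') (prod_cat X Y)
          (comp_biset (prod_cat X'' Y'') (prod_cat X' Y') (prod_cat X Y) (prod_biset \<Omega>' \<Psi>') (prod_biset \<Omega> \<Psi>))"
      using fc b
      by (intro elt_cong[symmetric] prod_biset_interchange fcs bset_comp_biset bset_prod)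
    then show ?thesis
      using fc b by (simp add: Comp_elt tm_elt bset_comp_biset bset_prod fcs)
  qed
  have 2: "?l (elt X'' X' \<Omega>') (elt X' X \<Omega>) (elt Y'' Y' \<Psi>') g =
      ?r (elt X'' X' \<Omega>') (elt X' X \<Omega>) (elt Y'' Y' \<Psi>') g"
    if b: "bset X'' X' \<Omega>'" "bset X' X \<Omega>" "bset Y'' Y' \<Psi>'" for \<Omega> \<Omega>' \<Psi>'
    by (rule A_ext[OF _ _ _ g]) (rule linear_intros fc that 1 | assumption)+
  have 3: "?l (elt X'' X' \<Omega>') (elt X' X \<Omega>) g' g = ?r (elt X'' X' \<Omega>') (elt X' X \<Omega>) g' g"
    if b: "bset X'' X' \<Omega>'" "bset X' X \<Omega>" for \<Omega> \<Omega>'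
    by (rule A_ext[OF _ _ _ g']) (rule linear_intros fc that g 2 | assumption)+
  have 4: "?l (elt X'' X' \<Omega>') f g' g = ?r (elt X'' X' \<Omega>') f g' g" if b: "bset X'' X' \<Omega>'" for \<Omega>'
    by (rule A_ext[OF _ _ _ f]) (rule linear_intros fc that g g' 3 | assumption)+
  show ?thesis
    by (rule A_ext[OF _ _ _ f']) (rule linear_intros fc f g g' 4 | assumption)+
qed

lemma associator_natural:
  assumes fc: "finite_category X" "finite_category X'" "finite_category Y" "finite_category Y'"
      "finite_category Z" "finite_category Z'"
    and f: "f \<in> carrier (A_mod R X' X)" and g: "g \<in> carrier (A_mod R Y' Y)" and h: "h \<in> carrier (A_mod R Z' Z)"
  shows "Comp B (prod_cat (prod_cat X Y) Z) (prod_cat (prod_cat X' Y') Z') (prod_cat X' (prod_cat Y' Z'))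
        (associator X' Y' Z')
        (tensor_mor R (prod_cat X Y) (prod_cat X' Y') Z Z' (tensor_mor R X X' Y Y' f g) h) =
      Comp B (prod_cat (prod_cat X Y) Z) (prod_cat X (prod_cat Y Z)) (prod_cat X' (prod_cat Y' Z'))
        (tensor_mor R X X' (prod_cat Y Z) (prod_cat Y' Z') f (tensor_mor R Y Y' Z Z' g h)) (associator X Y Z)"
    (is "?l f g h = ?r f g h")
proof -
  have 1: "?l (elt X' X \<Omega>) (elt Y' Y \<Psi>) (elt Z' Z \<Theta>) = ?r (elt X' X \<Omega>) (elt Y' Y \<Psi>) (elt Z' Z \<Theta>)"
    if b: "bset X' X \<Omega>" "bset Y' Y \<Psi>" "bset Z' Z \<Theta>" for \<Omega> \<Psi> \<Theta>
  proof -
    have "Comp B (prod_cat (prod_cat X Y) Z) (prod_cat (prod_cat X' Y') Z') (prod_cat X' (prod_cat Y' Z'))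
          (associator X' Y' Z') (elt (prod_cat (prod_cat X' Y') Z') (prod_cat (prod_cat X Y) Z)
            (prod_biset (prod_biset \<Omega> \<Psi>) \<Theta>)) =
        Comp B (prod_cat (prod_cat X Y) Z) (prod_cat X (prod_cat Y Z)) (prod_cat X' (prod_cat Y' Z'))
          (elt (prod_cat X' (prod_cat Y' Z')) (prod_cat X (prod_cat Y Z))
            (prod_biset \<Omega> (prod_biset \<Psi> \<Theta>))) (associator X Y Z)"
      unfolding associator_def
      by (rule functor_elt_square) (rule uisos fcs fc bset_prod prod_biset_assoc b)+
    then show ?thesis
      using fc b by (simp add: tm_elt bset_prod fcs)
  qed
  have 2: "?l (elt X' X \<Omega>) (elt Y' Y \<Psi>) h = ?r (elt X' X \<Omega>) (elt Y' Y \<Psi>) h"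
    if "bset X' X \<Omega>" "bset Y' Y \<Psi>" for \<Omega> \<Psi>
    by (rule A_ext[OF _ _ _ h]) (rule closed_intros fc that 1 | assumption)+
  have 3: "?l (elt X' X \<Omega>) g h = ?r (elt X' X \<Omega>) g h" if "bset X' X \<Omega>" for \<Omega>
    by (rule A_ext[OF _ _ _ g]) (rule closed_intros fc that h 2 | assumption)+
  show ?thesis
    by (rule A_ext[OF _ _ _ f]) (rule closed_intros fc g h 3 | assumption)+
qed

lemma lunitor_natural:
  assumes fc: "finite_category X" "finite_category X'" and f: "f \<in> carrier (A_mod R X' X)"
  shows "Comp B (prod_cat unit_cat X) (prod_cat unit_cat X') X' (lunitor X')
      (tensor_mor R unit_cat unit_cat X X' (Ident B unit_cat) f) =
    Comp B (prod_cat unit_cat X) X X' f (lunitor X)" (is "?l f = ?r f")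
proof -
  have 1: "?l (elt X' X \<Omega>) = ?r (elt X' X \<Omega>)" if b: "bset X' X \<Omega>" for \<Omega>
  proof -
    have "Comp B (prod_cat unit_cat X) (prod_cat unit_cat X') X' (lunitor X')
        (elt (prod_cat unit_cat X') (prod_cat unit_cat X) (prod_biset (id_biset unit_cat) \<Omega>)) = ?r (elt X' X \<Omega>)"
      unfolding lunitor_def
      by (rule functor_elt_square) (rule uisos fcs fc bset_prod bset_id prod_biset_lunit b)+
    then show ?thesis
      using fc b by (simp add: tm_elt bset_id fcs)
  qed
  show ?thesis
    \<comment> \<open>The identity is written as the class of a biset, so that \<open>elt_in\<close>
      and \<open>bset_id\<close> show that it lies in its module.\<close>
    unfolding B_simps(4)
    by (rule A_ext[OF _ _ _ f]) (rule closed_intros fc 1[unfolded B_simps(4)] | assumption)+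
qed

lemma runitor_natural:
  assumes fc: "finite_category X" "finite_category X'" and f: "f \<in> carrier (A_mod R X' X)"
  shows "Comp B (prod_cat X unit_cat) (prod_cat X' unit_cat) X' (runitor X')
      (tensor_mor R X X' unit_cat unit_cat f (Ident B unit_cat)) =
    Comp B (prod_cat X unit_cat) X X' f (runitor X)" (is "?l f = ?r f")
proof -
  have 1: "?l (elt X' X \<Omega>) = ?r (elt X' X \<Omega>)" if b: "bset X' X \<Omega>" for \<Omega>
  proof -
    have "Comp B (prod_cat X unit_cat) (prod_cat X' unit_cat) X' (runitor X')
        (elt (prod_cat X' unit_cat) (prod_cat X unit_cat) (prod_biset \<Omega> (id_biset unit_cat))) = ?r (elt X' X \<Omega>)"
      unfolding runitor_def
      by (rule functor_elt_square) (rule uisos fcs fc bset_prod bset_id prod_biset_runit b)+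
    then show ?thesis
      using fc b by (simp add: tm_elt bset_id fcs)
  qed
  show ?thesis
    unfolding B_simps(4)
    by (rule A_ext[OF _ _ _ f]) (rule closed_intros fc 1[unfolded B_simps(4)] | assumption)+
qed

lemma braiding_natural:
  assumes fc: "finite_category X" "finite_category X'" "finite_category Y" "finite_category Y'"
    and f: "f \<in> carrier (A_mod R X' X)" and g: "g \<in> carrier (A_mod R Y' Y)"
  shows "Comp B (prod_cat X Y) (prod_cat X' Y') (prod_cat Y' X') (braiding X' Y') (tensor_mor R X X' Y Y' f g) =
    Comp B (prod_cat X Y) (prod_cat Y X) (prod_cat Y' X') (tensor_mor R Y Y' X X' g f) (braiding X Y)"
    (is "?l f g = ?r f g")
proof -
  have 1: "?l (elt X' X \<Omega>) (elt Y' Y \<Psi>) = ?r (elt X' X \<Omega>) (elt Y' Y \<Psi>)"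
    if b: "bset X' X \<Omega>" "bset Y' Y \<Psi>" for \<Omega> \<Psi>
  proof -
    have "Comp B (prod_cat X Y) (prod_cat X' Y') (prod_cat Y' X') (braiding X' Y')
          (elt (prod_cat X' Y') (prod_cat X Y) (prod_biset \<Omega> \<Psi>)) =
        Comp B (prod_cat X Y) (prod_cat Y X) (prod_cat Y' X')
          (elt (prod_cat Y' X') (prod_cat Y X) (prod_biset \<Psi> \<Omega>)) (braiding X Y)"
      unfolding braiding_def
      by (rule functor_elt_square) (rule uisos fcs fc bset_prod prod_biset_swap b)+
    then show ?thesis
      using fc b by (simp add: tm_elt)
  qed
  have 2: "?l (elt X' X \<Omega>) g = ?r (elt X' X \<Omega>) g" if "bset X' X \<Omega>" for \<Omega>
    by (rule A_ext[OF _ _ _ g]) (rule closed_intros fc that 1 | assumption)+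
  show ?thesis
    by (rule A_ext[OF _ _ _ f]) (rule closed_intros fc g 2 | assumption)+
qed

section \<open>Coherence and the tensor category\<close>

lemmas coherence = Comp_induced tensor_induced Ident_induced structure_induced fcs

lemma symmetric_monoidal_category_B:
  "symmetric_monoidal_category (B :: ('a ucat, ('r, 'a) bmor, 'r) lin_category) prod_cat (tensor_mor R) unit_cat
    associator lunitor runitor braiding"
proof -
  interpret L: linear_category R "B :: ('a ucat, ('r, 'a) bmor, 'r) lin_category"
    by (rule linear_category_B)
  show ?thesis
  proof (unfold_locales, unfold B_simps(1,2))
    fix X Y :: "'a ucat" assume fc: "finite_category X" "finite_category Y"
    show "finite_category (prod_cat X Y)"
      by (rule finite_category_prod[OF fc])
    show "tensor_mor R X X Y Y (Ident B X) (Ident B Y) = Ident B (prod_cat X Y)"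
      by (rule induced_unique[where \<phi> = "map_pair (\<lambda>x. x) (\<lambda>x. x)" and \<psi> = "\<lambda>x. x"])
        ((rule coherence fc)+, auto elim!: pairE)
    show "braiding X Y \<in> carrier (A_mod R (prod_cat Y X) (prod_cat X Y))"
      by (rule induced_in[OF structure_induced(4)[OF fc]])
    show "Comp B (prod_cat (prod_cat X unit_cat) Y) (prod_cat X (prod_cat unit_cat Y)) (prod_cat X Y)
        (tensor_mor R X X (prod_cat unit_cat Y) Y (Ident B X) (lunitor Y)) (associator X unit_cat Y) =
        tensor_mor R (prod_cat X unit_cat) X Y Y (runitor X) (Ident B Y)"
      \<comment> \<open>The functors of the two sides are unknowns here. The rules
        \<open>coherence\<close> construct them along the syntax of the morphisms, and what is left
        is their agreement on nested pairs.\<close>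
      by (rule induced_unique) ((rule coherence fc)+, auto elim!: pairE)
    show "Comp B (prod_cat X Y) (prod_cat Y X) (prod_cat X Y) (braiding Y X) (braiding X Y) = Ident B (prod_cat X Y)"
      by (rule induced_unique) ((rule coherence fc)+, auto elim!: pairE)
    fix Z :: "'a ucat" assume fc': "finite_category Z"
    show "Comp B (prod_cat (prod_cat X Y) Z) (prod_cat (prod_cat Y Z) X) (prod_cat Y (prod_cat Z X)) (associator Y Z X)
        (Comp B (prod_cat (prod_cat X Y) Z) (prod_cat X (prod_cat Y Z)) (prod_cat (prod_cat Y Z) X)
          (braiding X (prod_cat Y Z)) (associator X Y Z)) =
        Comp B (prod_cat (prod_cat X Y) Z) (prod_cat Y (prod_cat X Z)) (prod_cat Y (prod_cat Z X))
          (tensor_mor R Y Y (prod_cat X Z) (prod_cat Z X) (Ident B Y) (braiding X Z))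
          (Comp B (prod_cat (prod_cat X Y) Z) (prod_cat (prod_cat Y X) Z) (prod_cat Y (prod_cat X Z))
            (associator Y X Z) (tensor_mor R (prod_cat X Y) (prod_cat Y X) Z Z (braiding X Y) (Ident B Z)))"
      by (rule induced_unique) ((rule coherence fc fc')+, auto elim!: pairE)
    fix W :: "'a ucat" assume fc'': "finite_category W"
    show "Comp B (prod_cat (prod_cat (prod_cat X Y) Z) W) (prod_cat (prod_cat X Y) (prod_cat Z W))
          (prod_cat X (prod_cat Y (prod_cat Z W)))
          (associator X Y (prod_cat Z W)) (associator (prod_cat X Y) Z W) =
        Comp B (prod_cat (prod_cat (prod_cat X Y) Z) W) (prod_cat X (prod_cat (prod_cat Y Z) W))
          (prod_cat X (prod_cat Y (prod_cat Z W)))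
          (tensor_mor R X X (prod_cat (prod_cat Y Z) W) (prod_cat Y (prod_cat Z W)) (Ident B X) (associator Y Z W))
          (Comp B (prod_cat (prod_cat (prod_cat X Y) Z) W) (prod_cat (prod_cat X (prod_cat Y Z)) W)
            (prod_cat X (prod_cat (prod_cat Y Z) W))
            (associator X (prod_cat Y Z) W)
            (tensor_mor R (prod_cat (prod_cat X Y) Z) (prod_cat X (prod_cat Y Z)) W W (associator X Y Z) (Ident B W)))"
      by (rule induced_unique) ((rule coherence fc fc' fc'')+, auto elim!: pairE)
  qed (rule bilinear_map_closed[OF tm_bilinear] finite_category_unit structure_iso tensor_Comp
      associator_natural lunitor_natural runitor_natural braiding_natural | assumption)+
qed

lemma tensor_category_B:
  "tensor_category R (B :: ('a ucat, ('r, 'a) bmor, 'r) lin_category) prod_cat (tensor_mor R) unit_cat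
    associator lunitor runitor braiding"
  by (intro tensor_category.intro tensor_category_axioms.intro additive_linear_category_B
      symmetric_monoidal_category_B) (simp add: tm_bilinear)

end

theorem proposition9p1:
  fixes R :: "('r, 'k) ring_scheme"
  assumes "cring R"
  shows "\<exists>a l r s. tensor_category R (biset_category R :: ('a ucat, ('r, 'a) bmor, 'r) lin_category)
           prod_cat (tensor_mor R) unit_cat a l r s"
proof -
  interpret biset_cat R
    by (rule biset_cat.intro[OF assms])
  show ?thesis
    using tensor_category_B by blast
qed

end
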